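(* For every $\alpha'>0$ there exist constants $c>0$ and $C\geq 1$ such that for every function $p=p(n)\in(0,1]$ with $p\geq C(\log n/n)^{1/2}$, asymptotically almost surely (i.e. with probability tending to $1$ as $n\to\infty$) the binomial random graph $G\in G(n,p)$ satisfies the following: every subgraph $H\subseteq G$ with $e(H)\geq \alpha' e(G)$ contains a copy of the grid graph $G_{s,s}$ for any positive integer $s\leq \frac{c}{p}$.
   Context: $G(n,p)$ is the binomial random graph on vertex set $[n]=\{1,\dots,n\}$, in which each of the $\binom n2$ possible edges is included independently with probability $p=p(n)$. For a graph $F$, $e(F)$ denotes its number of edges. The $s\times t$ grid graph $G_{s,t}$ has vertex set $[s]\times[t]$, and $uv$ is an edge if and only if $u$ and $v$ differ in exactly one coordinate, by exactly one. A copy of a graph $F$ in $H$ is a (not necessarily induced) subgraph of $H$ isomorphic to $F$. *)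

theory Defs
  imports "HOL-Probability.Probability" "HOL-Library.Ramsey"
begin

type_synonym 'a ugraph = "'a set \<times> 'a set set"

abbreviation verts :: "'a ugraph \<Rightarrow> 'a set" where
  "verts G \<equiv> fst G"

abbreviation edges :: "'a ugraph \<Rightarrow> 'a set set" where
  "edges G \<equiv> snd G"

definition simple_graph :: "'a ugraph \<Rightarrow> bool" where
  "simple_graph G \<longleftrightarrow> edges G \<subseteq> [verts G]\<^bsup>2\<^esup>"

definition num_edges :: "'a ugraph \<Rightarrow> nat" where
  "num_edges G = card (edges G)"

definition subgraph :: "'a ugraph \<Rightarrow> 'a ugraph \<Rightarrow> bool" where
  "subgraph H G \<longleftrightarrow> simple_graph H \<and> verts H \<subseteq> verts G \<and> edges H \<subseteq> edges G"

definition isomorphic :: "'a ugraph \<Rightarrow> 'b ugraph \<Rightarrow> bool" where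
  "isomorphic F F' \<longleftrightarrow>
     (\<exists>f. bij_betw f (verts F) (verts F') \<and>
          (\<forall>u\<in>verts F. \<forall>v\<in>verts F. {u, v} \<in> edges F \<longleftrightarrow> {f u, f v} \<in> edges F'))"

definition contains_copy :: "'b ugraph \<Rightarrow> 'a ugraph \<Rightarrow> bool" where
  "contains_copy H F \<longleftrightarrow> (\<exists>F'. subgraph F' H \<and> isomorphic F F')"

definition grid_adj :: "nat \<times> nat \<Rightarrow> nat \<times> nat \<Rightarrow> bool" where
  "grid_adj u v \<longleftrightarrow>
     (fst u = fst v \<and> \<bar>int (snd u) - int (snd v)\<bar> = 1) \<or>
     (snd u = snd v \<and> \<bar>int (fst u) - int (fst v)\<bar> = 1)"

definition grid_graph :: "nat \<Rightarrow> nat \<Rightarrow> (nat \<times> nat) ugraph" where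
  "grid_graph s t =
     ({1..s} \<times> {1..t},
      {{u, v} | u v. u \<in> {1..s} \<times> {1..t} \<and> v \<in> {1..s} \<times> {1..t} \<and> grid_adj u v})"

text \<open>
  The binomial random graph: one independent Bernoulli trial of parameter \<open>p\<close> for
  each of the two-element subsets of \<open>{1..n}\<close>. (\<open>False\<close> is only the value that
  \<^const>\<open>Pi_pmf\<close> assigns outside the index set.)
\<close>
definition gnp :: "nat \<Rightarrow> real \<Rightarrow> nat ugraph pmf" where
  "gnp n p =
     map_pmf (\<lambda>b. ({1..n}, {e \<in> [{1..n}]\<^bsup>2\<^esup>. b e}))
       (Pi_pmf ([{1..n}]\<^bsup>2\<^esup>) False (\<lambda>_. bernoulli_pmf p))"

lemma simple_graph_grid_graph: "simple_graph (grid_graph s t)"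
  by (auto simp: simple_graph_def grid_graph_def grid_adj_def nsets_def card_insert_if)

lemma simple_graph_gnp: "G \<in> set_pmf (gnp n p) \<Longrightarrow> simple_graph G \<and> verts G = {1..n}"
  by (auto simp: simple_graph_def gnp_def)

end

theory Submission
  imports Defs
begin

text \<open>
  By a density increment, \<open>H\<close> contains a pair \<open>A, B\<close> of equally large sets such that the density
  of \<open>H\<close> between any two not too small subsets of \<open>A\<close> and \<open>B\<close> is of order \<open>p\<close>. The grid is built
  row by row inside \<open>H[A, B]\<close>. Given a row \<open>w\<^sub>1, ..., w\<^sub>s\<close>, codegrees of order \<open>n p\<^sup>2\<close> and
  \<open>s \<le> c / p\<close> make the neighbourhoods \<open>N(w\<^sub>i)\<close> essentially disjoint, so the next row is a path that
  visits them in order; it exists if, for each \<open>i\<close>, any large part of \<open>N(w\<^sub>i)\<close> sends edges to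
  most of \<open>N(w\<^sub>i\<^sub>+\<^sub>1)\<close>. Since the edges of the new path must again have this property, an edge is
  called good if between any large parts of the neighbourhoods of its ends there is a good edge.
  A greatest fixed point gives such a notion, and every vertex has only \<open>O(log n / p)\<close> bad edges:
  otherwise \<open>O(log n / p)\<close> many vertices have neighbourhoods concentrated in tiny sets that
  are determined by the neighbourhoods of \<open>O(log n / p)\<close> further vertices, and a union
  bound over all choices shows that this does not happen in \<open>G(n, p)\<close>.
\<close>

section \<open>Counting events with product probabilities\<close>

text \<open>When \<open>p\<close> tends to 0, neighbourhoods are sublinear, so the lower density of
  \<open>H[A, B]\<close>, which concerns linear sets, says nothing about edges between two of them;
  and \<open>H\<close> is adversarial, so its edges cannot be treated as random. Structural claims
  are therefore proved by compression. A supposed family of \<open>b\<close> exceptional vertices is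
  encoded by at most \<open>b\<close> vertices \<open>X\<close>, edges \<open>F\<close> at
  \<open>X\<close> and subsets \<open>R w\<close> of \<open>X\<close>, and the code leaves each
  exceptional vertex with order \<open>p n\<close> neighbours in \<open>G\<close> inside at most
  \<open>4 * \<eta> * N\<close> vertices. The code costs a factor \<open>exp (O(p b N))\<close>,
  while the event has probability \<open>exp (- c p b N)\<close> with \<open>c\<close> growing like
  the logarithm of \<open>1 / \<eta>\<close>, so a small constant \<open>\<eta>\<close> wins. Two
  demands on \<open>b\<close> meet here: hitting all constraints at once needs order
  \<open>log n / p\<close> vertices, while the number of families \<open>R\<close>, up to
  \<open>2 ^ (b * b)\<close>, is affordable only for \<open>b\<close> of order at most
  \<open>p n\<close>. This is one place where \<open>p\<close> of order at least
  \<open>sqrt (log n / n)\<close> enters. The circular notion of a good edge causes no loss, because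
  the bound \<open>b\<close> on bad edges at a vertex reproduces itself under
  \<open>judge\<close>.\<close>

text \<open>Writing \<open>z ^ card\<close> as a product of factors
  \<open>1 + (z - 1) * [E i x]\<close> and expanding replaces independence by joint probabilities of
  subfamilies.\<close>

lemma expectation_power_card:
  fixes M :: "'a pmf" and z :: real and B :: "'a set" and E :: "'i \<Rightarrow> 'a \<Rightarrow> bool"
  assumes "finite I"
  shows "measure_pmf.expectation M (\<lambda>x. indicator B x * z ^ card {i\<in>I. E i x}) =
    (\<Sum>Z\<in>Pow I. (z - 1) ^ card Z * measure_pmf.prob M (B \<inter> {x. \<forall>i\<in>Z. E i x}))"
proof -
  have "indicator B x * z ^ card {i\<in>I. E i x} =
      (\<Sum>Z\<in>Pow I. (z - 1) ^ card Z * indicator (B \<inter> {x. \<forall>i\<in>Z. E i x}) x)" for x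
  proof -
    have "z ^ card {i\<in>I. E i x} = (\<Prod>i\<in>I. if E i x then z else 1)"
      using assms by (simp add: prod.If_cases Int_def)
    also have "\<dots> = (\<Prod>i\<in>I. (z - 1) * (if E i x then 1 else 0) + 1)"
      by (intro prod.cong) auto
    also have "\<dots> = (\<Sum>Z\<in>Pow I. \<Prod>i\<in>Z. (z - 1) * (if E i x then 1 else 0))"
      using assms by (subst prod_add) auto
    also have "\<dots> = (\<Sum>Z\<in>Pow I. (z - 1) ^ card Z * (if \<forall>i\<in>Z. E i x then 1 else 0))"
    proof (intro sum.cong refl)
      fix Z assume "Z \<in> Pow I"
      then have "finite Z" using assms finite_subset by auto
      then show "(\<Prod>i\<in>Z. (z - 1) * (if E i x then 1 else 0)) = (z - 1) ^ card Z * (if \<forall>i\<in>Z. E i x then 1 else 0)"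
        by (auto simp: prod.distrib)
    qed
    finally show ?thesis
      by (auto simp: indicator_def intro!: sum.cong)
  qed
  then have "measure_pmf.expectation M (\<lambda>x. indicator B x * z ^ card {i\<in>I. E i x}) =
      measure_pmf.expectation M (\<lambda>x. \<Sum>Z\<in>Pow I. (z - 1) ^ card Z * indicator (B \<inter> {x. \<forall>i\<in>Z. E i x}) x)"
    by simp
  also have "\<dots> = (\<Sum>Z\<in>Pow I. (z - 1) ^ card Z * measure_pmf.prob M (B \<inter> {x. \<forall>i\<in>Z. E i x}))"
    by (subst Bochner_Integration.integral_sum)
      (auto intro!: integrable_mult_right measure_pmf.integrable_const_bound[where B=1])
  finally show ?thesis .
qed

text \<open>Markov's inequality for \<open>z ^ card\<close>, serving both tails:
  \<open>z \<ge> 1\<close> gives the upper one and \<open>z \<le> 1\<close> the lower one. The event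
  \<open>B\<close> is carried along so that a prescribed edge set can be demanded at the same
  time.\<close>

lemma prob_card_markov:
  fixes M :: "'a pmf" and z a :: real and B :: "'a set" and E :: "'i \<Rightarrow> 'a \<Rightarrow> bool"
  assumes "finite I" "z > 0"
    and le: "\<And>x. x \<in> T \<Longrightarrow> x \<in> B \<and> z powr a \<le> z ^ card {i\<in>I. E i x}"
  shows "measure_pmf.prob M T \<le> z powr (-a) *
    (\<Sum>Z\<in>Pow I. (z - 1) ^ card Z * measure_pmf.prob M (B \<inter> {x. \<forall>i\<in>Z. E i x}))"
proof -
  have int: "integrable (measure_pmf M) (\<lambda>x. indicator B x * z ^ card {i\<in>I. E i x})"
  proof (rule measure_pmf.integrable_const_bound[where B="max 1 z ^ card I"])
    have "z ^ card {i\<in>I. E i x} \<le> max 1 z ^ card I" for x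
    proof -
      have "z ^ card {i\<in>I. E i x} \<le> max 1 z ^ card {i\<in>I. E i x}"
        using assms by (intro power_mono) auto
      also have "\<dots> \<le> max 1 z ^ card I"
        using assms by (intro power_increasing card_mono) auto
      finally show ?thesis .
    qed
    then show "AE x in measure_pmf M. norm (indicator B x * z ^ card {i\<in>I. E i x}) \<le> max 1 z ^ card I"
      using assms by (auto simp: indicator_def abs_mult)
  qed auto
  have "measure_pmf.prob M T = measure_pmf.expectation M (indicator T)" by simp
  also have "\<dots> \<le> measure_pmf.expectation M (\<lambda>x. z powr (-a) * (indicator B x * z ^ card {i\<in>I. E i x}))"
  proof (rule integral_mono)
    show "integrable (measure_pmf M) (indicator T :: _ \<Rightarrow> real)"
      by (auto intro!: measure_pmf.integrable_const_bound[where B=1])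
    show "integrable (measure_pmf M) (\<lambda>x. z powr (-a) * (indicator B x * z ^ card {i\<in>I. E i x}))"
      using int by (rule integrable_mult_right)
    fix x
    have pos: "z powr a > 0" using assms by simp
    show "indicator T x \<le> z powr (-a) * (indicator B x * z ^ card {i\<in>I. E i x})"
    proof (cases "x \<in> T")
      case True
      then show ?thesis using le[OF True] pos by (simp add: powr_minus field_simps)
    next
      case False
      then show ?thesis using assms by (simp add: indicator_def)
    qed
  qed
  also have "\<dots> = z powr (-a) * (\<Sum>Z\<in>Pow I. (z - 1) ^ card Z * measure_pmf.prob M (B \<inter> {x. \<forall>i\<in>Z. E i x}))"
    using expectation_power_card[OF assms(1), of M B z E] by simp
  finally show ?thesis .
qed

lemma sum_Pow_power:
  fixes u :: "'b::comm_ring_1"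
  assumes "finite I"
  shows "(\<Sum>Z\<in>Pow I. u ^ card Z) = (1 + u) ^ card I"
proof -
  have "(\<Prod>i\<in>I. u + 1) = (\<Sum>Z\<in>Pow I. \<Prod>i\<in>Z. u)"
    using assms by (subst prod_add) auto
  then show ?thesis by (simp add: add.commute)
qed

lemma power_one_plus_le_exp:
  fixes x :: real
  assumes "0 \<le> 1 + x"
  shows "(1 + x) ^ k \<le> exp (x * real k)"
proof -
  have "(1 + x) ^ k \<le> exp x ^ k" using assms by (intro power_mono) auto
  then show ?thesis by (simp add: exp_of_nat_mult[symmetric] mult.commute)
qed

lemma prob_card_ge:
  fixes M :: "'a pmf" and z a :: real and B :: "'a set" and E :: "'i \<Rightarrow> 'a \<Rightarrow> bool"
  assumes "finite I" "z \<ge> 1" "\<pi> \<ge> 0" "Q \<ge> 0"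
    and Z: "\<And>Z. Z \<subseteq> I \<Longrightarrow> measure_pmf.prob M (B \<inter> {x. \<forall>i\<in>Z. E i x}) \<le> Q * \<pi> ^ card Z"
  shows "measure_pmf.prob M (B \<inter> {x. a \<le> real (card {i\<in>I. E i x})}) \<le>
    Q * exp ((z - 1) * \<pi> * real (card I) - a * ln z)"
proof -
  have "measure_pmf.prob M (B \<inter> {x. a \<le> real (card {i\<in>I. E i x})}) \<le> z powr (-a) *
    (\<Sum>Z\<in>Pow I. (z - 1) ^ card Z * measure_pmf.prob M (B \<inter> {x. \<forall>i\<in>Z. E i x}))"
  proof (rule prob_card_markov)
    fix x assume "x \<in> B \<inter> {x. a \<le> real (card {i \<in> I. E i x})}"
    then show "x \<in> B \<and> z powr a \<le> z ^ card {i \<in> I. E i x}"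
      using assms powr_mono[of a "real (card {i \<in> I. E i x})" z] by (auto simp: powr_realpow)
  qed (use assms in auto)
  also have "\<dots> \<le> z powr (-a) * (\<Sum>Z\<in>Pow I. (z - 1) ^ card Z * (Q * \<pi> ^ card Z))"
    using assms by (intro mult_left_mono sum_mono) auto
  also have "(\<Sum>Z\<in>Pow I. (z - 1) ^ card Z * (Q * \<pi> ^ card Z)) = Q * (\<Sum>Z\<in>Pow I. ((z - 1) * \<pi>) ^ card Z)"
    by (simp add: sum_distrib_left power_mult_distrib ac_simps)
  also have "\<dots> = Q * (1 + (z - 1) * \<pi>) ^ card I"
    using assms by (simp add: sum_Pow_power)
  also have "z powr (-a) * \<dots> \<le> z powr (-a) * (Q * exp ((z - 1) * \<pi> * real (card I)))"
    using assms by (intro mult_left_mono power_one_plus_le_exp) (auto simp: add_nonneg_nonneg)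
  also have "\<dots> = Q * exp ((z - 1) * \<pi> * real (card I) - a * ln z)"
    using assms by (simp add: powr_def exp_diff exp_minus divide_inverse)
  finally show ?thesis .
qed

text \<open>For \<open>z \<le> 1\<close> the terms of the expansion alternate in sign, so the joint
  probabilities enter as equalities here.\<close>

lemma prob_card_le:
  fixes M :: "'a pmf" and z a :: real and E :: "'i \<Rightarrow> 'a \<Rightarrow> bool"
  assumes "finite I" "0 < z" "z \<le> 1" "0 \<le> \<pi>" "\<pi> \<le> 1"
    and Z: "\<And>Z. Z \<subseteq> I \<Longrightarrow> measure_pmf.prob M {x. \<forall>i\<in>Z. E i x} = \<pi> ^ card Z"
  shows "measure_pmf.prob M {x. real (card {i\<in>I. E i x}) \<le> a} \<le>
    exp (- (1 - z) * \<pi> * real (card I) - a * ln z)"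
proof -
  have "measure_pmf.prob M {x. real (card {i\<in>I. E i x}) \<le> a} \<le> z powr (-a) *
    (\<Sum>Z\<in>Pow I. (z - 1) ^ card Z * measure_pmf.prob M (UNIV \<inter> {x. \<forall>i\<in>Z. E i x}))"
  proof (rule prob_card_markov)
    fix x assume "x \<in> {x. real (card {i \<in> I. E i x}) \<le> a}"
    then show "x \<in> UNIV \<and> z powr a \<le> z ^ card {i \<in> I. E i x}"
      using assms powr_mono'[of "real (card {i \<in> I. E i x})" a z] by (auto simp: powr_realpow)
  qed (use assms in auto)
  also have "(\<Sum>Z\<in>Pow I. (z - 1) ^ card Z * measure_pmf.prob M (UNIV \<inter> {x. \<forall>i\<in>Z. E i x})) =
      (\<Sum>Z\<in>Pow I. ((z - 1) * \<pi>) ^ card Z)"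
    by (intro sum.cong) (auto simp: Z power_mult_distrib)
  also have "\<dots> = (1 + (z - 1) * \<pi>) ^ card I"
    using assms by (simp add: sum_Pow_power)
  also have "z powr (-a) * \<dots> \<le> z powr (-a) * exp ((z - 1) * \<pi> * real (card I))"
  proof (intro mult_left_mono power_one_plus_le_exp)
    have "(1 - z) * \<pi> \<le> 1 * 1" using assms by (intro mult_mono) auto
    then show "0 \<le> 1 + (z - 1) * \<pi>" by (simp add: algebra_simps)
  qed auto
  also have "\<dots> = exp (- (1 - z) * \<pi> * real (card I) - a * ln z)"
    using assms by (simp add: powr_def exp_diff exp_minus divide_inverse)
  finally show ?thesis .
qed

section \<open>Edge counts in \<open>gnp\<close>\<close>

lemma prob_gnp_subset:
  assumes "0 \<le> p" "p \<le> 1" "Z \<subseteq> [{1..n}]\<^bsup>2\<^esup>"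
  shows "measure_pmf.prob (gnp n p) {G. Z \<subseteq> edges G} = p ^ card Z"
proof -
  let ?I = "[{1..n}]\<^bsup>2\<^esup>"
  have fin: "finite ?I" by (simp add: finite_imp_finite_nsets)
  have "measure_pmf.prob (gnp n p) {G. Z \<subseteq> edges G} =
      measure_pmf.prob (Pi_pmf ?I False (\<lambda>_. bernoulli_pmf p)) (Pi ?I (\<lambda>e. if e \<in> Z then {True} else UNIV))"
    unfolding gnp_def measure_map_pmf
    by (rule arg_cong[where f="measure_pmf.prob _"]) (use assms in \<open>fastforce simp: Pi_def split: if_splits\<close>)
  also have "\<dots> = (\<Prod>e\<in>?I. if e \<in> Z then p else 1)"
    using fin assms
    by (subst measure_Pi_pmf_Pi) (auto intro!: prod.cong simp: measure_pmf_single)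
  also have "\<dots> = p ^ card Z"
    using fin assms by (simp add: prod.If_cases Int_absorb1)
  finally show ?thesis .
qed

lemma edges_gnp_subset: "G \<in> set_pmf (gnp n p) \<Longrightarrow> edges G \<subseteq> [{1..n}]\<^bsup>2\<^esup>"
  by (auto simp: gnp_def)

text \<open>As \<open>F\<close> and \<open>D\<close> are disjoint, demanding \<open>F\<close> just
  multiplies the tail bound by \<open>p ^ card F\<close>. Summing this weight over all
  \<open>F\<close> is what keeps the union bound over adversarial edge sets affordable.\<close>

lemma prob_gnp_many_edges:
  assumes "0 \<le> p" "p \<le> 1" "D \<subseteq> [{1..n}]\<^bsup>2\<^esup>" "F \<subseteq> [{1..n}]\<^bsup>2\<^esup>" "F \<inter> D = {}" "z \<ge> 1"
  shows "measure_pmf.prob (gnp n p) {G. F \<subseteq> edges G \<and> a \<le> real (card (edges G \<inter> D))} \<le>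
    p ^ card F * exp ((z - 1) * p * real (card D) - a * ln z)"
proof -
  have fin: "finite D" "finite F" using assms finite_subset finite_imp_finite_nsets[of "{1..n}" 2] by auto
  have eq: "{G. F \<subseteq> edges G \<and> a \<le> real (card (edges G \<inter> D))} =
      {G. F \<subseteq> edges G} \<inter> {G::nat ugraph. a \<le> real (card {e\<in>D. e \<in> edges G})}"
    by (auto simp: Int_def conj_commute)
  show ?thesis
    unfolding eq
  proof (rule prob_card_ge)
    fix Z assume Z: "Z \<subseteq> D"
    then have "finite Z" "F \<inter> Z = {}" using assms fin finite_subset by auto
    have "{G. F \<subseteq> edges G} \<inter> {G::nat ugraph. \<forall>e\<in>Z. e \<in> edges G} = {G. F \<union> Z \<subseteq> edges G}" by auto
    then show "measure_pmf.prob (gnp n p) ({G. F \<subseteq> edges G} \<inter> {G. \<forall>e\<in>Z. e \<in> edges G}) \<le> p ^ card F * p ^ card Z"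
      using prob_gnp_subset[of p "F \<union> Z" n] assms Z \<open>finite Z\<close> fin \<open>F \<inter> Z = {}\<close>
      by (simp add: card_Un_disjoint power_add)
  qed (use assms fin in auto)
qed

lemma prob_Union_le:
  fixes M :: "'a pmf"
  assumes "finite I" "T \<subseteq> (\<Union>i\<in>I. E i)" "\<And>i. i \<in> I \<Longrightarrow> measure_pmf.prob M (E i) \<le> f i"
  shows "measure_pmf.prob M T \<le> sum f I"
proof -
  have "measure_pmf.prob M T \<le> measure_pmf.prob M (\<Union>i\<in>I. E i)"
    using assms by (intro measure_pmf.finite_measure_mono) auto
  also have "\<dots> \<le> (\<Sum>i\<in>I. measure_pmf.prob M (E i))"
    using assms by (intro measure_pmf.finite_measure_subadditive_finite) auto
  also have "\<dots> \<le> sum f I" using assms by (intro sum_mono) auto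
  finally show ?thesis .
qed

section \<open>Exceptional events in the binomial random graph\<close>

definition cross :: "'a set \<Rightarrow> 'a set \<Rightarrow> 'a set set" where
  "cross X Y = (\<lambda>(x, y). {x, y}) ` (X \<times> Y)"

lemma inj_on_doubleton: "X \<inter> Y = {} \<Longrightarrow> inj_on (\<lambda>(x, y). {x, y}) (X \<times> Y)"
  by (auto simp: inj_on_def doubleton_eq_iff)

lemma card_cross: "X \<inter> Y = {} \<Longrightarrow> card (cross X Y) = card X * card Y"
  by (simp add: cross_def card_image inj_on_doubleton card_cartesian_product)

lemma cross_subset: "X \<subseteq> W \<Longrightarrow> Y \<subseteq> W \<Longrightarrow> X \<inter> Y = {} \<Longrightarrow> cross X Y \<subseteq> [W]\<^bsup>2\<^esup>"
  by (auto simp: cross_def)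

text \<open>
  The set \<open>F\<close> is the part of the adversarial subgraph between \<open>X\<close> and \<open>V\<close>. It is disjoint from the
  edges between \<open>S\<close> and \<open>V\<close>, so a union bound over \<open>F\<close> costs only \<open>(1 + p) ^ (card X * card V)\<close>.
\<close>

definition concentrated :: "nat \<Rightarrow> nat \<Rightarrow> nat \<Rightarrow> real \<Rightarrow> real \<Rightarrow> nat ugraph \<Rightarrow> nat set \<Rightarrow> nat set \<Rightarrow> nat set \<Rightarrow> bool" where
  "concentrated n N b \<eta> a G X S V \<longleftrightarrow> X \<subseteq> {1..n} \<and> S \<subseteq> {1..n} \<and> V \<subseteq> {1..n} \<and> X \<inter> S = {} \<and> X \<inter> V = {} \<and> S \<inter> V = {} \<and>
     card V \<le> N \<and> card X \<le> b \<and> card S = b \<and>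
     (\<exists>F R. F \<subseteq> edges G \<inter> cross X V \<and> (\<forall>w\<in>S. R w \<subseteq> X \<and> real (card {v\<in>V. \<forall>x\<in>R w. {x, v} \<notin> F}) \<le> \<eta> * real N \<and>
        a \<le> real (card {v\<in>V. {w, v} \<in> edges G \<and> (\<forall>x\<in>R w. {x, v} \<notin> F)})))"

text \<open>In units of \<open>p * b * N\<close>: the choice of \<open>F\<close> costs 1, the choice
  of \<open>R\<close> costs 1 because \<open>b * b \<le> p * b * N\<close>, and with
  \<open>z = 1 / \<eta>\<close> the mean term costs 1 because at most \<open>b * \<eta> * N\<close>
  pairs are available. Having \<open>b * a\<close> edges among these pairs gains 4 by the assumption
  on \<open>a\<close>.\<close>

lemma prob_concentrated_fixed:
  fixes p \<eta> a :: real
  assumes p: "0 < p" "p \<le> 1" and \<eta>: "0 < \<eta>" "\<eta> \<le> 1" and b: "b \<le> p * N" and a: "0 \<le> a" "4 * p * N \<le> a * ln (1 / \<eta>)"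
  shows "measure_pmf.prob (gnp n p) {G. concentrated n N b \<eta> a G X S V} \<le> exp (- (p * b * N))"
proof (cases "X \<subseteq> {1..n} \<and> S \<subseteq> {1..n} \<and> V \<subseteq> {1..n} \<and> X \<inter> S = {} \<and> X \<inter> V = {} \<and> S \<inter> V = {} \<and>
     card V \<le> N \<and> card X \<le> b \<and> card S = b")
  case False
  then have "{G. concentrated n N b \<eta> a G X S V} = {}" by (auto simp: concentrated_def)
  then show ?thesis by (simp only: measure_empty exp_ge_zero)
next
  case True
  then have fin: "finite X" "finite S" "finite V" using finite_subset[OF _ finite_atLeastAtMost, of _ 1 n] by blast+
  let ?T = "\<lambda>F R w. {v\<in>V. \<forall>x\<in>R w. {x, v} \<notin> F}"
  let ?D = "\<lambda>F R. (\<lambda>(w, v). {w, v}) ` (SIGMA w:S. ?T F R w)"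
  define ok where "ok F R \<longleftrightarrow> (\<forall>w\<in>S. card (?T F R w) \<le> \<eta> * N)" for F R
  define Ev where "Ev = (\<lambda>(F, R). {G :: nat ugraph. ok F R \<and> F \<subseteq> edges G \<and> b * a \<le> card (edges G \<inter> ?D F R)})"
  let ?I = "Pow (cross X V) \<times> (S \<rightarrow>\<^sub>E Pow X)"
  let ?e = "exp (p * b * N - b * (a * ln (1 / \<eta>)))"
  have finI: "finite ?I" using fin by (auto simp: cross_def intro!: finite_PiE)
  have inj: "inj_on (\<lambda>(w, v). {w, v}) (SIGMA w:S. {v\<in>V. P w v})" for P
    by (rule inj_on_subset[OF inj_on_doubleton[of S V]]) (use True in auto)
  have "measure_pmf.prob (gnp n p) {G. concentrated n N b \<eta> a G X S V} \<le> (\<Sum>(F, R)\<in>?I. p ^ card F * ?e)"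
  proof (rule prob_Union_le[OF finI, of _ Ev])
    show "{G. concentrated n N b \<eta> a G X S V} \<subseteq> (\<Union>i\<in>?I. Ev i)"
    proof
      fix G assume "G \<in> {G. concentrated n N b \<eta> a G X S V}"
      then have "concentrated n N b \<eta> a G X S V" by simp
      then obtain F R0 where F0: "F \<subseteq> edges G \<inter> cross X V" and R0': "\<forall>w\<in>S. R0 w \<subseteq> X \<and>
          real (card (?T F R0 w)) \<le> \<eta> * real N \<and> a \<le> real (card {v\<in>V. {w, v} \<in> edges G \<and> (\<forall>x\<in>R0 w. {x, v} \<notin> F)})"
        unfolding concentrated_def by (elim conjE exE) (rule that)
      have F: "F \<subseteq> edges G" "F \<subseteq> cross X V" using F0 by auto
      have R0: "\<And>w. w \<in> S \<Longrightarrow> R0 w \<subseteq> X" "\<And>w. w \<in> S \<Longrightarrow> card (?T F R0 w) \<le> \<eta> * N"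
         "\<And>w. w \<in> S \<Longrightarrow> a \<le> card {v\<in>V. {w, v} \<in> edges G \<and> (\<forall>x\<in>R0 w. {x, v} \<notin> F)}"
        using R0' by simp_all
      \<comment> \<open>Values outside \<open>S\<close> are normalised so that \<open>R\<close>
        ranges over a finite set.\<close>
      define R where "R = restrict R0 S"
      have R: "R w = R0 w" if "w \<in> S" for w using that by (simp add: R_def)
      have RI: "R \<in> S \<rightarrow>\<^sub>E Pow X" using R0(1) by (auto simp: R_def)
      have ok: "ok F R" unfolding ok_def using R R0(2) by simp
      let ?Z = "SIGMA w:S. {v\<in>V. {w, v} \<in> edges G \<and> (\<forall>x\<in>R w. {x, v} \<notin> F)}"
      have "b * a = (\<Sum>w\<in>S. a)" using True by simp
      also have "\<dots> \<le> (\<Sum>w\<in>S. real (card {v\<in>V. {w, v} \<in> edges G \<and> (\<forall>x\<in>R w. {x, v} \<notin> F)}))"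
        using R R0(3) by (intro sum_mono) simp
      also have "\<dots> = card ?Z" using fin by (subst card_SigmaI) auto
      also have "\<dots> = card ((\<lambda>(w, v). {w, v}) ` ?Z)" by (subst card_image[OF inj]) auto
      also have "\<dots> \<le> card (edges G \<inter> ?D F R)"
        using fin by (intro of_nat_mono card_mono finite_Int) auto
      finally have "G \<in> Ev (F, R)" using ok F by (simp add: Ev_def)
      then show "G \<in> (\<Union>i\<in>?I. Ev i)" using F RI by blast
    qed
  next
    fix i assume i: "i \<in> ?I"
    obtain F R where FR: "i = (F, R)" by (cases i)
    show "measure_pmf.prob (gnp n p) (Ev i) \<le> (case i of (F, R) \<Rightarrow> p ^ card F * ?e)"
    proof (cases "ok F R")
      case False
      then have "Ev i = {}" by (simp add: Ev_def FR)
      then show ?thesis using p by (simp add: FR)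
    next
      case ok: True
      have "?D F R \<subseteq> cross S V" by (auto simp: cross_def)
      then have Dn: "?D F R \<subseteq> [{1..n}]\<^bsup>2\<^esup>" using cross_subset[of S "{1..n}" V] True by blast
      have Fn: "F \<subseteq> [{1..n}]\<^bsup>2\<^esup>" using i FR cross_subset[of X "{1..n}" V] True by auto
      have FD: "F \<inter> ?D F R = {}"
        using i FR True by (fastforce simp: cross_def doubleton_eq_iff)
      have "card (?D F R) = card (SIGMA w:S. ?T F R w)" by (rule card_image[OF inj])
      also have "\<dots> = (\<Sum>w\<in>S. card (?T F R w))" using fin by (subst card_SigmaI) auto
      also have "real \<dots> \<le> (\<Sum>w\<in>S. \<eta> * N)"
        unfolding of_nat_sum using ok by (intro sum_mono) (auto simp: ok_def)
      also have "\<dots> = b * (\<eta> * N)" using True by simp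
      finally have cD: "card (?D F R) \<le> b * (\<eta> * N)" .
      have ev: "Ev i = {G. F \<subseteq> edges G \<and> b * a \<le> real (card (edges G \<inter> ?D F R))}"
        using ok by (simp add: Ev_def FR)
      have "measure_pmf.prob (gnp n p) (Ev i) \<le> p ^ card F * exp ((1 / \<eta> - 1) * p * real (card (?D F R)) - (b * a) * ln (1 / \<eta>))"
        unfolding ev by (rule prob_gnp_many_edges[OF _ _ Dn Fn FD]) (use p \<eta> in auto)
      also have "\<dots> \<le> p ^ card F * ?e"
      proof -
        have "(1 / \<eta> - 1) * p * real (card (?D F R)) \<le> (1 / \<eta>) * p * (b * (\<eta> * N))"
          using cD p \<eta> by (intro mult_mono) auto
        also have "\<dots> = p * b * N" using \<eta> by simp
        finally have "(1 / \<eta> - 1) * p * real (card (?D F R)) - (b * a) * ln (1 / \<eta>) \<le> p * b * N - b * (a * ln (1 / \<eta>))"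
          by simp
        then show ?thesis using p by (intro mult_left_mono) auto
      qed
      finally show ?thesis by (simp add: FR)
    qed
  qed
  also have "(\<Sum>(F, R)\<in>?I. p ^ card F * ?e) = (\<Sum>F\<in>Pow (cross X V). p ^ card F) * (real (card (S \<rightarrow>\<^sub>E Pow X)) * ?e)"
    by (subst sum.cartesian_product[symmetric])
      (simp add: sum_distrib_left sum_distrib_right mult_ac)
  also have "(\<Sum>F\<in>Pow (cross X V). p ^ card F) = (1 + p) ^ (card X * card V)"
    using fin True by (subst sum_Pow_power) (auto simp: card_cross, simp add: cross_def)
  also have "card (S \<rightarrow>\<^sub>E Pow X) = (2 ^ card X) ^ b"
    using fin True by (simp add: card_PiE card_Pow)
  also have "(1 + p) ^ (card X * card V) * (real ((2 ^ card X) ^ b) * ?e) \<le> exp (p * b * N) * (exp (p * b * N) * ?e)"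
  proof (intro mult_mono)
    have "(1 + p) ^ (card X * card V) \<le> exp (p * real (card X * card V))" using p by (intro power_one_plus_le_exp) simp
    also have "p * real (card X * card V) \<le> p * real (b * N)"
      using True p by (intro mult_left_mono of_nat_mono mult_le_mono) auto
    finally show "(1 + p) ^ (card X * card V) \<le> exp (p * b * N)" by (simp add: mult_ac)
    have "real ((2 ^ card X) ^ b) = 2 ^ (card X * b)" by (simp add: power_mult)
    also have "\<dots> \<le> (2::real) ^ (b * b)" using True by (intro power_increasing) auto
    also have "\<dots> \<le> exp (1 * real (b * b))" using power_one_plus_le_exp[of 1 "b * b"] by simp
    also have "1 * real (b * b) \<le> p * b * N" using mult_left_mono[OF b, of b] by (simp add: mult_ac)
    finally show "real ((2 ^ card X) ^ b) \<le> exp (p * b * N)" by simp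
  qed (use p in auto)
  also have "\<dots> = exp (3 * (p * b * N) - b * (a * ln (1 / \<eta>)))" by (simp add: exp_add[symmetric] exp_diff)
  also have "\<dots> \<le> exp (- (p * b * N))"
    using mult_left_mono[OF a(2), of b] by (simp add: mult_ac)
  finally show ?thesis .
qed

lemma prob_concentrated:
  fixes p \<eta> a :: real
  assumes p: "0 < p" "p \<le> 1" and \<eta>: "0 < \<eta>" "\<eta> \<le> 1" and b: "b \<le> p * N" and a: "0 \<le> a" "4 * p * N \<le> a * ln (1 / \<eta>)"
  shows "measure_pmf.prob (gnp n p) {G. \<exists>X S V. concentrated n N b \<eta> a G X S V} \<le> 8 ^ n * exp (- (p * b * N))"
proof -
  let ?I = "Pow {1..n} \<times> Pow {1..n} \<times> Pow {1..n::nat}"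
  have "measure_pmf.prob (gnp n p) {G. \<exists>X S V. concentrated n N b \<eta> a G X S V} \<le> (\<Sum>(X, S, V)\<in>?I. exp (- (p * b * N)))"
    by (rule prob_Union_le[of _ _ "\<lambda>(X, S, V). {G. concentrated n N b \<eta> a G X S V}"])
      (use prob_concentrated_fixed[OF assms] in \<open>auto simp: concentrated_def\<close>)
  also have "\<dots> = card ?I * exp (- (p * b * N))" by (simp add: case_prod_unfold)
  also have "card ?I = (2 ^ n) * (2 ^ n) * 2 ^ n" by (simp add: card_cartesian_product card_Pow)
  also have "real \<dots> = 8 ^ n" by (simp add: power_mult_distrib[symmetric])
  finally show ?thesis .
qed

text \<open>The upper tails that follow take \<open>z = 8\<close> and a threshold of eight times a
  bound on the mean, which gives the exponent \<open>7 - 8 * ln 8 \<le> - 9\<close> times that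
  bound.\<close>

lemma ln_8_ge_2: "ln (8::real) \<ge> 2"
proof -
  have "ln (8::real) = ln (2 ^ 3)" by simp
  also have "\<dots> = 3 * ln 2" by (subst ln_realpow) auto
  finally show ?thesis using ln2_ge_two_thirds by linarith
qed

lemma prob_dense_pair:
  fixes p :: real
  assumes p: "0 < p" "p \<le> 1"
  shows "measure_pmf.prob (gnp n p) {G. \<exists>X Y. X \<subseteq> {1..n} \<and> Y \<subseteq> {1..n} \<and> X \<inter> Y = {} \<and> card X = u \<and> card Y = u \<and>
     8 * p * (real u)\<^sup>2 \<le> card (edges G \<inter> cross X Y)} \<le> 4 ^ n * exp (- (9 * p * (real u)\<^sup>2))"
proof -
  let ?I = "Pow {1..n} \<times> Pow {1..n::nat}"
  let ?E = "\<lambda>(X, Y). {G. X \<subseteq> {1..n} \<and> Y \<subseteq> {1..n} \<and> X \<inter> Y = {} \<and> card X = u \<and> card Y = u \<and>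
     8 * p * (real u)\<^sup>2 \<le> card (edges G \<inter> cross X Y)}"
  have "measure_pmf.prob (gnp n p) {G. \<exists>X Y. X \<subseteq> {1..n} \<and> Y \<subseteq> {1..n} \<and> X \<inter> Y = {} \<and> card X = u \<and> card Y = u \<and>
     8 * p * (real u)\<^sup>2 \<le> card (edges G \<inter> cross X Y)} \<le> (\<Sum>(X, Y)\<in>?I. exp (- (9 * p * (real u)\<^sup>2)))"
  proof (rule prob_Union_le[of _ _ ?E])
    fix i assume "i \<in> ?I"
    obtain X Y where i: "i = (X, Y)" by (cases i)
    show "measure_pmf.prob (gnp n p) (?E i) \<le> (case i of (X, Y) \<Rightarrow> exp (- (9 * p * (real u)\<^sup>2)))"
    proof (cases "X \<subseteq> {1..n} \<and> Y \<subseteq> {1..n} \<and> X \<inter> Y = {} \<and> card X = u \<and> card Y = u")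
      case True
      have "measure_pmf.prob (gnp n p) (?E i) = measure_pmf.prob (gnp n p)
         {G. {} \<subseteq> edges G \<and> 8 * p * (real u)\<^sup>2 \<le> real (card (edges G \<inter> cross X Y))}"
        using True by (simp add: i)
      also have "\<dots> \<le> p ^ card ({} :: nat set set) * exp ((8 - 1) * p * real (card (cross X Y)) - 8 * p * (real u)\<^sup>2 * ln 8)"
        using True p by (intro prob_gnp_many_edges cross_subset) auto
      also have "\<dots> = exp (p * (real u)\<^sup>2 * 7 - p * (real u)\<^sup>2 * (8 * ln 8))"
        using True by (simp add: card_cross power2_eq_square mult_ac)
      also have "\<dots> \<le> exp (- (9 * p * (real u)\<^sup>2))"
      proof -
        have "p * (real u)\<^sup>2 * 16 \<le> p * (real u)\<^sup>2 * (8 * ln 8)"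
          using ln_8_ge_2 p by (intro mult_left_mono) auto
        then show ?thesis by simp
      qed
      finally show ?thesis by (simp add: i)
    next
      case False
      then have "?E i = {}" unfolding i by auto
      then show ?thesis by (simp only: measure_empty) (simp add: i)
    qed
  qed auto
  also have "\<dots> = card ?I * exp (- (9 * p * (real u)\<^sup>2))" by (simp add: case_prod_unfold)
  also have "card ?I = (2 ^ n) * 2 ^ n" by (simp add: card_cartesian_product card_Pow)
  also have "real \<dots> = 4 ^ n" by (simp add: power_mult_distrib[symmetric])
  finally show ?thesis .
qed

lemma prob_high_degree:
  fixes p :: real
  assumes p: "0 < p" "p \<le> 1"
  shows "measure_pmf.prob (gnp n p) {G. \<exists>x\<in>{1..n}. 8 * p * n \<le> card (edges G \<inter> cross {x} ({1..n} - {x}))}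
    \<le> n * exp (- (9 * p * n))"
proof -
  have "measure_pmf.prob (gnp n p) {G. \<exists>x\<in>{1..n}. 8 * p * n \<le> card (edges G \<inter> cross {x} ({1..n} - {x}))}
     \<le> (\<Sum>x\<in>{1..n}. exp (- (9 * p * n)))"
  proof (rule prob_Union_le[of _ _ "\<lambda>x. {G. 8 * p * n \<le> card (edges G \<inter> cross {x} ({1..n} - {x}))}"])
    fix x assume x: "x \<in> {1..n}"
    have "measure_pmf.prob (gnp n p) {G. 8 * p * n \<le> card (edges G \<inter> cross {x} ({1..n} - {x}))} = measure_pmf.prob (gnp n p)
         {G. {} \<subseteq> edges G \<and> 8 * p * n \<le> real (card (edges G \<inter> cross {x} ({1..n} - {x})))}" by simp
    also have "\<dots> \<le> p ^ card ({} :: nat set set) * exp ((8 - 1) * p * real (card (cross {x} ({1..n} - {x}))) - 8 * p * n * ln 8)"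
      using x p by (intro prob_gnp_many_edges cross_subset) auto
    also have "\<dots> \<le> exp (7 * p * n - p * n * (8 * ln 8))"
    proof -
      have "card (cross {x} ({1..n} - {x})) \<le> n" using x by (subst card_cross) auto
      then have "(8 - 1) * p * real (card (cross {x} ({1..n} - {x}))) \<le> 7 * p * n"
        using p by (intro mult_mono) auto
      then show ?thesis by (simp add: mult_ac)
    qed
    also have "\<dots> \<le> exp (- (9 * p * n))"
    proof -
      have "p * n * 16 \<le> p * n * (8 * ln 8)" using ln_8_ge_2 p by (intro mult_left_mono) auto
      then show ?thesis by simp
    qed
    finally show "measure_pmf.prob (gnp n p) {G. 8 * p * n \<le> card (edges G \<inter> cross {x} ({1..n} - {x}))} \<le> exp (- (9 * p * n))" .
  qed auto
  then show ?thesis by simp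
qed

lemma prob_high_codegree:
  fixes p :: real
  assumes p: "0 < p" "p \<le> 1"
  shows "measure_pmf.prob (gnp n p) {G. \<exists>x\<in>{1..n}. \<exists>y\<in>{1..n}. x \<noteq> y \<and>
      8 * p\<^sup>2 * n \<le> card {z\<in>{1..n} - {x, y}. {x, z} \<in> edges G \<and> {y, z} \<in> edges G}}
    \<le> (real n)\<^sup>2 * exp (- (9 * p\<^sup>2 * n))"
proof -
  let ?E = "\<lambda>(x, y). {G :: nat ugraph. x \<noteq> y \<and> 8 * p\<^sup>2 * n \<le> card {z\<in>{1..n} - {x, y}. {x, z} \<in> edges G \<and> {y, z} \<in> edges G}}"
  have "measure_pmf.prob (gnp n p) {G. \<exists>x\<in>{1..n}. \<exists>y\<in>{1..n}. x \<noteq> y \<and>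
      8 * p\<^sup>2 * n \<le> card {z\<in>{1..n} - {x, y}. {x, z} \<in> edges G \<and> {y, z} \<in> edges G}}
      \<le> (\<Sum>(x, y)\<in>{1..n} \<times> {1..n}. exp (- (9 * p\<^sup>2 * n)))"
  proof (rule prob_Union_le[of _ _ ?E])
    fix i assume i0: "i \<in> {1..n} \<times> {1..n}"
    obtain x y where i: "i = (x, y)" by (cases i)
    then have xy: "x \<in> {1..n}" "y \<in> {1..n}" using i0 by auto
    show "measure_pmf.prob (gnp n p) (?E i) \<le> (case i of (x, y) \<Rightarrow> exp (- (9 * p\<^sup>2 * n)))"
    proof (cases "x = y")
      case True
      then show ?thesis by (simp add: i)
    next
      case False
      let ?I = "{1..n} - {x, y}"
      have "measure_pmf.prob (gnp n p) (?E i) = measure_pmf.prob (gnp n p)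
         (UNIV \<inter> {G. 8 * p\<^sup>2 * n \<le> real (card {z\<in>?I. {x, z} \<in> edges G \<and> {y, z} \<in> edges G})})"
        using False by (simp add: i)
      also have "\<dots> \<le> 1 * exp ((8 - 1) * p\<^sup>2 * real (card ?I) - 8 * p\<^sup>2 * n * ln 8)"
      proof (rule prob_card_ge)
        fix Z assume Z: "Z \<subseteq> ?I"
        then have finZ: "finite Z" using finite_subset by blast
        \<comment> \<open>Distinct common neighbours use disjoint pairs of edges, so
          \<open>card Z\<close> of them require \<open>2 * card Z\<close> edges.\<close>
        have eq: "UNIV \<inter> {G. \<forall>z\<in>Z. {x, z} \<in> edges G \<and> {y, z} \<in> edges G} = {G. cross {x, y} Z \<subseteq> edges G}"
          by (auto simp: cross_def)
        have "{x, y} \<inter> Z = {}" using Z by auto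
        then have "card (cross {x, y} Z) = 2 * card Z" using False by (simp add: card_cross)
        moreover have "cross {x, y} Z \<subseteq> [{1..n}]\<^bsup>2\<^esup>"
          using \<open>{x, y} \<inter> Z = {}\<close> xy Z by (intro cross_subset) auto
        ultimately show "measure_pmf.prob (gnp n p) (UNIV \<inter> {G. \<forall>z\<in>Z. {x, z} \<in> edges G \<and> {y, z} \<in> edges G}) \<le> 1 * (p\<^sup>2) ^ card Z"
          unfolding eq using p by (simp add: prob_gnp_subset power_mult)
      qed auto
      also have "\<dots> \<le> exp (7 * p\<^sup>2 * n - p\<^sup>2 * n * (8 * ln 8))"
      proof -
        have "card ?I \<le> card {1..n}" by (intro card_mono) auto
        then have "(8 - 1) * p\<^sup>2 * real (card ?I) \<le> 7 * p\<^sup>2 * n"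
          using p by (intro mult_mono) auto
        then show ?thesis by (simp add: mult_ac)
      qed
      also have "\<dots> \<le> exp (- (9 * p\<^sup>2 * n))"
      proof -
        have "p\<^sup>2 * n * 16 \<le> p\<^sup>2 * n * (8 * ln 8)" using ln_8_ge_2 p by (intro mult_left_mono) auto
        then show ?thesis by simp
      qed
      finally show ?thesis by (simp add: i)
    qed
  qed auto
  also have "\<dots> = (real n)\<^sup>2 * exp (- (9 * p\<^sup>2 * n))" by (simp add: case_prod_unfold power2_eq_square)
  finally show ?thesis .
qed

lemma prob_few_edges:
  fixes p :: real
  assumes p: "0 < p" "p \<le> 1" and n: "2 \<le> n"
  shows "measure_pmf.prob (gnp n p) {G. num_edges G \<le> p * (real n)\<^sup>2 / 8} \<le> exp (- (p * (real n)\<^sup>2 / 32))"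
proof -
  let ?I = "[{1..n}]\<^bsup>2\<^esup>"
  have fin: "finite ?I" by (simp add: finite_imp_finite_nsets)
  have "card ?I = n choose 2" using n_subsets[of "{1..n}" 2] by (simp add: nsets_def) (metis (no_types, lifting) Collect_cong finite_atLeastAtMost finite_subset)
  then have "real (card ?I) = real n * (real n - 1) / 2"
    using n by (simp add: choose_two real_of_nat_div of_nat_diff)
  moreover have "real n * (real n / 2) \<le> real n * (real n - 1)" using n by (intro mult_left_mono) auto
  ultimately have M: "(real n)\<^sup>2 / 4 \<le> card ?I" by (simp add: power2_eq_square)
  have "measure_pmf.prob (gnp n p) {G. num_edges G \<le> p * (real n)\<^sup>2 / 8} \<le>
      measure_pmf.prob (gnp n p) {G. real (card {e\<in>?I. e \<in> edges G}) \<le> p * card ?I / 2}"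
  \<comment> \<open>Only on the support are all edges known to be two-element subsets of
    \<open>{1..n}\<close>.\<close>
  proof (rule measure_pmf.finite_measure_mono_AE)
    show "AE G in measure_pmf (gnp n p). G \<in> {G. num_edges G \<le> p * (real n)\<^sup>2 / 8} \<longrightarrow>
        G \<in> {G. real (card {e\<in>?I. e \<in> edges G}) \<le> p * card ?I / 2}"
      unfolding AE_measure_pmf_iff
    proof (intro ballI impI)
      fix G assume G: "G \<in> set_pmf (gnp n p)" "G \<in> {G. num_edges G \<le> p * (real n)\<^sup>2 / 8}"
      have "{e\<in>?I. e \<in> edges G} = edges G" using edges_gnp_subset[OF G(1)] by auto
      moreover have "p * ((real n)\<^sup>2 / 4) \<le> p * card ?I" using M p by (intro mult_left_mono) auto
      ultimately show "G \<in> {G. real (card {e\<in>?I. e \<in> edges G}) \<le> p * card ?I / 2}"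
        using G(2) by (simp add: num_edges_def)
    qed
  qed auto
  also have "\<dots> \<le> exp (- (1 - 1 / 2) * p * real (card ?I) - p * card ?I / 2 * ln (1 / 2))"
    using fin p
  proof (intro prob_card_le)
    fix Z assume "Z \<subseteq> ?I"
    moreover have "{G. \<forall>e\<in>Z. e \<in> edges G} = {G :: nat ugraph. Z \<subseteq> edges G}" by auto
    ultimately show "measure_pmf.prob (gnp n p) {G. \<forall>e\<in>Z. e \<in> edges G} = p ^ card Z"
      using prob_gnp_subset[of p Z n] p by simp
  qed auto
  also have "\<dots> = exp (p * card ?I * (ln 2 - 1) / 2)" by (simp add: ln_div field_simps)
  also have "\<dots> \<le> exp (- (p * (real n)\<^sup>2 / 32))"
  proof -
    have "p * ((real n)\<^sup>2 / 4) * (1 / 4) \<le> p * card ?I * (1 - ln 2)"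
      using M p ln2_le_25_over_36 by (intro mult_mono) auto
    then show ?thesis by (simp add: algebra_simps)
  qed
  finally show ?thesis .
qed

section \<open>Hitting sets and edge counts\<close>

lemma exists_le_average:
  fixes f :: "'a \<Rightarrow> real" and c :: real
  assumes "finite V" "V \<noteq> {}" "sum f V \<le> c * card V"
  shows "\<exists>v\<in>V. f v \<le> c"
proof (rule ccontr)
  assume "\<not> ?thesis"
  then have "sum (\<lambda>_. c) V < sum f V" using assms by (intro sum_strict_mono) auto
  then show False using assms by (simp add: mult.commute)
qed

text \<open>A derandomised choice of \<open>r\<close> random points. The potential adds the cost
  \<open>f\<close> of the chosen points to \<open>d\<close> times the number of constraints still
  unhit; by averaging, some point costs at most the mean of \<open>f\<close> and leaves at most a
  fraction \<open>1 - q\<close> of the unhit constraints, both measured jointly.\<close>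

lemma hitting_set:
  fixes f :: "'a \<Rightarrow> real" and Q :: "'e \<Rightarrow> 'a \<Rightarrow> bool" and q d :: real
  assumes fin: "finite V" "V \<noteq> {}" "finite E" and f: "\<And>v. v \<in> V \<Longrightarrow> 0 \<le> f v"
    and q: "0 \<le> q" "q \<le> 1" and Q: "\<And>e. e \<in> E \<Longrightarrow> q * card V \<le> card {v\<in>V. Q e v}"
    and d: "0 \<le> d"
  shows "\<exists>X\<subseteq>V. card X \<le> r \<and>
    sum f X + d * card {e\<in>E. \<forall>v\<in>X. \<not> Q e v} \<le> r * (sum f V / card V) + d * (1 - q) ^ r * card E"
  using d
proof (induction r arbitrary: d)
  case 0
  then show ?case by (intro exI[of _ "{}"]) auto
next
  case (Suc r)
  then have "0 \<le> d * (1 - q)" using q by simp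
  \<comment> \<open>The induction hypothesis is used with weight \<open>d * (1 - q)\<close>,
    anticipating the saving that the last point brings.\<close>
  from Suc.IH[OF this] obtain X where X: "X \<subseteq> V" "card X \<le> r"
    "sum f X + (d * (1 - q)) * card {e\<in>E. \<forall>v\<in>X. \<not> Q e v} \<le> r * (sum f V / card V) + d * (1 - q) * (1 - q) ^ r * card E"
    by blast
  let ?U = "{e\<in>E. \<forall>v\<in>X. \<not> Q e v}"
  have cV: "real (card V) > 0" using fin by (simp add: card_gt_0_iff)
  have finU: "finite ?U" using fin by simp
  have "(\<Sum>v\<in>V. real (card {e\<in>?U. \<not> Q e v})) = (\<Sum>v\<in>V. \<Sum>e\<in>?U. if \<not> Q e v then 1 else 0)"
    using fin by (intro sum.cong) (auto simp: sum.If_cases Int_def)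
  also have "\<dots> = (\<Sum>e\<in>?U. \<Sum>v\<in>V. if \<not> Q e v then 1 else 0)" by (rule sum.swap)
  also have "\<dots> = (\<Sum>e\<in>?U. real (card {v\<in>V. \<not> Q e v}))"
    using fin by (intro sum.cong) (auto simp: sum.If_cases Int_def)
  also have "\<dots> \<le> (\<Sum>e\<in>?U. (1 - q) * card V)"
  proof (rule sum_mono)
    fix e assume "e \<in> ?U"
    then have "q * card V \<le> card {v\<in>V. Q e v}" using Q by auto
    moreover have "card V = card {v\<in>V. Q e v} + card {v\<in>V. \<not> Q e v}"
      using fin by (subst card_Un_disjoint[symmetric]) (auto intro: arg_cong[where f=card])
    ultimately show "real (card {v\<in>V. \<not> Q e v}) \<le> (1 - q) * card V" by (simp add: algebra_simps)
  qed
  finally have av: "(\<Sum>v\<in>V. real (card {e\<in>?U. \<not> Q e v})) \<le> (1 - q) * card V * card ?U"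
    by (simp add: mult.commute)
  have "(\<Sum>v\<in>V. f v + d * card {e\<in>?U. \<not> Q e v}) \<le> (sum f V / card V + d * (1 - q) * card ?U) * card V"
    using mult_left_mono[OF av, of d] Suc.prems cV
    by (simp add: sum.distrib sum_distrib_left[symmetric] algebra_simps)
  then obtain v where v: "v \<in> V" "f v + d * card {e\<in>?U. \<not> Q e v} \<le> sum f V / card V + d * (1 - q) * card ?U"
    using exists_le_average[OF fin(1,2)] by blast
  have finX: "finite X" using X fin finite_subset by auto
  have s: "sum f (insert v X) \<le> f v + sum f X"
    using finX f[OF v(1)] by (cases "v \<in> X") (auto simp: insert_absorb)
  have eq: "{e\<in>E. \<forall>u\<in>insert v X. \<not> Q e u} = {e\<in>?U. \<not> Q e v}" by auto
  have "sum f (insert v X) + d * card {e\<in>E. \<forall>u\<in>insert v X. \<not> Q e u} \<le>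
     Suc r * (sum f V / card V) + d * (1 - q) ^ Suc r * card E"
    unfolding eq using s v(2) X(3) by (simp add: algebra_simps add_divide_distrib)
  moreover have "card (insert v X) \<le> Suc r" using X finX by (auto simp: card_insert_if)
  ultimately show ?case using X v by (intro exI[of _ "insert v X"]) auto
qed

text \<open>The relation may be asymmetric, since directed bad edges are counted too. On a symmetric
  relation, \<open>ecount h V V\<close> counts each edge twice.\<close>

definition ecount :: "('a \<Rightarrow> 'b \<Rightarrow> bool) \<Rightarrow> 'a set \<Rightarrow> 'b set \<Rightarrow> nat" where
  "ecount h X Y = (\<Sum>x\<in>X. card {y\<in>Y. h x y})"

lemma ecount_swap:
  assumes "finite X" "finite Y"
  shows "ecount h X Y = (\<Sum>y\<in>Y. card {x\<in>X. h x y})"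
proof -
  have "ecount h X Y = (\<Sum>x\<in>X. \<Sum>y\<in>Y. if h x y then 1 else 0)"
    unfolding ecount_def using assms by (intro sum.cong) (auto simp: sum.If_cases Int_def)
  also have "\<dots> = (\<Sum>y\<in>Y. \<Sum>x\<in>X. if h x y then 1 else 0)" by (rule sum.swap)
  also have "\<dots> = (\<Sum>y\<in>Y. card {x\<in>X. h x y})"
    using assms by (intro sum.cong) (auto simp: sum.If_cases Int_def)
  finally show ?thesis .
qed

lemma ecount_sym:
  assumes "finite X" "finite Y" "\<And>x y. h x y \<Longrightarrow> h y x"
  shows "ecount h X Y = ecount h Y X"
  using assms by (subst ecount_swap) (auto simp: ecount_def intro!: sum.cong arg_cong[where f=card])

lemma ecount_union_left:
  "finite X \<Longrightarrow> finite X' \<Longrightarrow> X \<inter> X' = {} \<Longrightarrow> ecount h (X \<union> X') Y = ecount h X Y + ecount h X' Y"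
  by (simp add: ecount_def sum.union_disjoint)

section \<open>Building the grid row by row\<close>

text \<open>
  Here \<open>g\<close> is adjacency in the random graph and \<open>h\<close> adjacency in the bipartite graph \<open>H[A, B]\<close>.
  In \<open>no_concentration\<close> the relation \<open>F\<close> need not be symmetric: it is applied to \<open>h\<close> with bad
  edges removed, and badness depends on the direction of an edge.
\<close>

locale grid_host =
  fixes A B :: "'a set" and h g :: "'a \<Rightarrow> 'a \<Rightarrow> bool" and N b r s :: nat
    and \<theta> \<eta> k t \<Delta> cd :: real
  assumes fin: "finite A" "finite B" and disj: "A \<inter> B = {}" and cA: "card A = N" and cB: "card B = N"
    and h_sym: "h x y \<Longrightarrow> h y x"
    and h_sides: "h x y \<Longrightarrow> x \<in> A \<and> y \<in> B \<or> x \<in> B \<and> y \<in> A"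
    and h_g: "h x y \<Longrightarrow> g x y"
    and dense: "X \<subseteq> A \<Longrightarrow> Y \<subseteq> B \<Longrightarrow> \<eta> * N \<le> card X \<Longrightarrow> \<eta> * N \<le> card Y \<Longrightarrow>
      \<theta> * card X * card Y \<le> ecount h X Y"
    and no_concentration: "X \<subseteq> A \<union> B \<Longrightarrow> S \<subseteq> A \<union> B \<Longrightarrow> V \<subseteq> A \<union> B \<Longrightarrow> X \<inter> S = {} \<Longrightarrow> X \<inter> V = {} \<Longrightarrow>
      S \<inter> V = {} \<Longrightarrow> card V \<le> N \<Longrightarrow> card X \<le> b \<Longrightarrow> card S = b \<Longrightarrow>
      (\<And>x v. F x v \<Longrightarrow> h x v) \<Longrightarrow> (\<And>w. w \<in> S \<Longrightarrow> R w \<subseteq> X) \<Longrightarrow>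
      (\<And>w. w \<in> S \<Longrightarrow> card {v\<in>V. \<forall>x\<in>R w. \<not> F x v} \<le> 4 * \<eta> * N) \<Longrightarrow>
      (\<And>w. w \<in> S \<Longrightarrow> k / 4 \<le> card {v\<in>V. g w v \<and> (\<forall>x\<in>R w. \<not> F x v)}) \<Longrightarrow> False"
    and max_degree: "real (card {y. h x y}) \<le> \<Delta>"
    and codegree: "x \<noteq> y \<Longrightarrow> real (card {z. h x z \<and> h y z}) \<le> cd"
    and pos: "0 < \<theta>" "0 < \<eta>" "0 < t" "\<theta> * \<eta> \<le> 1" "4 \<le> k" "0 < N" "4 * \<eta> < 1"
    and num_r: "r \<le> b" "(1 - \<theta> * \<eta>) ^ r \<le> \<eta> / 4" "2 * r * t \<le> k / 8"
    and num_b: "2 * b \<le> \<eta> * N" "4 * b \<le> k" "2 * k * b \<le> \<eta> * N * t"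
    and num_D: "(1 - t / (2 * \<Delta>)) ^ b * (b * N) < 1" "t \<le> 2 * \<Delta>"
    and num_k: "8 * k \<le> \<theta> * N"
    and num_s: "s * cd \<le> k" "4 * s \<le> k" "s * s \<le> 4 * \<eta> * N"
begin

text \<open>All assumptions are symmetric in \<open>A\<close> and \<open>B\<close>, so each
  one-sided statement is proved once and transferred by this lemma.\<close>

lemma swap: "grid_host B A h g N b r s \<theta> \<eta> k t \<Delta> cd"
proof
  fix X Y assume "X \<subseteq> B" "Y \<subseteq> A" "\<eta> * N \<le> card X" "\<eta> * N \<le> card Y"
  then show "\<theta> * card X * card Y \<le> ecount h X Y"
    using dense[of Y X] ecount_sym[of X Y h] fin finite_subset h_sym
    by (metis mult.assoc mult.commute)
next
  fix X S V :: "'a set" and F R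
  assume "X \<subseteq> B \<union> A" "S \<subseteq> B \<union> A" "V \<subseteq> B \<union> A" "X \<inter> S = {}" "X \<inter> V = {}"
      "S \<inter> V = {}" "card V \<le> N" "card X \<le> b" "card S = b"
      "(\<And>x v. F x v \<Longrightarrow> h x v)" "(\<And>w. w \<in> S \<Longrightarrow> R w \<subseteq> X)"
      "(\<And>w. w \<in> S \<Longrightarrow> card {v\<in>V. \<forall>x\<in>R w. \<not> F x v} \<le> 4 * \<eta> * N)"
      "(\<And>w. w \<in> S \<Longrightarrow> k / 4 \<le> card {v\<in>V. g w v \<and> (\<forall>x\<in>R w. \<not> F x v)})"
  then show False using no_concentration[of X S V F R] by (simp add: Un_commute)
next
  show "h x y \<Longrightarrow> x \<in> B \<and> y \<in> A \<or> x \<in> A \<and> y \<in> B" for x y using h_sides by blast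
  show "B \<inter> A = {}" using disj by blast
  show "h x y \<Longrightarrow> h y x" for x y by (rule h_sym)
qed (fact fin cA cB h_g max_degree codegree pos num_r num_b num_D num_k num_s)+

abbreviation "nb x \<equiv> {y. h x y}"

lemma fin_nb [simp]: "finite (nb x)"
  by (rule finite_subset[of _ "A \<union> B"]) (use h_sides fin in auto)

lemma nb_A: "x \<in> A \<Longrightarrow> nb x \<subseteq> B" and nb_B: "x \<in> B \<Longrightarrow> nb x \<subseteq> A"
  using h_sides disj by blast+

text \<open>Were there \<open>\<eta> * N\<close> such vertices, \<open>dense\<close> would apply to
  them and \<open>Y\<close> and contradict their degree sum.\<close>

lemma few_low_degree_B:
  assumes "Y \<subseteq> A" "\<eta> * N \<le> card Y"
  shows "card {x\<in>B. card (nb x \<inter> Y) < \<theta> * card Y} < \<eta> * N"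
proof (rule ccontr)
  let ?L = "{x\<in>B. card (nb x \<inter> Y) < \<theta> * card Y}"
  assume "\<not> ?thesis"
  then have L: "\<eta> * N \<le> card ?L" by simp
  have finY: "finite Y" using assms fin finite_subset by auto
  have "0 < \<eta> * N" using pos by simp
  then have ne: "?L \<noteq> {}" using L by (metis card.empty not_le of_nat_0)
  have "\<theta> * card Y * card ?L \<le> ecount h Y ?L" using assms L by (intro dense) auto
  also have "ecount h Y ?L = (\<Sum>x\<in>?L. card {y\<in>Y. h y x})"
    using fin finY by (intro ecount_swap) auto
  also have "real \<dots> = (\<Sum>x\<in>?L. real (card (nb x \<inter> Y)))"
    unfolding of_nat_sum by (intro sum.cong refl arg_cong[where f="\<lambda>x. real (card x)"]) (auto intro: h_sym)
  also have "\<dots> < (\<Sum>x\<in>?L. \<theta> * card Y)"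
    using ne fin by (intro sum_strict_mono) auto
  finally show False by (simp add: mult_ac)
qed

section \<open>Vertices whose neighbourhood does not expand\<close>

definition side :: "'a \<Rightarrow> 'a set" where "side x = (if x \<in> A then A else B)"

text \<open>Neighbours of a set \<open>R\<close> of neighbours of \<open>w\<close> lie on the side
  of \<open>w\<close> itself. The threshold is \<open>k / 2\<close> instead of \<open>k\<close>
  because witnesses of size \<open>k\<close> are trimmed before expansion is applied to
  them.\<close>

definition nonexpanding :: "'a set" where
  "nonexpanding = {w\<in>A \<union> B. \<exists>R\<subseteq>nb w. k / 2 \<le> card R \<and> 2 * \<eta> * N < card {y\<in>side w. card (nb y \<inter> R) < t}}"

text \<open>
  A single random-like set \<open>X\<close> of size \<open>r\<close> simultaneously hits almost all neighbourhoods but few points of \<open>R w\<close>,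
  for at least half of the exceptional vertices \<open>w\<close>; hence the weighted form of \<open>hitting_set\<close>.
\<close>

lemma card_nonexpanding_A: "card (nonexpanding \<inter> A) < 2 * b"
proof (rule ccontr)
  assume "\<not> ?thesis"
  then obtain S where S: "S \<subseteq> nonexpanding \<inter> A" "card S = 2 * b" "finite S"
    by (meson not_le obtain_subset_with_card_n)
  have "\<forall>w\<in>S. \<exists>R. R \<subseteq> nb w \<and> k / 2 \<le> card R \<and> 2 * \<eta> * N < card {y\<in>A. card (nb y \<inter> R) < t}"
  proof
    fix w assume "w \<in> S"
    then have "w \<in> nonexpanding" "side w = A" using S by (auto simp: side_def)
    then show "\<exists>R. R \<subseteq> nb w \<and> k / 2 \<le> card R \<and> 2 * \<eta> * N < card {y\<in>A. card (nb y \<inter> R) < t}"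
      unfolding nonexpanding_def by auto
  qed
  from bchoice[OF this] obtain R where "\<forall>w\<in>S. R w \<subseteq> nb w \<and> k / 2 \<le> card (R w) \<and>
      2 * \<eta> * N < card {y\<in>A. card (nb y \<inter> R w) < t}" by (rule exE)
  then have R: "\<And>w. w \<in> S \<Longrightarrow> R w \<subseteq> nb w" "\<And>w. w \<in> S \<Longrightarrow> k / 2 \<le> card (R w)"
    "\<And>w. w \<in> S \<Longrightarrow> 2 * \<eta> * N < card {y\<in>A. card (nb y \<inter> R w) < t}" by simp_all
  \<comment> \<open>The hitting set is taken from \<open>V\<close> and must avoid \<open>S\<close>.
    Discarding \<open>S\<close> costs at most \<open>2 * b \<le> \<eta> * N\<close> vertices, so
    each \<open>Y w\<close> keeps more than \<open>\<eta> * N\<close>.\<close>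
  define V where "V = A - S"
  define Y where "Y w = {y\<in>V. card (nb y \<inter> R w) < t}" for w
  have finV: "finite V" using fin by (simp add: V_def)
  have YV: "Y w \<subseteq> V" for w unfolding Y_def by (rule Collect_restrict)
  have cV: "card V \<le> N" unfolding V_def using fin cA by (metis card_mono Diff_subset)
  have cY: "\<eta> * N < card (Y w)" if "w \<in> S" for w
  proof -
    have "{y\<in>A. card (nb y \<inter> R w) < t} \<subseteq> Y w \<union> S" by (auto simp: Y_def V_def)
    then have "card {y\<in>A. card (nb y \<inter> R w) < t} \<le> card (Y w \<union> S)"
      using finV YV S by (intro card_mono) (auto intro: finite_subset)
    also have "\<dots> \<le> card (Y w) + card S" by (rule card_Un_le)
    finally show ?thesis using R(3)[OF that] S num_b by linarith
  qed
  have etaN: "0 < \<eta> * N" using pos by simp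
  have bpos: "0 < b"
  proof (rule ccontr)
    assume "\<not> 0 < b"
    \<comment> \<open>For \<open>b = 0\<close> the empty sets would satisfy all premises of
      \<open>no_concentration\<close>.\<close>
    then show False using no_concentration[of "{}" "{}" "{}" "\<lambda>_ _. False" "\<lambda>_. {}"] pos by simp
  qed
  then have Sne: "S \<noteq> {}" using S by auto
  have Vne: "V \<noteq> {}"
  proof -
    obtain w where "w \<in> S" using Sne by auto
    then have "card (Y w) > 0" using cY[of w] etaN by (metis less_trans of_nat_0_less_iff)
    then show ?thesis using YV[of w] by auto
  qed
  have cV0: "real (card V) > 0" using Vne finV by (simp add: card_gt_0_iff)
  define f where "f v = (\<Sum>w\<in>S. if v \<in> Y w then real (card (nb v \<inter> R w)) else 0)" for v
  \<comment> \<open>The constraints: \<open>x\<close> should have a neighbour in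
    \<open>X \<inter> Y w\<close>. Vertices \<open>x\<close> below this threshold are among the few
    of low degree into \<open>Y w\<close>, as \<open>card (Y w)\<close> exceeds
    \<open>\<eta> * N\<close>.\<close>
  define E where "E = {(w, x). w \<in> S \<and> x \<in> B \<and> \<theta> * \<eta> * card V \<le> card (nb x \<inter> Y w)}"
  define Q where "Q = (\<lambda>(w, x) v. h x v \<and> v \<in> Y w)"
  have EsubSB: "E \<subseteq> S \<times> B" by (auto simp: E_def)
  have finE: "finite E" using EsubSB S fin finite_subset by blast
  have cE: "card E \<le> 2 * b * N" using card_mono[OF _ EsubSB] S fin cB by (simp add: card_cartesian_product)
  \<comment> \<open>The exchange rate between the two failures: missing \<open>\<eta> * N\<close>
    vertices of \<open>B\<close> weighs as much as hitting \<open>k / 4\<close> points of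
    \<open>R w\<close>.\<close>
  define d where "d = k / (4 * \<eta> * N)"
  have d0: "0 \<le> d" using pos by (simp add: d_def)
  have "\<exists>X\<subseteq>V. card X \<le> r \<and> sum f X + d * card {e\<in>E. \<forall>v\<in>X. \<not> Q e v} \<le>
      r * (sum f V / card V) + d * (1 - \<theta> * \<eta>) ^ r * card E"
  proof (rule hitting_set[OF finV Vne finE _ _ pos(4) _ d0])
    show "0 \<le> f v" for v by (simp add: f_def sum_nonneg)
    show "0 \<le> \<theta> * \<eta>" using pos by simp
    fix e assume "e \<in> E"
    then obtain w x where e: "e = (w, x)" "\<theta> * \<eta> * card V \<le> card (nb x \<inter> Y w)" by (auto simp: E_def)
    have "nb x \<inter> Y w = {v\<in>V. Q e v}" using YV e by (auto simp: Q_def)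
    then show "\<theta> * \<eta> * card V \<le> card {v\<in>V. Q e v}" using e by simp
  qed
  then obtain X where X: "X \<subseteq> V" "card X \<le> r"
    "sum f X + d * card {e\<in>E. \<forall>v\<in>X. \<not> Q e v} \<le> r * (sum f V / card V) + d * (1 - \<theta> * \<eta>) ^ r * card E"
    by blast
  have finX: "finite X" using X finV finite_subset by auto
  define hit where "hit w = (\<Sum>v\<in>X \<inter> Y w. real (card (nb v \<inter> R w)))" for w
  define miss where "miss w = {x\<in>B. \<theta> * \<eta> * card V \<le> card (nb x \<inter> Y w) \<and> nb x \<inter> X \<inter> Y w = {}}" for w
  have sum_hit: "sum f X = (\<Sum>w\<in>S. hit w)"
  proof -
    have "sum f X = (\<Sum>w\<in>S. \<Sum>v\<in>X. if v \<in> Y w then real (card (nb v \<inter> R w)) else 0)"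
      unfolding f_def by (rule sum.swap)
    then show ?thesis using finX by (simp add: hit_def sum.inter_restrict)
  qed
  have sum_miss: "card {e\<in>E. \<forall>v\<in>X. \<not> Q e v} = (\<Sum>w\<in>S. card (miss w))"
  proof -
    have "{e\<in>E. \<forall>v\<in>X. \<not> Q e v} = (SIGMA w:S. miss w)"
      by (auto simp: E_def Q_def miss_def)
    then show ?thesis using S fin by (simp add: miss_def)
  qed
  have fV: "sum f V \<le> 2 * b * t * card V"
  proof -
    have "sum f V \<le> (\<Sum>v\<in>V. \<Sum>w\<in>S. t)"
      unfolding f_def by (intro sum_mono) (use pos in \<open>auto simp: Y_def\<close>)
    then show ?thesis using S by (simp add: mult_ac)
  qed
  have tot: "(\<Sum>w\<in>S. hit w + d * card (miss w)) \<le> k * b / 4"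
  proof -
    have "r * (sum f V / card V) \<le> r * (2 * b * t)"
      using fV cV0 by (intro mult_left_mono) (simp_all add: field_simps)
    also have "\<dots> = b * (2 * r * t)" by (simp add: mult_ac)
    also have "\<dots> \<le> b * (k / 8)" using num_r by (intro mult_left_mono) auto
    finally have 1: "r * (sum f V / card V) \<le> b * (k / 8)" .
    have "d * (1 - \<theta> * \<eta>) ^ r * card E \<le> d * (\<eta> / 4) * (2 * b * N)"
      using num_r d0 cE pos by (intro mult_mono) (auto simp flip: of_nat_mult)
    also have "\<dots> = b * (k / 8)" using pos by (simp add: d_def)
    finally have 2: "d * (1 - \<theta> * \<eta>) ^ r * card E \<le> b * (k / 8)" .
    have "(\<Sum>w\<in>S. hit w + d * card (miss w)) = sum f X + d * card {e\<in>E. \<forall>v\<in>X. \<not> Q e v}"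
      unfolding sum_hit sum_miss by (simp add: sum.distrib sum_distrib_left)
    moreover have "k * b / 4 = b * (k / 8) + b * (k / 8)" by simp
    ultimately show ?thesis using X(3) 1 2 by linarith
  qed
  have hit0: "0 \<le> hit w" for w by (simp add: hit_def sum_nonneg)
  \<comment> \<open>Each vertex outside \<open>S1\<close> contributes at least \<open>k / 4\<close>
    to a total of at most \<open>b * (k / 4)\<close>, so at most \<open>b\<close> of the
    \<open>2 * b\<close> vertices are lost. This is why \<open>S\<close> was taken twice as large as
    needed.\<close>
  define S1 where "S1 = {w\<in>S. hit w \<le> k / 4 \<and> card (miss w) \<le> \<eta> * N}"
  have "card (S - S1) * (k / 4) = (\<Sum>w\<in>S - S1. k / 4)" by simp
  also have "\<dots> \<le> (\<Sum>w\<in>S - S1. hit w + d * card (miss w))"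
  proof (rule sum_mono)
    fix w assume w: "w \<in> S - S1"
    show "k / 4 \<le> hit w + d * card (miss w)"
    proof (cases "hit w \<le> k / 4")
      case True
      then have "\<eta> * N \<le> card (miss w)" using w by (auto simp: S1_def)
      then have "d * (\<eta> * N) \<le> d * card (miss w)" using d0 by (rule mult_left_mono)
      moreover have "d * (\<eta> * N) = k / 4" using pos by (simp add: d_def)
      ultimately show ?thesis using hit0[of w] by linarith
    next
      case False
      then show ?thesis using d0 by (simp add: add_increasing2)
    qed
  qed
  also have "\<dots> \<le> (\<Sum>w\<in>S. hit w + d * card (miss w))"
    using S d0 hit0 by (intro sum_mono2) auto
  also have "\<dots> \<le> b * (k / 4)" using tot by (simp add: mult_ac)
  finally have "card (S - S1) \<le> b" using pos by simp
  moreover have "card (S - S1) = card S - card S1" using S by (intro card_Diff_subset) (auto simp: S1_def)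
  ultimately have "b \<le> card S1" using S by simp
  then obtain S' where S': "S' \<subseteq> S1" "card S' = b" by (meson obtain_subset_with_card_n)
  have S'S: "S' \<subseteq> S" using S' by (auto simp: S1_def)
  show False
  \<comment> \<open>The vertices of \<open>B\<close> missed by \<open>X \<inter> Y w\<close> are of
    low degree into \<open>Y w\<close> or lie in \<open>miss w\<close>, hence are few. Yet they
    contain \<open>R w\<close> up to \<open>hit w\<close> points, that is, at least
    \<open>k / 2 - k / 4\<close> neighbours of \<open>w\<close>.\<close>
  proof (rule no_concentration[of X S' B h "\<lambda>w. X \<inter> Y w"])
    show "X \<subseteq> A \<union> B" "X \<inter> B = {}" "X \<inter> S' = {}" using X S'S disj by (auto simp: V_def)
    show "S' \<subseteq> A \<union> B" "S' \<inter> B = {}" using S'S S disj by auto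
    show "card B \<le> N" "card X \<le> b" "card S' = b" using cB X num_r S' by auto
    fix w assume "w \<in> S'"
    then have w: "w \<in> S" "hit w \<le> k / 4" "card (miss w) \<le> \<eta> * N" using S' by (auto simp: S1_def)
    let ?T = "{v\<in>B. \<forall>x\<in>X \<inter> Y w. \<not> h x v}"
    let ?L = "{x\<in>B. card (nb x \<inter> Y w) < \<theta> * card (Y w)}"
    have "?T \<subseteq> ?L \<union> miss w"
    proof
      fix x assume x: "x \<in> ?T"
      have "\<theta> * \<eta> * card V \<le> \<theta> * (\<eta> * N)" using cV pos by (simp add: mult.assoc mult_left_mono)
      also have "\<dots> \<le> \<theta> * card (Y w)" using cY[OF w(1)] pos by (intro mult_left_mono) auto
      finally show "x \<in> ?L \<union> miss w" using x by (auto simp: miss_def intro: h_sym)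
    qed
    then have "card ?T \<le> card (?L \<union> miss w)"
      using fin by (intro card_mono) (auto simp: miss_def)
    also have "\<dots> \<le> card ?L + card (miss w)" by (rule card_Un_le)
    finally have "real (card ?T) \<le> card ?L + card (miss w)" by simp
    moreover have "card ?L < \<eta> * N"
      using cY[OF w(1)] YV by (intro few_low_degree_B) (auto simp: V_def)
    ultimately show "card ?T \<le> 4 * \<eta> * N" using w(3) etaN by linarith
    have RB: "R w \<subseteq> B" using R(1)[OF w(1)] nb_A w S by blast
    have finR: "finite (R w)" using RB fin finite_subset by auto
    have "R w \<subseteq> {v\<in>B. g w v \<and> (\<forall>x\<in>X \<inter> Y w. \<not> h x v)} \<union> (\<Union>v\<in>X \<inter> Y w. nb v \<inter> R w)"
      using RB R(1)[OF w(1)] h_g by blast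
    then have "card (R w) \<le> card ({v\<in>B. g w v \<and> (\<forall>x\<in>X \<inter> Y w. \<not> h x v)} \<union> (\<Union>v\<in>X \<inter> Y w. nb v \<inter> R w))"
      using fin finX by (intro card_mono) auto
    also have "\<dots> \<le> card {v\<in>B. g w v \<and> (\<forall>x\<in>X \<inter> Y w. \<not> h x v)} + card (\<Union>v\<in>X \<inter> Y w. nb v \<inter> R w)"
      by (rule card_Un_le)
    also have "card (\<Union>v\<in>X \<inter> Y w. nb v \<inter> R w) \<le> (\<Sum>v\<in>X \<inter> Y w. card (nb v \<inter> R w))"
      using finX by (intro card_UN_le) auto
    finally have "real (card (R w)) \<le> card {v\<in>B. g w v \<and> (\<forall>x\<in>X \<inter> Y w. \<not> h x v)} + hit w"
      by (simp add: hit_def flip: of_nat_sum)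
    then show "k / 4 \<le> card {v\<in>B. g w v \<and> (\<forall>x\<in>X \<inter> Y w. \<not> h x v)}"
      using R(2)[OF w(1)] w(2) by linarith
  qed auto
qed

lemma b_pos: "0 < b"
proof (rule ccontr)
  assume "\<not> 0 < b"
  then show False using no_concentration[of "{}" "{}" "{}" "\<lambda>_ _. False" "\<lambda>_. {}"] pos by simp
qed

lemma card_nonexpanding_B: "card (nonexpanding \<inter> B) < 2 * b"
proof -
  interpret sw: grid_host B A h g N b r s \<theta> \<eta> k t \<Delta> cd by (rule swap)
  have "sw.side x = side x" if "x \<in> A \<union> B" for x using that disj by (auto simp: side_def sw.side_def)
  then have "sw.nonexpanding = nonexpanding" unfolding nonexpanding_def sw.nonexpanding_def by (auto simp: Un_commute)
  then show ?thesis using sw.card_nonexpanding_A by simp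
qed

section \<open>Bad edges and a fixed point of their definition\<close>

text \<open>The edges that become bad once all edges in \<open>bad\<close> are discarded.\<close>

definition judge :: "('a \<times> 'a) set \<Rightarrow> ('a \<times> 'a) set" where
  "judge bad = {(w, w'). h w w' \<and> w \<notin> nonexpanding \<and> (\<exists>R Y. R \<subseteq> nb w \<and> Y \<subseteq> nb w' \<and> k \<le> card R \<and> k \<le> card Y \<and>
     (\<forall>x\<in>R. \<forall>y\<in>Y. h x y \<longrightarrow> (x, y) \<in> bad))}"

lemma judge_mono: "bad \<subseteq> bad' \<Longrightarrow> judge bad \<subseteq> judge bad'"
  unfolding judge_def by blast

lemma fin_out: "bad \<subseteq> {(x, y). h x y} \<Longrightarrow> finite (bad `` {x})"
  by (rule finite_subset[of _ "nb x"]) auto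

text \<open>
  The witnesses \<open>R\<close> for \<open>b\<close> many bad edges at \<open>w\<close> are all subsets of \<open>nb w\<close>. A common hitting set \<open>X\<close> of
  size at most \<open>b\<close> captures the neighbourhoods of all of them up to \<open>3 * \<eta> * N\<close> vertices.
\<close>

lemma out_judge_A:
  assumes bad: "bad \<subseteq> {(x, y). h x y}" "\<And>x. card (bad `` {x}) < b" and w: "w \<in> A"
  shows "card (judge bad `` {w}) < b"
proof (rule ccontr)
  assume "\<not> ?thesis"
  then obtain S where S: "S \<subseteq> judge bad `` {w}" "card S = b" "finite S"
    by (meson not_le obtain_subset_with_card_n)
  have wn: "w \<notin> nonexpanding" using S b_pos by (force simp: judge_def)
  have SB: "S \<subseteq> B" using S nb_A[OF w] by (auto simp: judge_def)
  have "\<forall>v\<in>S. \<exists>RY. fst RY \<subseteq> nb w \<and> snd RY \<subseteq> nb v \<and> k \<le> card (fst RY) \<and> k \<le> card (snd RY) \<and>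
     (\<forall>x\<in>fst RY. \<forall>y\<in>snd RY. h x y \<longrightarrow> (x, y) \<in> bad)"
  proof
    fix v assume "v \<in> S"
    then have "(w, v) \<in> judge bad" using S by auto
    then obtain R Y where "R \<subseteq> nb w \<and> Y \<subseteq> nb v \<and> k \<le> card R \<and> k \<le> card Y \<and> (\<forall>x\<in>R. \<forall>y\<in>Y. h x y \<longrightarrow> (x, y) \<in> bad)"
      unfolding judge_def by auto
    then show "\<exists>RY. fst RY \<subseteq> nb w \<and> snd RY \<subseteq> nb v \<and> k \<le> card (fst RY) \<and> k \<le> card (snd RY) \<and>
     (\<forall>x\<in>fst RY. \<forall>y\<in>snd RY. h x y \<longrightarrow> (x, y) \<in> bad)"
      by (intro exI[of _ "(R, Y)"]) simp
  qed
  from bchoice[OF this] obtain RY where RY: "\<And>v. v \<in> S \<Longrightarrow> fst (RY v) \<subseteq> nb w \<and> snd (RY v) \<subseteq> nb v \<and>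
      k \<le> card (fst (RY v)) \<and> k \<le> card (snd (RY v)) \<and> (\<forall>x\<in>fst (RY v). \<forall>y\<in>snd (RY v). h x y \<longrightarrow> (x, y) \<in> bad)"
    by blast
  \<comment> \<open>The witnesses are stripped of \<open>S\<close>, so that \<open>X\<close> avoids
    \<open>S\<close>, and cut to a common size: at least \<open>k / 2\<close>, so that
    \<open>w\<close> being expanding applies to them, and at most \<open>k\<close>, so that few bad
    edges start in them.\<close>
  define m where "m = nat \<lceil>k / 2\<rceil>"
  have m: "k / 2 \<le> m" "m \<le> k / 2 + 1" "m \<le> k" using pos unfolding m_def by linarith+
  have "\<exists>R. R \<subseteq> fst (RY v) - S \<and> card R = m" if "v \<in> S" for v
  proof -
    have "finite (fst (RY v))" using RY[OF that] fin_nb finite_subset by blast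
    have "card (fst (RY v)) - card S \<le> card (fst (RY v) - S)" using S(3) by (rule diff_card_le_card_Diff)
    then have "real m \<le> card (fst (RY v) - S)" using conjunct1[OF conjunct2[OF conjunct2[OF RY[OF that]]]] S(2) m(2) num_b(2) pos(5) by linarith
    then have "m \<le> card (fst (RY v) - S)" by simp
    then obtain R where "R \<subseteq> fst (RY v) - S" "card R = m" by (rule obtain_subset_with_card_n)
    then show ?thesis by blast
  qed
  then have "\<forall>v\<in>S. \<exists>R. R \<subseteq> fst (RY v) - S \<and> card R = m" by blast
  from bchoice[OF this] obtain R where R: "\<And>v. v \<in> S \<Longrightarrow> R v \<subseteq> fst (RY v) - S \<and> card (R v) = m" by blast
  define V where "V = nb w - S"
  have RV: "R v \<subseteq> V" if "v \<in> S" for v using R[OF that] RY[OF that] by (auto simp: V_def)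
  have finV: "finite V" by (simp add: V_def)
  have VB: "V \<subseteq> B" using nb_A[OF w] by (auto simp: V_def)
  have cVD: "card V \<le> \<Delta>"
    using max_degree[of w] card_mono[OF fin_nb[of w], of V] by (simp add: V_def)
  obtain v0 where v0: "v0 \<in> S" using S b_pos by fastforce
  have "0 < m" using m pos by linarith
  then have "R v0 \<noteq> {}" using R[OF v0] by auto
  then have Vne: "V \<noteq> {}" using RV[OF v0] by auto
  then have D0: "0 < \<Delta>" using cVD finV by (smt (verit) card_gt_0_iff of_nat_0_less_iff)
  define gd where "gd y v = {x \<in> R v. h x y \<and> (x, y) \<notin> bad}" for y v
  \<comment> \<open>A vertex \<open>y\<close> with \<open>t\<close> neighbours in \<open>R v\<close>
    has \<open>t / 2\<close> good ones, and then it is a constraint to be hit, or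
    \<open>t / 2\<close> bad ones, and then it is counted in \<open>?M\<close> below.\<close>
  define E where "E = {(v, y). v \<in> S \<and> y \<in> A \<and> t / 2 \<le> card (gd y v)}"
  have EsubSA: "E \<subseteq> S \<times> A" by (auto simp: E_def)
  have finE: "finite E" using EsubSA S fin finite_subset by blast
  have cE: "card E \<le> b * N" using card_mono[OF _ EsubSA] S fin cA by (simp add: card_cartesian_product)
  define Q where "Q = (\<lambda>(v, y) x. x \<in> gd y v)"
  define q where "q = t / (2 * \<Delta>)"
  have q: "0 \<le> q" "q \<le> 1" using pos D0 num_D by (auto simp: q_def)
  have "\<exists>X\<subseteq>V. card X \<le> b \<and> (sum (\<lambda>_. 0) X :: real) + (1::real) * card {e\<in>E. \<forall>v\<in>X. \<not> Q e v} \<le>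
      b * (sum (\<lambda>_. 0) V / card V) + 1 * (1 - q) ^ b * card E"
  proof (rule hitting_set[OF finV Vne finE _ q])
    fix e assume "e \<in> E"
    then obtain v y where e: "e = (v, y)" "v \<in> S" "t / 2 \<le> card (gd y v)" by (auto simp: E_def)
    have "gd y v = {x\<in>V. Q e x}" using RV[OF e(2)] e by (auto simp: Q_def gd_def)
    moreover have "q * card V \<le> q * \<Delta>" using cVD q by (intro mult_left_mono) auto
    moreover have "q * \<Delta> = t / 2" using D0 by (simp add: q_def)
    ultimately show "q * card V \<le> card {x\<in>V. Q e x}" using e by simp
  qed auto
  then obtain X where X: "X \<subseteq> V" "card X \<le> b" "card {e\<in>E. \<forall>v\<in>X. \<not> Q e v} \<le> (1 - q) ^ b * card E" by auto
  \<comment> \<open>The number of unhit constraints is an integer below 1, so every constraint is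
    hit. This is what forces \<open>b\<close> to be of order \<open>log n / p\<close>.\<close>
  have "(1 - q) ^ b * card E \<le> (1 - q) ^ b * (b * N)"
    using cE q by (intro mult_left_mono) (auto simp flip: of_nat_mult)
  then have "card {e\<in>E. \<forall>v\<in>X. \<not> Q e v} = 0" using X(3) num_D by (simp add: q_def)
  then have X0: "\<And>e. e \<in> E \<Longrightarrow> \<exists>x\<in>X. Q e x" using finE by auto
  show False
  proof (rule no_concentration[of X S A "\<lambda>x y. h x y \<and> (x, y) \<notin> bad" "\<lambda>v. X \<inter> R v"])
    show "X \<subseteq> A \<union> B" "X \<inter> A = {}" "X \<inter> S = {}" using X VB disj by (auto simp: V_def)
    show "S \<subseteq> A \<union> B" "S \<inter> A = {}" using SB disj by auto
    show "card A \<le> N" "card X \<le> b" "card S = b" using cA X S by auto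
    fix v assume v: "v \<in> S"
    let ?T = "{y\<in>A. \<forall>x\<in>X \<inter> R v. \<not> (h x y \<and> (x, y) \<notin> bad)}"
    let ?L = "{y\<in>A. card (nb y \<inter> R v) < t}"
    let ?M = "{y\<in>A. t / 2 \<le> card {x\<in>R v. (x, y) \<in> bad}}"
    have finR: "finite (R v)" using RV[OF v] finV finite_subset by auto
    have "?T \<subseteq> ?L \<union> ?M"
    proof
      fix y assume y: "y \<in> ?T"
      have "(v, y) \<notin> E"
      proof
        assume "(v, y) \<in> E"
        from X0[OF this] obtain x where "x \<in> X" "x \<in> gd y v" by (auto simp: Q_def)
        then show False using y by (auto simp: gd_def)
      qed
      then have 1: "card (gd y v) < t / 2" using v y by (auto simp: E_def)
      have "nb y \<inter> R v \<subseteq> gd y v \<union> {x\<in>R v. (x, y) \<in> bad}" by (auto simp: gd_def intro: h_sym)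
      then have "card (nb y \<inter> R v) \<le> card (gd y v \<union> {x\<in>R v. (x, y) \<in> bad})"
        using finR by (intro card_mono) (auto simp: gd_def)
      also have "\<dots> \<le> card (gd y v) + card {x\<in>R v. (x, y) \<in> bad}" by (rule card_Un_le)
      finally have "real (card (nb y \<inter> R v)) \<le> card (gd y v) + card {x\<in>R v. (x, y) \<in> bad}" by simp
      then show "y \<in> ?L \<union> ?M" using 1 y by auto
    qed
    then have "card ?T \<le> card (?L \<union> ?M)" using fin by (intro card_mono) auto
    also have "\<dots> \<le> card ?L + card ?M" by (rule card_Un_le)
    finally have T: "real (card ?T) \<le> card ?L + card ?M" by simp
    have "R v \<subseteq> nb w" using RV[OF v] by (auto simp: V_def)
    moreover have "k / 2 \<le> card (R v)" using R[OF v] m by simp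
    ultimately have L: "card ?L \<le> 2 * \<eta> * N"
      using wn w by (auto simp: nonexpanding_def side_def not_less)
    \<comment> \<open>Double counting: fewer than \<open>b\<close> bad edges leave each of the at
      most \<open>k\<close> vertices of \<open>R v\<close>, so few \<open>y\<close> receive
      \<open>t / 2\<close> of them.\<close>
    have "card ?M * (t / 2) = (\<Sum>y\<in>?M. t / 2)" by simp
    also have "\<dots> \<le> (\<Sum>y\<in>?M. real (card {x\<in>R v. (x, y) \<in> bad}))" by (intro sum_mono) auto
    also have "\<dots> \<le> (\<Sum>y\<in>A. real (card {x\<in>R v. (x, y) \<in> bad}))" using fin by (intro sum_mono2) auto
    also have "\<dots> = real (ecount (\<lambda>x y. (x, y) \<in> bad) (R v) A)"
      using fin finR by (subst ecount_swap) auto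
    also have "\<dots> \<le> (\<Sum>x\<in>R v. real b)"
      unfolding ecount_def of_nat_sum
    proof (intro sum_mono)
      fix x
      have "card {y\<in>A. (x, y) \<in> bad} \<le> card (bad `` {x})"
        using fin_out[OF bad(1)] by (intro card_mono) auto
      then show "real (card {y\<in>A. (x, y) \<in> bad}) \<le> real b" using bad(2)[of x] by simp
    qed
    also have "\<dots> \<le> k * b" using R[OF v] m by (simp add: mult_right_mono)
    finally have "card ?M * t \<le> 2 * k * b" by simp
    also have "\<dots> \<le> \<eta> * N * t" by (rule num_b)
    finally have "card ?M \<le> \<eta> * N" using pos by simp
    moreover have "0 \<le> \<eta> * N" using pos by simp
    ultimately show "card ?T \<le> 4 * \<eta> * N" using T L by linarith
    \<comment> \<open>All edges of \<open>h\<close> from \<open>R v\<close> to the second witness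
      are bad, so that witness, consisting of at least \<open>k\<close> neighbours of
      \<open>v\<close>, lies entirely in the small missed set.\<close>
    have sub: "snd (RY v) \<subseteq> {y\<in>A. g v y \<and> (\<forall>x\<in>X \<inter> R v. \<not> (h x y \<and> (x, y) \<notin> bad))}"
      using RY[OF v] R[OF v] nb_B[of v] SB v h_g by blast
    then have "card (snd (RY v)) \<le> card {y\<in>A. g v y \<and> (\<forall>x\<in>X \<inter> R v. \<not> (h x y \<and> (x, y) \<notin> bad))}"
      using fin by (intro card_mono) auto
    then show "k / 4 \<le> card {y\<in>A. g v y \<and> (\<forall>x\<in>X \<inter> R v. \<not> (h x y \<and> (x, y) \<notin> bad))}"
      using RY[OF v] pos by linarith
  qed auto
qed

lemma out_judge:
  assumes bad: "bad \<subseteq> {(x, y). h x y}" "\<And>x. card (bad `` {x}) < b"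
  shows "card (judge bad `` {w}) < b"
proof -
  consider "w \<in> A" | "w \<in> B" | "w \<notin> A \<union> B" by auto
  then show ?thesis
  proof cases
    case 1 then show ?thesis using out_judge_A[OF bad] by simp
  next
    case 2
    interpret sw: grid_host B A h g N b r s \<theta> \<eta> k t \<Delta> cd by (rule swap)
    have "sw.side x = side x" if "x \<in> A \<union> B" for x using that disj by (auto simp: side_def sw.side_def)
    then have "sw.nonexpanding = nonexpanding" unfolding nonexpanding_def sw.nonexpanding_def by (auto simp: Un_commute)
    then have "sw.judge bad = judge bad" unfolding judge_def sw.judge_def by simp
    then show ?thesis using sw.out_judge_A[OF bad 2] by simp
  next
    case 3
    then have "judge bad `` {w} = {}" using h_sides by (auto simp: judge_def)
    then show ?thesis using b_pos by simp
  qed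
qed

text \<open>\<open>judge\<close> is monotone and preserves the bound \<open>b\<close> by
  \<open>out_judge\<close>, so it maps the finite family \<open>C\<close> into itself. A maximal
  member of \<open>C\<close> is contained in its image, and maximality forces equality.\<close>

lemma judge_fixpoint:
  obtains bad where "bad \<subseteq> {(x, y). h x y}" "\<And>x. card (bad `` {x}) < b" "judge bad = bad"
proof -
  define C where "C = {bad. bad \<subseteq> {(x, y). h x y} \<and> (\<forall>x. card (bad `` {x}) < b) \<and> bad \<subseteq> judge bad}"
  have "finite {(x, y). h x y}"
    by (rule finite_subset[of _ "(A \<union> B) \<times> (A \<union> B)"]) (use h_sides fin in auto)
  then have "finite C" by (auto simp: C_def intro: finite_subset[of _ "Pow {(x, y). h x y}"])
  moreover have "{} \<in> C" using b_pos by (auto simp: C_def)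
  ultimately obtain bad where bad: "bad \<in> C" "\<And>bad'. bad' \<in> C \<Longrightarrow> bad \<subseteq> bad' \<Longrightarrow> bad = bad'"
    using finite_has_maximal[of C] by auto
  have "judge bad \<subseteq> {(x, y). h x y}" by (auto simp: judge_def)
  moreover have "card (judge bad `` {x}) < b" for x using bad out_judge by (auto simp: C_def)
  moreover have "judge bad \<subseteq> judge (judge bad)" using bad judge_mono by (auto simp: C_def)
  ultimately have "judge bad \<in> C" by (simp add: C_def)
  then have "bad = judge bad" using bad by (auto simp: C_def)
  then show ?thesis using bad(1) that by (auto simp: C_def)
qed

section \<open>Discarding vertices with concentrated neighbourhoods\<close>

text \<open>The case of \<open>no_concentration\<close> with empty \<open>X\<close>: the small set
  is \<open>T \<inter> B\<close> itself and need not be described by neighbourhoods.\<close>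

lemma few_concentrated_A:
  assumes "card (T \<inter> B) \<le> 4 * \<eta> * N"
  shows "card {w\<in>A. k \<le> card (nb w \<inter> T)} < b"
proof (rule ccontr)
  assume "\<not> ?thesis"
  then obtain S where S: "S \<subseteq> {w\<in>A. k \<le> card (nb w \<inter> T)}" "card S = b"
    by (meson not_le obtain_subset_with_card_n)
  show False
  proof (rule no_concentration[of "{}" S "T \<inter> B" "\<lambda>_ _. False" "\<lambda>_. {}"])
    show "S \<inter> (T \<inter> B) = {}" using S disj by auto
    show "card (T \<inter> B) \<le> N" using fin cB by (metis card_mono Int_lower2)
    fix w assume "w \<in> S"
    then have w: "w \<in> A" "k \<le> card (nb w \<inter> T)" using S by auto
    have "nb w \<inter> T \<subseteq> {v\<in>T \<inter> B. g w v}" using nb_A[OF w(1)] h_g by auto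
    then have "card (nb w \<inter> T) \<le> card {v\<in>T \<inter> B. g w v}"
      using fin by (intro card_mono) auto
    then have "k / 4 \<le> card {v\<in>T \<inter> B. g w v}" using w pos by linarith
    then show "k / 4 \<le> card {v\<in>T \<inter> B. g w v \<and> (\<forall>x\<in>{}. \<not> False)}" by simp
    show "card {v\<in>T \<inter> B. \<forall>x\<in>{}. \<not> False} \<le> 4 * \<eta> * N" using assms by (simp add: Int_def)
  qed (use S in auto)
qed

lemma few_concentrated_B:
  assumes "card (T \<inter> A) \<le> 4 * \<eta> * N"
  shows "card {w\<in>B. k \<le> card (nb w \<inter> T)} < b"
  by (rule grid_host.few_concentrated_A[OF swap assms])

lemma few_low_degree_A:
  assumes "Y \<subseteq> B" "\<eta> * N \<le> card Y"
  shows "card {x\<in>A. card (nb x \<inter> Y) < \<theta> * card Y} < \<eta> * N"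
  by (rule grid_host.few_low_degree_B[OF swap assms])

text \<open>
  A maximal set \<open>U\<close> obtained by repeatedly adding vertices with many neighbours in it stays small,
  because few vertices have a neighbourhood concentrated in a small set.
\<close>

lemma core_exists:
  obtains U where "nonexpanding \<subseteq> U" "A \<union> B - U \<noteq> {}" "\<And>w. w \<in> A \<union> B - U \<Longrightarrow> 7 * k \<le> card (nb w - U)"
proof -
  define Base where "Base = nonexpanding \<union> {w\<in>A \<union> B. card (nb w) < 8 * k}"
  have etaN: "\<eta> * N \<le> N" using pos by (simp add: mult_left_le_one_le)
  have low: "card {w\<in>A. card (nb w) < 8 * k} < \<eta> * N" "card {w\<in>B. card (nb w) < 8 * k} < \<eta> * N"
  proof -
    have "{w\<in>A. card (nb w) < 8 * k} \<subseteq> {x\<in>A. card (nb x \<inter> B) < \<theta> * card B}"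
      using nb_A num_k cB by (auto simp: Int_absorb2)
    then have "card {w\<in>A. card (nb w) < 8 * k} \<le> card {x\<in>A. card (nb x \<inter> B) < \<theta> * card B}"
      using fin by (intro card_mono) auto
    then show "card {w\<in>A. card (nb w) < 8 * k} < \<eta> * N"
      using few_low_degree_A[of B] etaN cB by simp
    have "{w\<in>B. card (nb w) < 8 * k} \<subseteq> {x\<in>B. card (nb x \<inter> A) < \<theta> * card A}"
      using nb_B num_k cA by (auto simp: Int_absorb2)
    then have "card {w\<in>B. card (nb w) < 8 * k} \<le> card {x\<in>B. card (nb x \<inter> A) < \<theta> * card A}"
      using fin by (intro card_mono) auto
    then show "card {w\<in>B. card (nb w) < 8 * k} < \<eta> * N"
      using few_low_degree_B[of A] etaN cA by simp
  qed
  have base: "card (Base \<inter> A) < 2 * b + \<eta> * N" "card (Base \<inter> B) < 2 * b + \<eta> * N"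
  proof -
    have "Base \<inter> A = (nonexpanding \<inter> A) \<union> {w\<in>A. card (nb w) < 8 * k}" by (auto simp: Base_def)
    then have "card (Base \<inter> A) \<le> card (nonexpanding \<inter> A) + card {w\<in>A. card (nb w) < 8 * k}"
      by (simp add: card_Un_le)
    then show "card (Base \<inter> A) < 2 * b + \<eta> * N" using card_nonexpanding_A low by linarith
    have "Base \<inter> B = (nonexpanding \<inter> B) \<union> {w\<in>B. card (nb w) < 8 * k}" by (auto simp: Base_def)
    then have "card (Base \<inter> B) \<le> card (nonexpanding \<inter> B) + card {w\<in>B. card (nb w) < 8 * k}"
      by (simp add: card_Un_le)
    then show "card (Base \<inter> B) < 2 * b + \<eta> * N" using card_nonexpanding_B low by linarith
  qed
  define C where "C = {U. Base \<subseteq> U \<and> U \<subseteq> A \<union> B \<and> card (U \<inter> A) \<le> 4 * \<eta> * N \<and> card (U \<inter> B) \<le> 4 * \<eta> * N \<and>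
     (\<forall>w\<in>U - Base. k \<le> card (nb w \<inter> U))}"
  have "finite C" by (rule finite_subset[of _ "Pow (A \<union> B)"]) (use fin in \<open>auto simp: C_def\<close>)
  moreover have "Base \<in> C"
    using base num_b pos by (auto simp: C_def Base_def nonexpanding_def)
  ultimately obtain U where U: "U \<in> C" "\<And>U'. U' \<in> C \<Longrightarrow> U \<subseteq> U' \<Longrightarrow> U = U'"
    using finite_has_maximal[of C] by auto
  have U1: "Base \<subseteq> U" "U \<subseteq> A \<union> B" "card (U \<inter> A) \<le> 4 * \<eta> * N" "card (U \<inter> B) \<le> 4 * \<eta> * N"
    "\<And>w. w \<in> U - Base \<Longrightarrow> k \<le> card (nb w \<inter> U)" using U by (auto simp: C_def)
  \<comment> \<open>The bound improves itself: size at most \<open>4 * \<eta> * N\<close> allows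
    \<open>few_concentrated_A\<close>, which yields \<open>3 * b + \<eta> * N\<close>. The gap
    leaves room for one more vertex, so maximality of \<open>U\<close> can be exploited.\<close>
  have UA: "card (U \<inter> A) < 3 * b + \<eta> * N"
  proof -
    have "U \<inter> A \<subseteq> (Base \<inter> A) \<union> {w\<in>A. k \<le> card (nb w \<inter> U)}" using U1 by auto
    then have "card (U \<inter> A) \<le> card ((Base \<inter> A) \<union> {w\<in>A. k \<le> card (nb w \<inter> U)})"
      using fin by (intro card_mono) auto
    also have "\<dots> \<le> card (Base \<inter> A) + card {w\<in>A. k \<le> card (nb w \<inter> U)}" by (rule card_Un_le)
    finally show ?thesis using base few_concentrated_A[of U] U1 by linarith
  qed
  have UB: "card (U \<inter> B) < 3 * b + \<eta> * N"
  proof -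
    have "U \<inter> B \<subseteq> (Base \<inter> B) \<union> {w\<in>B. k \<le> card (nb w \<inter> U)}" using U1 by auto
    then have "card (U \<inter> B) \<le> card ((Base \<inter> B) \<union> {w\<in>B. k \<le> card (nb w \<inter> U)})"
      using fin by (intro card_mono) auto
    also have "\<dots> \<le> card (Base \<inter> B) + card {w\<in>B. k \<le> card (nb w \<inter> U)}" by (rule card_Un_le)
    finally show ?thesis using base few_concentrated_B[of U] U1 by linarith
  qed
  have "7 * k \<le> card (nb w - U)" if w: "w \<in> A \<union> B - U" for w
  proof (rule ccontr)
    assume n: "\<not> ?thesis"
    have "card (nb w) = card (nb w \<inter> U) + card (nb w - U)"
      by (subst card_Un_disjoint[symmetric]) (auto intro: arg_cong[where f=card])
    moreover have "8 * k \<le> card (nb w)" using w U1(1) by (auto simp: Base_def)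
    ultimately have kw: "k \<le> card (nb w \<inter> U)" using n by linarith
    have "k \<le> card (nb v \<inter> insert w U)" if "v \<in> insert w U - Base" for v
    proof -
      have "k \<le> card (nb v \<inter> U)" using that kw U1(5) by auto
      also have "card (nb v \<inter> U) \<le> card (nb v \<inter> insert w U)" by (intro card_mono) auto
      finally show ?thesis by simp
    qed
    moreover have "card (insert w U \<inter> A) \<le> 4 * \<eta> * N"
    proof -
      have "card (insert w U \<inter> A) \<le> card (insert w (U \<inter> A))" using fin by (intro card_mono) auto
      also have "\<dots> \<le> Suc (card (U \<inter> A))" using fin by (simp add: card_insert_if)
      finally show ?thesis using UA num_b b_pos by linarith
    qed
    moreover have "card (insert w U \<inter> B) \<le> 4 * \<eta> * N"
    proof -
      have "card (insert w U \<inter> B) \<le> card (insert w (U \<inter> B))" using fin by (intro card_mono) auto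
      also have "\<dots> \<le> Suc (card (U \<inter> B))" using fin by (simp add: card_insert_if)
      finally show ?thesis using UB num_b b_pos by linarith
    qed
    ultimately have "insert w U \<in> C" using U1 w by (auto simp: C_def)
    then show False using U(2)[of "insert w U"] w by auto
  qed
  moreover have "A \<union> B - U \<noteq> {}"
  proof
    assume "A \<union> B - U = {}"
    then have "U \<inter> A = A" by auto
    then have "N \<le> 4 * \<eta> * N" using U1 cA by simp
    then show False using pos by simp
  qed
  ultimately show ?thesis using that U1(1) by (auto simp: Base_def)
qed

section \<open>Rows of the grid\<close>

definition row :: "('a \<times> 'a) set \<Rightarrow> 'a set \<Rightarrow> 'a set \<Rightarrow> (nat \<Rightarrow> 'a) \<Rightarrow> bool" where
  "row bad U X f \<longleftrightarrow> (\<forall>i<s. f i \<in> A \<union> B - U - X) \<and> inj_on f {..<s} \<and>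
     (\<forall>i. Suc i < s \<longrightarrow> h (f i) (f (Suc i)) \<and> (f i, f (Suc i)) \<notin> bad) \<and> (\<forall>i<s. card (nb (f i) \<inter> X) < k)"

text \<open>A greedy path: at least \<open>7 * k\<close> neighbours outside \<open>U\<close> are
  available at each step, against fewer than \<open>b\<close> bad edges and at most \<open>s\<close>
  path vertices, both numbers being at most \<open>k / 4\<close>.\<close>

lemma first_row:
  assumes bad: "bad \<subseteq> {(x, y). h x y}" "\<And>x. card (bad `` {x}) < b"
    and U: "A \<union> B - U \<noteq> {}" "\<And>w. w \<in> A \<union> B - U \<Longrightarrow> 7 * k \<le> card (nb w - U)"
  shows "\<exists>f. row bad U {} f"
proof -
  have "\<exists>f. (\<forall>i\<le>m. f i \<in> A \<union> B - U) \<and> inj_on f {..m} \<and>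
     (\<forall>i<m. h (f i) (f (Suc i)) \<and> (f i, f (Suc i)) \<notin> bad)" if "m \<le> s" for m
    using that
  proof (induction m)
    case 0
    obtain w where "w \<in> A \<union> B - U" using U by auto
    then show ?case by (intro exI[of _ "\<lambda>_. w"]) auto
  next
    case (Suc m)
    then obtain f where f: "\<And>i. i \<le> m \<Longrightarrow> f i \<in> A \<union> B - U" "inj_on f {..m}"
      "\<And>i. i < m \<Longrightarrow> h (f i) (f (Suc i)) \<and> (f i, f (Suc i)) \<notin> bad" by auto
    let ?Z = "bad `` {f m} \<union> f ` {..m}"
    have "card ?Z \<le> card (bad `` {f m}) + card (f ` {..m})" by (rule card_Un_le)
    also have "\<dots> < b + Suc m" using bad(2)[of "f m"] card_image_le[of "{..m}" f] by simp
    finally have "real (card ?Z) < card (nb (f m) - U)"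
      using U(2)[OF f(1)[of m]] Suc.prems num_b num_s pos by linarith
    then have "\<not> (nb (f m) - U \<subseteq> ?Z)"
      using card_mono[of ?Z "nb (f m) - U"] fin_out[OF bad(1)] by auto
    then obtain y where y: "h (f m) y" "y \<notin> U" "(f m, y) \<notin> bad" "y \<notin> f ` {..m}" by auto
    have yAB: "y \<in> A \<union> B" using y h_sides by auto
    have "inj_on (f(Suc m := y)) {..Suc m}"
      using f(2) y(4) by (auto simp: inj_on_def atMost_Suc)
    then show ?case using f(1,3) y(1-3) yAB
    proof (intro exI[of _ "f(Suc m := y)"] conjI)
      show "inj_on (f(Suc m := y)) {..Suc m}" by fact
    qed (auto simp: le_Suc_eq less_Suc_eq)
  qed
  from this[of s] obtain f where f: "\<And>i. i \<le> s \<Longrightarrow> f i \<in> A \<union> B - U" "inj_on f {..s}"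
      "\<And>i. i < s \<Longrightarrow> h (f i) (f (Suc i)) \<and> (f i, f (Suc i)) \<notin> bad" by auto
  have "inj_on f {..<s}" using f(2) by (rule inj_on_subset) auto
  then show ?thesis using f pos by (intro exI[of _ f]) (auto simp: row_def)
qed

lemma next_row:
  assumes bad: "judge bad = bad" and U: "nonexpanding \<subseteq> U" "\<And>w. w \<in> A \<union> B - U \<Longrightarrow> 7 * k \<le> card (nb w - U)"
    and f: "row bad U X f" and X: "X \<subseteq> A \<union> B" "card X + s \<le> s * s" and s: "0 < s"
  shows "\<exists>f'. row bad U (X \<union> f ` {..<s}) f' \<and> (\<forall>i<s. h (f i) (f' i))"
proof -
  have f1: "\<And>i. i < s \<Longrightarrow> f i \<in> A \<union> B - U - X" "inj_on f {..<s}"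
    "\<And>i. Suc i < s \<Longrightarrow> h (f i) (f (Suc i)) \<and> (f i, f (Suc i)) \<notin> bad"
    "\<And>i. i < s \<Longrightarrow> card (nb (f i) \<inter> X) < k" using f by (auto simp: row_def)
  define X' where "X' = X \<union> f ` {..<s}"
  have finX: "finite X" using X fin finite_subset by blast
  have X'AB: "X' \<subseteq> A \<union> B" using X f1 by (auto simp: X'_def)
  have "card X' \<le> card X + card (f ` {..<s})" unfolding X'_def by (rule card_Un_le)
  also have "card (f ` {..<s}) \<le> s" using card_image_le[of "{..<s}" f] by simp
  finally have cX': "card X' \<le> s * s" using X by linarith
  have finX': "finite X'" using finX by (simp add: X'_def)
  have cX'': "card (X' \<inter> A) \<le> 4 * \<eta> * N" "card (X' \<inter> B) \<le> 4 * \<eta> * N"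
  proof -
    have "card (X' \<inter> A) \<le> s * s" "card (X' \<inter> B) \<le> s * s"
      using cX' card_mono[OF finX', of "X' \<inter> A"] card_mono[OF finX', of "X' \<inter> B"] by auto
    then show "card (X' \<inter> A) \<le> 4 * \<eta> * N" "card (X' \<inter> B) \<le> 4 * \<eta> * N" using num_s by linarith+
  qed
  \<comment> \<open>Avoiding \<open>Z\<close> gives the new row the last clause of
    \<open>row\<close>.\<close>
  define Z where "Z = {w\<in>A \<union> B. k \<le> card (nb w \<inter> X')}"
  have finZ: "finite Z" using fin by (simp add: Z_def)
  have "Z = {w\<in>A. k \<le> card (nb w \<inter> X')} \<union> {w\<in>B. k \<le> card (nb w \<inter> X')}" by (auto simp: Z_def)
  then have "card Z \<le> card {w\<in>A. k \<le> card (nb w \<inter> X')} + card {w\<in>B. k \<le> card (nb w \<inter> X')}"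
    using card_Un_le by simp
  then have cZ: "card Z < 2 * b"
    using few_concentrated_A[OF cX''(2)] few_concentrated_B[OF cX''(1)] by linarith
  \<comment> \<open>Without the overlaps, the candidate sets \<open>L i\<close> are pairwise
    disjoint for \<open>i < s\<close>, which makes the new row injective.\<close>
  define Ov where "Ov i = (\<Union>j\<in>{..<s} - {i}. nb (f i) \<inter> nb (f j))" for i
  define L where "L i = nb (f i) - U - X' - Z - Ov i" for i
  have finOv: "finite (Ov i)" for i by (auto simp: Ov_def)
  have cOv: "card (Ov i) \<le> k" if "i < s" for i
  proof -
    have "card (Ov i) \<le> (\<Sum>j\<in>{..<s} - {i}. card (nb (f i) \<inter> nb (f j)))"
      unfolding Ov_def by (intro card_UN_le) auto
    also have "real \<dots> \<le> (\<Sum>j\<in>{..<s} - {i}. cd)"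
      unfolding of_nat_sum
    proof (rule sum_mono)
      fix j assume j: "j \<in> {..<s} - {i}"
      then have "f i \<noteq> f j" using f1(2) that by (auto simp: inj_on_def)
      moreover have "nb (f i) \<inter> nb (f j) = {z. h (f i) z \<and> h (f j) z}" by auto
      ultimately show "real (card (nb (f i) \<inter> nb (f j))) \<le> cd" using codegree by auto
    qed
    also have "\<dots> = (s - 1) * cd" using that by simp
    also have "\<dots> \<le> k"
    proof (cases "cd \<ge> 0")
      case True
      then have "(s - 1) * cd \<le> s * cd" by (intro mult_right_mono) auto
      then show ?thesis using num_s by linarith
    next
      case False
      then have "(s - 1) * cd \<le> 0" by (simp add: mult_nonneg_nonpos)
      then show ?thesis using pos by linarith
    qed
    finally show ?thesis by simp
  qed
  have cL: "2 * k \<le> card (L i)" if i: "i < s" for i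
  proof -
    \<comment> \<open>Of \<open>7 * k\<close> neighbours, at most \<open>k\<close> are lost to
      earlier rows, \<open>k / 4\<close> to the current row, \<open>k / 2\<close> to
      \<open>Z\<close> and \<open>k\<close> to overlaps.\<close>
    have "nb (f i) - U \<subseteq> L i \<union> (nb (f i) \<inter> X) \<union> f ` {..<s} \<union> Z \<union> Ov i" by (auto simp: L_def X'_def)
    then have "card (nb (f i) - U) \<le> card (L i \<union> (nb (f i) \<inter> X) \<union> f ` {..<s} \<union> Z \<union> Ov i)"
      using finZ finOv by (intro card_mono) (auto simp: L_def)
    also have "\<dots> \<le> card (L i) + card (nb (f i) \<inter> X) + card (f ` {..<s}) + card Z + card (Ov i)"
      by (intro order_trans[OF card_Un_le] add_mono order_refl)
    finally have "card (nb (f i) - U) \<le> card (L i) + card (nb (f i) \<inter> X) + s + card Z + card (Ov i)"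
      using card_image_le[of "{..<s}" f] by simp
    moreover have "7 * k \<le> card (nb (f i) - U)" using U(2) f1(1)[OF i] by auto
    ultimately show ?thesis using f1(4)[OF i] cOv[OF i] cZ num_b num_s pos by linarith
  qed
  \<comment> \<open>\<open>reach i\<close> collects the ends of good paths with one vertex in each
    of \<open>L 0\<close>, ..., \<open>L i\<close>.\<close>
  define reach where "reach = rec_nat (L 0) (\<lambda>i R. {y\<in>L (Suc i). \<exists>x\<in>R. h x y \<and> (x, y) \<notin> bad})"
  have reach0: "reach 0 = L 0" and reachS: "reach (Suc i) = {y\<in>L (Suc i). \<exists>x\<in>reach i. h x y \<and> (x, y) \<notin> bad}" for i
    by (simp_all add: reach_def)
  have reachL: "reach i \<subseteq> L i" for i by (cases i) (auto simp: reach0 reachS)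
  have finL: "finite (L i)" for i by (simp add: L_def)
  have creach: "k \<le> card (reach i)" if "i < s" for i
    using that
  proof (induction i)
    case 0
    then show ?case using cL[of 0] pos by (simp add: reach0)
  next
    case (Suc i)
    let ?Y = "L (Suc i) - reach (Suc i)"
    \<comment> \<open>No good edge joins \<open>reach i\<close> to the unreached part of
      \<open>L (Suc i)\<close>. If both had \<open>k\<close> vertices they would witness that the
      row edge is in \<open>judge bad\<close>, which is \<open>bad\<close>. So of the
      \<open>2 * k\<close> candidates at least \<open>k\<close> are reached.\<close>
    have "\<not> k \<le> card ?Y"
    proof
      assume kY: "k \<le> card ?Y"
      have "(f i, f (Suc i)) \<in> judge bad"
        unfolding judge_def
      proof (clarify, intro conjI exI)
        show "h (f i) (f (Suc i))" using f1(3) Suc.prems by auto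
        show "f i \<notin> nonexpanding" using f1(1)[of i] Suc.prems U by auto
        show "reach i \<subseteq> nb (f i)" using reachL[of i] by (auto simp: L_def)
        show "?Y \<subseteq> nb (f (Suc i))" by (auto simp: L_def)
        show "k \<le> card (reach i)" using Suc by simp
        show "\<forall>x\<in>reach i. \<forall>y\<in>?Y. h x y \<longrightarrow> (x, y) \<in> bad" by (auto simp: reachS)
      qed (rule kY)
      then show False using bad f1(3)[OF Suc.prems] by simp
    qed
    moreover have "card (L (Suc i)) = card (reach (Suc i)) + card ?Y"
      using finL[of "Suc i"] reachL[of "Suc i"] finite_subset[OF reachL finL]
      by (subst card_Un_disjoint[symmetric]) (auto intro!: arg_cong[where f=card])
    ultimately show ?case using cL[OF Suc.prems] by linarith
  qed
  have path: "\<forall>y\<in>reach i. \<exists>f'. f' i = y \<and> (\<forall>j\<le>i. f' j \<in> L j) \<and>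
      (\<forall>j<i. h (f' j) (f' (Suc j)) \<and> (f' j, f' (Suc j)) \<notin> bad)" for i
  proof (induction i)
    case 0
    show ?case
    proof
      fix y assume "y \<in> reach 0"
      then show "\<exists>f'. f' 0 = y \<and> (\<forall>j\<le>0. f' j \<in> L j) \<and>
      (\<forall>j<0. h (f' j) (f' (Suc j)) \<and> (f' j, f' (Suc j)) \<notin> bad)"
        by (intro exI[of _ "\<lambda>_. y"]) (auto simp: reach0)
    qed
  next
    case (Suc i)
    show ?case
    proof
      fix y assume "y \<in> reach (Suc i)"
      then obtain x where x: "x \<in> reach i" "h x y" "(x, y) \<notin> bad" "y \<in> L (Suc i)" by (auto simp: reachS)
      then obtain f' where f': "f' i = x" "\<And>j. j \<le> i \<Longrightarrow> f' j \<in> L j"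
        "\<And>j. j < i \<Longrightarrow> h (f' j) (f' (Suc j)) \<and> (f' j, f' (Suc j)) \<notin> bad" using Suc.IH by blast
      show "\<exists>f'. f' (Suc i) = y \<and> (\<forall>j\<le>Suc i. f' j \<in> L j) \<and>
      (\<forall>j<Suc i. h (f' j) (f' (Suc j)) \<and> (f' j, f' (Suc j)) \<notin> bad)"
        using f' x by (intro exI[of _ "f'(Suc i := y)"]) (auto simp: le_Suc_eq less_Suc_eq)
    qed
  qed
  have "reach (s - 1) \<noteq> {}" using creach[of "s - 1"] s pos by auto
  then obtain f' where f'0: "\<And>j. j \<le> s - 1 \<Longrightarrow> f' j \<in> L j"
        "\<And>j. j < s - 1 \<Longrightarrow> h (f' j) (f' (Suc j)) \<and> (f' j, f' (Suc j)) \<notin> bad"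
    using path[of "s - 1"] by blast
  have f': "f' j \<in> L j" if "j < s" for j using f'0 that by simp
  have hf: "h (f i) (f' i)" if "i < s" for i using f'[OF that] by (auto simp: L_def)
  have "inj_on f' {..<s}"
  proof (rule inj_onI)
    fix i j assume ij: "i \<in> {..<s}" "j \<in> {..<s}" "f' i = f' j"
    show "i = j"
    proof (rule ccontr)
      assume "i \<noteq> j"
      then have "f' i \<in> Ov i" using ij hf[of i] hf[of j] by (auto simp: Ov_def)
      then show False using f'[of i] ij by (auto simp: L_def)
    qed
  qed
  moreover have "f' i \<in> A \<union> B - U - X'" "card (nb (f' i) \<inter> X') < k" if "i < s" for i
  proof -
    have "f' i \<in> A \<union> B" using hf[OF that] h_sides by auto
    then show "f' i \<in> A \<union> B - U - X'" "card (nb (f' i) \<inter> X') < k"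
      using f'[OF that] by (auto simp: L_def Z_def)
  qed
  ultimately have "row bad U X' f'" using f'0 by (auto simp: row_def)
  then show ?thesis using hf by (auto simp: X'_def)
qed

text \<open>The last conjunct later places the vertices in the vertex set of the host; for
  \<open>s = 1\<close> the adjacency conjuncts say nothing about the single vertex.\<close>

lemma grid_exists:
  assumes s: "0 < s"
  shows "\<exists>F. inj_on (\<lambda>(i, j). F i j) ({..<s} \<times> {..<s}) \<and>
    (\<forall>i j. Suc i < s \<and> j < s \<longrightarrow> h (F i j) (F (Suc i) j)) \<and>
    (\<forall>i j. i < s \<and> Suc j < s \<longrightarrow> h (F i j) (F i (Suc j))) \<and>
    (\<forall>i j. i < s \<and> j < s \<longrightarrow> (\<exists>y. h (F i j) y))"
proof -
  obtain bad where bad: "bad \<subseteq> {(x, y). h x y}" "\<And>x. card (bad `` {x}) < b" "judge bad = bad"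
    using judge_fixpoint by blast
  obtain U where U: "nonexpanding \<subseteq> U" "A \<union> B - U \<noteq> {}" "\<And>w. w \<in> A \<union> B - U \<Longrightarrow> 7 * k \<le> card (nb w - U)"
    using core_exists by blast
  define used :: "(nat \<Rightarrow> nat \<Rightarrow> 'a) \<Rightarrow> nat \<Rightarrow> 'a set" where "used F i = (\<Union>i'<i. F i' ` {..<s})" for F i
  have "\<exists>F. (\<forall>i\<le>m. row bad U (used F i) (F i)) \<and> (\<forall>i<m. \<forall>j<s. h (F i j) (F (Suc i) j))"
    if "m < s" for m
    using that
  proof (induction m)
    case 0
    obtain f where "row bad U {} f" using first_row[OF bad(1,2) U(2,3)] by blast
    then show ?case by (intro exI[of _ "\<lambda>_. f"]) (auto simp: used_def)
  next
    case (Suc m)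
    then obtain F where F: "\<And>i. i \<le> m \<Longrightarrow> row bad U (used F i) (F i)"
      "\<And>i j. i < m \<Longrightarrow> j < s \<Longrightarrow> h (F i j) (F (Suc i) j)" by auto
    have "card (used F m) \<le> (\<Sum>i'<m. card (F i' ` {..<s}))"
      unfolding used_def by (rule card_UN_le) auto
    also have "\<dots> \<le> (\<Sum>i'<m. s)" by (intro sum_mono order_trans[OF card_image_le]) auto
    finally have "card (used F m) + s \<le> Suc m * s" by simp
    also have "\<dots> \<le> s * s" using Suc.prems by (intro mult_le_mono1) simp
    finally have c: "card (used F m) + s \<le> s * s" .
    have "used F m \<subseteq> A \<union> B"
    proof
      fix x assume "x \<in> used F m"
      then obtain i j where "i < m" "j < s" "x = F i j" by (auto simp: used_def)
      then show "x \<in> A \<union> B" using F(1)[of i] by (auto simp: row_def)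
    qed
    from next_row[OF bad(3) U(1,3) F(1)[OF order_refl] this c s]
    obtain f' where f': "row bad U (used F m \<union> F m ` {..<s}) f'" "\<And>i. i < s \<Longrightarrow> h (F m i) (f' i)" by blast
    let ?F = "F(Suc m := f')"
    have "used ?F i = used F i" if "i \<le> Suc m" for i
      unfolding used_def using that by (intro SUP_cong) auto
    moreover have "used F (Suc m) = used F m \<union> F m ` {..<s}" by (simp add: used_def lessThan_Suc Un_commute)
    ultimately have "row bad U (used ?F i) (?F i)" if "i \<le> Suc m" for i
      using F(1)[of i] f'(1) that by (cases "i = Suc m") auto
    moreover have "h (?F i j) (?F (Suc i) j)" if "i < Suc m" "j < s" for i j
      using F(2)[of i j] f'(2)[of j] that by (cases "i = m") auto
    ultimately show ?case by blast
  qed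
  from this[of "s - 1"] s obtain F where F0: "\<forall>i\<le>s - 1. row bad U (used F i) (F i)"
      "\<forall>i<s - 1. \<forall>j<s. h (F i j) (F (Suc i) j)" by auto
  have F: "row bad U (used F i) (F i)" if "i < s" for i using F0(1) that by auto
  have F2: "h (F i j) (F (Suc i) j)" if "Suc i < s" "j < s" for i j
    using F0(2) that by (auto simp: less_diff_conv)
  have diff: "F i j \<noteq> F i' j'" if "i < i'" "i' < s" "j < s" "j' < s" for i i' j j'
  proof -
    have "F i j \<in> used F i'" using that by (auto simp: used_def)
    moreover have "F i' j' \<notin> used F i'" using F[of i'] that by (auto simp: row_def)
    ultimately show ?thesis by auto
  qed
  have "inj_on (\<lambda>(i, j). F i j) ({..<s} \<times> {..<s})"
  proof (rule inj_onI)
    fix u v assume uv: "u \<in> {..<s} \<times> {..<s}" "v \<in> {..<s} \<times> {..<s}" "(case u of (i, j) \<Rightarrow> F i j) = (case v of (i, j) \<Rightarrow> F i j)"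
    obtain i j i' j' where ij: "u = (i, j)" "v = (i', j')" by (cases u, cases v)
    then have *: "i \<in> {..<s}" "j \<in> {..<s}" "i' \<in> {..<s}" "j' \<in> {..<s}" "F i j = F i' j'" using uv by auto
    have "i = i'"
      using diff[of i i' j j'] diff[of i' i j' j] * by (cases i i' rule: linorder_cases) auto
    moreover have "inj_on (F i) {..<s}" using F[of i] * by (auto simp: row_def)
    ultimately show "u = v" using * ij by (auto simp: inj_on_def)
  qed
  moreover have "h (F i j) (F i (Suc j))" if "i < s" "Suc j < s" for i j
    using F[OF that(1)] that by (auto simp: row_def)
  moreover have "\<exists>y. h (F i j) y" if "i < s" "j < s" for i j
  proof -
    have "F i j \<in> A \<union> B - U" using F[OF that(1)] that by (auto simp: row_def)
    then have "7 * k \<le> card (nb (F i j) - U)" by (rule U(3))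
    then have "card (nb (F i j) - U) \<noteq> 0" using pos by linarith
    then have "nb (F i j) - U \<noteq> {}" by (metis card.empty)
    then show ?thesis by auto
  qed
  ultimately show ?thesis using F2 by (intro exI[of _ F]) auto
qed

end

section \<open>A regular pair by density increment\<close>

lemma ecount_mono: "finite X' \<Longrightarrow> finite Y' \<Longrightarrow> X \<subseteq> X' \<Longrightarrow> Y \<subseteq> Y' \<Longrightarrow> ecount h X Y \<le> ecount h X' Y'"
  unfolding ecount_def by (intro order_trans[OF sum_mono sum_mono2] card_mono) auto

lemma ecount_union_right:
  assumes "finite X" "finite Y" "finite Y'" "Y \<inter> Y' = {}"
  shows "ecount h X (Y \<union> Y') = ecount h X Y + ecount h X Y'"
  using assms by (simp add: ecount_swap sum.union_disjoint)

text \<open>Greedy cut: each new vertex goes opposite to the majority of its earlier neighbours, so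
  half of the edges are cut. The other factor 2 comes from \<open>ecount h V V\<close> counting each
  edge twice.\<close>

lemma large_cut:
  fixes h :: "'a \<Rightarrow> 'a \<Rightarrow> bool"
  assumes "finite V" "\<And>x y. h x y \<Longrightarrow> h y x" "\<And>x. \<not> h x x"
  shows "\<exists>A\<subseteq>V. ecount h V V \<le> 4 * ecount h A (V - A)"
  using assms(1)
proof (induction V)
  case empty
  then show ?case by (auto simp: ecount_def)
next
  case (insert x F)
  then obtain A where A: "A \<subseteq> F" "ecount h F F \<le> 4 * ecount h A (F - A)" by auto
  have finA: "finite A" using A insert finite_subset by auto
  have d: "ecount h {x} Y = card {y\<in>Y. h x y}" for Y by (simp add: ecount_def)
  have sw: "ecount h Y {x} = ecount h {x} Y" if "finite Y" for Y
    using ecount_sym[of Y "{x}" h] assms that by simp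
  have xx: "ecount h {x} {x} = 0" using assms by (simp add: ecount_def)
  have "ecount h (insert x F) (insert x F) = ecount h ({x} \<union> F) ({x} \<union> F)" by simp
  also have "\<dots> = ecount h F F + 2 * ecount h {x} F"
    using insert xx sw[of F] by (subst ecount_union_left, auto simp: ecount_union_right simp del: Un_insert_left)
  finally have tot: "ecount h (insert x F) (insert x F) = ecount h F F + 2 * ecount h {x} F" .
  have "ecount h {x} F = ecount h {x} (A \<union> (F - A))" using A by (simp add: Un_absorb1)
  also have "\<dots> = ecount h {x} A + ecount h {x} (F - A)"
    using insert finA by (intro ecount_union_right) auto
  finally have sp: "ecount h {x} F = ecount h {x} A + ecount h {x} (F - A)" .
  show ?case
  proof (cases "ecount h {x} A \<le> ecount h {x} (F - A)")
    case True
    have "ecount h (insert x A) (insert x F - insert x A) = ecount h ({x} \<union> A) (F - A)"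
      using insert by (intro arg_cong2[where f="ecount h"]) auto
    also have "\<dots> = ecount h {x} (F - A) + ecount h A (F - A)"
      using insert finA A by (intro ecount_union_left) auto
    finally show ?thesis using A tot sp True by (intro exI[of _ "insert x A"]) auto
  next
    case False
    have "ecount h A (insert x F - A) = ecount h A ({x} \<union> (F - A))"
      using insert A by (intro arg_cong2[where f="ecount h"]) auto
    also have "\<dots> = ecount h A {x} + ecount h A (F - A)"
      using insert finA by (intro ecount_union_right) auto
    finally show ?thesis using A tot sp False sw[OF finA] by (intro exI[of _ A]) auto
  qed
qed

text \<open>Removing elements that are not above the average one at a time never lowers the
  average.\<close>

lemma exists_subset_sum_ge:
  fixes f :: "'a \<Rightarrow> real"
  assumes "finite S" "m \<le> card S"
  shows "\<exists>T\<subseteq>S. card T = m \<and> m * sum f S \<le> card S * sum f T"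
  using assms
proof (induction "card S - m" arbitrary: S)
  case 0
  then show ?case by (intro exI[of _ S]) auto
next
  case (Suc d)
  then have ne: "S \<noteq> {}" and c: "card S > 0" by auto
  have "\<exists>v\<in>S. f v \<le> sum f S / card S"
    using Suc ne c by (intro exists_le_average) auto
  then obtain v where v: "v \<in> S" "f v \<le> sum f S / card S" by auto
  have cS: "card (S - {v}) = card S - 1" using v Suc.prems by simp
  obtain T where T: "T \<subseteq> S - {v}" "card T = m" "m * sum f (S - {v}) \<le> card (S - {v}) * sum f T"
  proof -
    have "d = card (S - {v}) - m" "m \<le> card (S - {v})" using Suc.hyps(2) cS by auto
    from Suc.hyps(1)[OF this(1) _ this(2)] show ?thesis using that Suc.prems(1) by blast
  qed
  have s: "sum f (S - {v}) = sum f S - f v" using v Suc.prems by (simp add: sum_diff1)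
  have vv: "card S * f v \<le> sum f S" using v c by (simp add: field_simps)
  have "m * sum f S \<le> card S * sum f T"
  \<comment> \<open>The general case cancels the factor \<open>card S - 1\<close>.\<close>
  proof (cases "card S = 1")
    case True
    then have "m = 0" using Suc by simp
    then show ?thesis using T Suc.prems finite_subset by (metis card_eq_0_iff finite_Diff mult_zero_left mult_zero_right of_nat_0 order_refl sum.empty)
  next
    case False
    then have c1: "real (card S) - 1 > 0" using c by linarith
    have "(real (card S) - 1) * sum f S \<le> card S * sum f (S - {v})" using vv by (simp add: s algebra_simps)
    then have "m * ((real (card S) - 1) * sum f S) \<le> m * (card S * sum f (S - {v}))"
      by (rule mult_left_mono) simp
    also have "\<dots> = card S * (m * sum f (S - {v}))" by simp
    also have "\<dots> \<le> card S * ((real (card S) - 1) * sum f T)"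
    proof (rule mult_left_mono)
      have "real (card (S - {v})) = real (card S) - 1" using cS c by (simp add: of_nat_diff)
      then show "m * sum f (S - {v}) \<le> (real (card S) - 1) * sum f T" using T(3) by simp
    qed simp
    finally have "(real (card S) - 1) * (m * sum f S) \<le> (real (card S) - 1) * (card S * sum f T)"
      by (simp add: mult_ac)
    then show ?thesis using c1 by (simp only: mult_le_cancel_left_pos)
  qed
  then show ?case using T by blast
qed

lemma exists_subset_ecount_ge:
  assumes "finite X" "m \<le> card X"
  shows "\<exists>X'\<subseteq>X. card X' = m \<and> m * ecount h X Y \<le> card X * ecount h X' Y"
  using exists_subset_sum_ge[OF assms, of "\<lambda>x. real (card {y\<in>Y. h x y})"]
  unfolding ecount_def of_nat_sum[symmetric] of_nat_mult[symmetric] of_nat_le_iff .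

lemma exists_subset_ecount_le:
  assumes "finite X" "m \<le> card X"
  shows "\<exists>X'\<subseteq>X. card X' = m \<and> card X * ecount h X' Y \<le> m * ecount h X Y"
proof -
  obtain X' where X': "X' \<subseteq> X" "card X' = m"
    "m * sum (\<lambda>x. - real (card {y\<in>Y. h x y})) X \<le> card X * sum (\<lambda>x. - real (card {y\<in>Y. h x y})) X'"
    using exists_subset_sum_ge[OF assms, of "\<lambda>x. - real (card {y\<in>Y. h x y})"] by blast
  from X'(3) have "real (card X * ecount h X' Y) \<le> real (m * ecount h X Y)"
    by (simp add: sum_negf ecount_def)
  then show ?thesis using X' by (auto simp only: of_nat_le_iff)
qed

text \<open>Each side of a large cut is shrunk by averaging, which keeps its share of the edges.
  Choosing \<open>A0\<close> as a side with \<open>2 * m\<close> vertices leaves enough spare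
  vertices to pad the other side if it is too small.\<close>

lemma balanced_cut:
  fixes h :: "'a \<Rightarrow> 'a \<Rightarrow> bool"
  assumes "finite V" and h: "\<And>x y. h x y \<Longrightarrow> h y x" "\<And>x. \<not> h x x" and m: "4 * m \<le> card V"
  shows "\<exists>A B. A \<subseteq> V \<and> B \<subseteq> V \<and> A \<inter> B = {} \<and> card A = m \<and> card B = m \<and>
    m * m * ecount h V V \<le> 4 * card V * card V * ecount h A B"
proof -
  obtain A1 where A1: "A1 \<subseteq> V" "ecount h V V \<le> 4 * ecount h A1 (V - A1)"
    using large_cut[of V h] assms(1) h by blast
  have "\<exists>A0 B0. A0 \<subseteq> V \<and> B0 \<subseteq> V \<and> A0 \<inter> B0 = {} \<and> 2 * m \<le> card A0 \<and> ecount h V V \<le> 4 * ecount h A0 B0"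
  proof (cases "2 * m \<le> card A1")
    case True
    then show ?thesis using A1 by (intro exI[of _ A1] exI[of _ "V - A1"]) auto
  next
    case False
    have "card (V - A1) = card V - card A1" using A1 assms(1) finite_subset by (metis card_Diff_subset)
    moreover have "ecount h A1 (V - A1) = ecount h (V - A1) A1"
      using h(1) assms(1) A1 finite_subset by (intro ecount_sym) auto
    ultimately show ?thesis using A1 False m by (intro exI[of _ "V - A1"] exI[of _ A1]) auto
  qed
  then obtain A0 B0 where AB: "A0 \<subseteq> V" "B0 \<subseteq> V" "A0 \<inter> B0 = {}" "2 * m \<le> card A0" "ecount h V V \<le> 4 * ecount h A0 B0"
    by blast
  have fin: "finite A0" "finite B0" using AB(1,2) assms(1) finite_subset by blast+
  obtain A where A: "A \<subseteq> A0" "card A = m" "m * ecount h A0 B0 \<le> card A0 * ecount h A B0"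
    using exists_subset_ecount_ge[of A0 m h B0] fin AB(4) by auto
  have finA: "finite A" using A fin finite_subset by auto
  have "\<exists>B\<subseteq>V. A \<inter> B = {} \<and> card B = m \<and> m * ecount h A B0 \<le> card V * ecount h A B"
  proof (cases "m \<le> card B0")
    case True
    then obtain B where B: "B \<subseteq> B0" "card B = m" "m * ecount h B0 A \<le> card B0 * ecount h B A"
      using exists_subset_ecount_ge[of B0 m h A] fin by auto
    have finB: "finite B" using B fin finite_subset by auto
    have "m * ecount h A B0 \<le> card B0 * ecount h A B"
      using B(3) ecount_sym[OF finA fin(2) h(1)] ecount_sym[OF finA finB h(1)] by simp
    also have "\<dots> \<le> card V * ecount h A B" using AB assms(1) by (intro mult_le_mono1 card_mono) auto
    finally show ?thesis using A B AB by (intro exI[of _ B]) auto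
  next
    case False
    have "m \<le> card (A0 - A)" using A AB finA by (simp add: card_Diff_subset)
    then have "m - card B0 \<le> card (A0 - A)" by simp
    then obtain B1 where B1: "B1 \<subseteq> A0 - A" "card B1 = m - card B0" by (meson obtain_subset_with_card_n)
    have finB1: "finite B1" using B1 fin finite_subset by (metis finite_Diff)
    have "card (B0 \<union> B1) = card B0 + card B1" using fin finB1 B1 AB by (intro card_Un_disjoint) auto
    moreover have "m * ecount h A B0 \<le> card V * ecount h A (B0 \<union> B1)"
      using m fin finA finB1 by (intro mult_le_mono ecount_mono) auto
    ultimately show ?thesis using A B1 AB False by (intro exI[of _ "B0 \<union> B1"]) auto
  qed
  then obtain B where B: "B \<subseteq> V" "A \<inter> B = {}" "card B = m" "m * ecount h A B0 \<le> card V * ecount h A B" by blast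
  have "m * m * ecount h V V \<le> m * m * (4 * ecount h A0 B0)" using AB by (intro mult_le_mono) auto
  also have "\<dots> = 4 * m * (m * ecount h A0 B0)" by simp
  also have "\<dots> \<le> 4 * m * (card V * ecount h A B0)"
    using order_trans[OF A(3) mult_le_mono1[OF card_mono[OF assms(1) AB(1)]]] by (rule mult_le_mono2)
  also have "\<dots> = 4 * card V * (m * ecount h A B0)" by simp
  also have "\<dots> \<le> 4 * card V * (card V * ecount h A B)" using B(4) by (rule mult_le_mono2)
  finally show ?thesis using A B AB by (intro exI[of _ A] exI[of _ B]) (auto simp: mult_ac)
qed

text \<open>Levels are numbered from below: sets have size \<open>u * k ^ j\<close>, and the descent
  starts at \<open>j = J\<close>. If every level had a subpair denser by the factor
  \<open>1 + \<xi>\<close>, the pair at level 0 would exceed the cap \<open>c\<close>.\<close>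

lemma density_increment:
  fixes a c \<xi> :: real
  assumes "A0 \<inter> B0 = {}" "card A0 = u * k ^ J" "card B0 = u * k ^ J" "a * (real (u * k ^ J))\<^sup>2 \<le> ecount h A0 B0"
    and upper: "\<And>X Y. X \<subseteq> A0 \<Longrightarrow> Y \<subseteq> B0 \<Longrightarrow> card X = u \<Longrightarrow> card Y = u \<Longrightarrow> ecount h X Y \<le> c * (real u)\<^sup>2"
    and "c < (1 + \<xi>) ^ J * a" "0 < u" "0 < a" "0 \<le> \<xi>"
  shows "\<exists>j<J. \<exists>A B. \<exists>D::real. A \<subseteq> A0 \<and> B \<subseteq> B0 \<and> card A = u * k ^ Suc j \<and> card B = u * k ^ Suc j \<and> a \<le> D \<and>
    D * (real (u * k ^ Suc j))\<^sup>2 \<le> ecount h A B \<and>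
    (\<forall>X Y. X \<subseteq> A \<longrightarrow> Y \<subseteq> B \<longrightarrow> card X = u * k ^ j \<longrightarrow> card Y = u * k ^ j \<longrightarrow>
      ecount h X Y \<le> (1 + \<xi>) * D * (real (u * k ^ j))\<^sup>2)"
proof (rule ccontr)
  assume neg: "\<not> ?thesis"
  have "\<exists>A B. A \<subseteq> A0 \<and> B \<subseteq> B0 \<and> card A = u * k ^ (J - i) \<and> card B = u * k ^ (J - i) \<and>
    (1 + \<xi>) ^ i * a * (real (u * k ^ (J - i)))\<^sup>2 \<le> ecount h A B" if "i \<le> J" for i
    using that
  proof (induction i)
    case 0
    then show ?case using assms by (intro exI[of _ A0] exI[of _ B0]) auto
  next
    case (Suc i)
    define j where "j = J - Suc i"
    have j: "J - i = Suc j" "j < J" using Suc.prems by (auto simp: j_def)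
    from Suc obtain A B where AB: "A \<subseteq> A0" "B \<subseteq> B0" "card A = u * k ^ Suc j" "card B = u * k ^ Suc j"
      "(1 + \<xi>) ^ i * a * (real (u * k ^ Suc j))\<^sup>2 \<le> ecount h A B" unfolding j(1)[symmetric] by auto
    have "1 * a \<le> (1 + \<xi>) ^ i * a" using assms by (intro mult_right_mono) auto
    have "\<not> (\<forall>X Y. X \<subseteq> A \<longrightarrow> Y \<subseteq> B \<longrightarrow> card X = u * k ^ j \<longrightarrow> card Y = u * k ^ j \<longrightarrow>
      ecount h X Y \<le> (1 + \<xi>) * ((1 + \<xi>) ^ i * a) * (real (u * k ^ j))\<^sup>2)"
    proof (rule notI)
      assume all: "\<forall>X Y. X \<subseteq> A \<longrightarrow> Y \<subseteq> B \<longrightarrow> card X = u * k ^ j \<longrightarrow> card Y = u * k ^ j \<longrightarrow>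
        ecount h X Y \<le> (1 + \<xi>) * ((1 + \<xi>) ^ i * a) * (real (u * k ^ j))\<^sup>2"
      have "a \<le> (1 + \<xi>) ^ i * a" using \<open>1 * a \<le> _\<close> by simp
      with AB all have "\<exists>A B. \<exists>D::real. A \<subseteq> A0 \<and> B \<subseteq> B0 \<and> card A = u * k ^ Suc j \<and> card B = u * k ^ Suc j \<and> a \<le> D \<and>
        D * (real (u * k ^ Suc j))\<^sup>2 \<le> ecount h A B \<and>
        (\<forall>X Y. X \<subseteq> A \<longrightarrow> Y \<subseteq> B \<longrightarrow> card X = u * k ^ j \<longrightarrow> card Y = u * k ^ j \<longrightarrow>
          ecount h X Y \<le> (1 + \<xi>) * D * (real (u * k ^ j))\<^sup>2)"
        by (rule_tac exI[of _ A], rule_tac exI[of _ B], rule_tac exI[of _ "(1 + \<xi>) ^ i * a"]) (intro conjI)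
      with j(2) show False by (rule notE[OF neg, OF exI[of _ j], OF conjI])
    qed
    then obtain X Y where XY: "X \<subseteq> A" "Y \<subseteq> B" "card X = u * k ^ j" "card Y = u * k ^ j"
      "(1 + \<xi>) * ((1 + \<xi>) ^ i * a) * (real (u * k ^ j))\<^sup>2 < ecount h X Y" unfolding not_le[symmetric] by blast
    moreover have "(1 + \<xi>) ^ Suc i * a = (1 + \<xi>) * ((1 + \<xi>) ^ i * a)" by simp
    ultimately have "(1 + \<xi>) ^ Suc i * a * (real (u * k ^ j))\<^sup>2 \<le> ecount h X Y" by simp
    with order_trans[OF XY(1) AB(1)] order_trans[OF XY(2) AB(2)] XY(3,4)
    have "X \<subseteq> A0 \<and> Y \<subseteq> B0 \<and> card X = u * k ^ j \<and> card Y = u * k ^ j \<and>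
        (1 + \<xi>) ^ Suc i * a * (real (u * k ^ j))\<^sup>2 \<le> ecount h X Y" by (intro conjI)
    then show ?case unfolding j_def[symmetric] by (rule_tac exI[of _ X], rule_tac exI[of _ Y])
  qed
  from this[of J] obtain X Y where XY: "X \<subseteq> A0" "Y \<subseteq> B0" "card X = u" "card Y = u"
    "(1 + \<xi>) ^ J * a * (real u)\<^sup>2 \<le> ecount h X Y" by auto
  have "c * (real u)\<^sup>2 < (1 + \<xi>) ^ J * a * (real u)\<^sup>2" using assms by (intro mult_strict_right_mono) auto
  then show False using upper[of X Y] XY by linarith
qed

text \<open>An upper bound on all pairs of size \<open>m\<close> passes by averaging to all larger
  pairs. Subtracting the part of \<open>A \<times> B\<close> outside an \<open>m\<close> by
  \<open>m\<close> pair from the total then leaves it \<open>D * m\<^sup>2\<close> times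
  \<open>k\<^sup>2 - (1 + \<xi>) * (k\<^sup>2 - 1) = 1 / 2 + \<xi>\<close>; this explains the value
  of \<open>\<xi>\<close>.\<close>

lemma lower_regular:
  fixes D :: real and k m :: nat and h :: "'a \<Rightarrow> 'a \<Rightarrow> bool"
  assumes fin: "finite A" "finite B" and h: "\<And>x y. h x y \<Longrightarrow> h y x"
    and c: "card A = k * m" "card B = k * m" "2 \<le> k" "0 < m" "0 \<le> D"
    and D: "D * (real (k * m))\<^sup>2 \<le> ecount h A B"
    and upper: "\<And>X Y. X \<subseteq> A \<Longrightarrow> Y \<subseteq> B \<Longrightarrow> card X = m \<Longrightarrow> card Y = m \<Longrightarrow>
      ecount h X Y \<le> (1 + 1 / (2 * (real k)\<^sup>2)) * D * (real m)\<^sup>2"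
    and XY: "X \<subseteq> A" "Y \<subseteq> B" "m \<le> card X" "m \<le> card Y"
  shows "D / 2 * card X * card Y \<le> ecount h X Y"
proof -
  define \<xi> where "\<xi> = 1 / (2 * (real k)\<^sup>2)"
  have m0: "(real m)\<^sup>2 > 0" using c by simp
  have up: "ecount h X Y \<le> (1 + \<xi>) * D * card X * card Y"
    if XY: "X \<subseteq> A" "Y \<subseteq> B" "m \<le> card X" "m \<le> card Y" for X Y
  proof -
    have f: "finite X" "finite Y" using XY fin finite_subset by auto
    obtain X' where X': "X' \<subseteq> X" "card X' = m" "m * ecount h X Y \<le> card X * ecount h X' Y"
      using exists_subset_ecount_ge[of X m h Y] f XY by auto
    obtain Y' where Y': "Y' \<subseteq> Y" "card Y' = m" "m * ecount h Y X' \<le> card Y * ecount h Y' X'"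
      using exists_subset_ecount_ge[of Y m h X'] f XY by auto
    have f': "finite X'" "finite Y'" using X' Y' f finite_subset by auto
    have e: "ecount h Y X' = ecount h X' Y" "ecount h Y' X' = ecount h X' Y'"
      using f f' h by (auto intro!: ecount_sym)
    have "m * (m * ecount h X Y) \<le> m * (card X * ecount h X' Y)" using X'(3) by simp
    also have "\<dots> = card X * (m * ecount h X' Y)" by simp
    also have "\<dots> \<le> card X * (card Y * ecount h X' Y')" using Y'(3) e by simp
    finally have "real (m * (m * ecount h X Y)) \<le> real (card X * (card Y * ecount h X' Y'))"
      by (simp only: of_nat_le_iff)
    also have "\<dots> = card X * (card Y * real (ecount h X' Y'))" by simp
    also have "\<dots> \<le> card X * (card Y * ((1 + \<xi>) * D * (real m)\<^sup>2))"
      using upper[of X' Y'] X' Y' XY unfolding \<xi>_def by (intro mult_left_mono) auto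
    finally have "(real m)\<^sup>2 * ecount h X Y \<le> (real m)\<^sup>2 * ((1 + \<xi>) * D * card X * card Y)"
      by (simp add: power2_eq_square mult_ac)
    then show ?thesis using m0 by (simp only: mult_le_cancel_left_pos)
  qed
  have low: "D / 2 * (real m)\<^sup>2 \<le> ecount h X Y" if XY: "X \<subseteq> A" "Y \<subseteq> B" "card X = m" "card Y = m" for X Y
  proof -
    have f: "finite X" "finite Y" using XY fin finite_subset by auto
    have km: "m \<le> k * m - m" using c by (cases k) (auto simp: numeral_2_eq_2)
    have cX: "card (A - X) = k * m - m" and cY: "card (B - Y) = k * m - m"
      using XY c f by (auto simp: card_Diff_subset)
    have k1: "real (k * m - m) = (real k - 1) * m" using c by (simp add: of_nat_diff algebra_simps)
    have "ecount h A B = ecount h (X \<union> (A - X)) B" using XY by (simp add: Un_absorb1)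
    also have "\<dots> = ecount h X B + ecount h (A - X) B" using f fin by (intro ecount_union_left) auto
    also have "ecount h X B = ecount h X (Y \<union> (B - Y))" using XY by (simp add: Un_absorb1)
    also have "\<dots> = ecount h X Y + ecount h X (B - Y)" using f fin by (intro ecount_union_right) auto
    finally have e: "real (ecount h A B) = real (ecount h X Y) + real (ecount h X (B - Y)) + real (ecount h (A - X) B)" by simp
    have 1: "ecount h X (B - Y) \<le> (1 + \<xi>) * D * m * ((real k - 1) * m)"
      using up[of X "B - Y"] XY cY km k1 by auto
    have 2: "ecount h (A - X) B \<le> (1 + \<xi>) * D * ((real k - 1) * m) * (k * m)"
      using up[of "A - X" B] cX km k1 c by auto
    have "D * (real (k * m))\<^sup>2 - (1 + \<xi>) * D * m * ((real k - 1) * m) - (1 + \<xi>) * D * ((real k - 1) * m) * (k * m) \<le> ecount h X Y"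
      using D e 1 2 by linarith
    also have "D * (real (k * m))\<^sup>2 - (1 + \<xi>) * D * m * ((real k - 1) * m) - (1 + \<xi>) * D * ((real k - 1) * m) * (k * m)
      = D * (real m)\<^sup>2 * ((real k)\<^sup>2 - (1 + \<xi>) * ((real k)\<^sup>2 - 1))"
      by (simp add: power2_eq_square algebra_simps)
    also have "(real k)\<^sup>2 - (1 + \<xi>) * ((real k)\<^sup>2 - 1) = 1 / 2 + \<xi>"
      using c by (simp add: \<xi>_def field_simps)
    finally have "D * (real m)\<^sup>2 * (1 / 2 + \<xi>) \<le> ecount h X Y" .
    moreover have "D * (real m)\<^sup>2 * (1 / 2) \<le> D * (real m)\<^sup>2 * (1 / 2 + \<xi>)"
      using c by (intro mult_left_mono) (auto simp: \<xi>_def)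
    ultimately show ?thesis by simp
  qed
  \<comment> \<open>Sparsest \<open>m\<close>-subsets, obtained by averaging, carry the lower bound
    over to all larger pairs.\<close>
  have f: "finite X" "finite Y" using XY fin finite_subset by auto
  obtain X' where X': "X' \<subseteq> X" "card X' = m" "card X * ecount h X' Y \<le> m * ecount h X Y"
    using exists_subset_ecount_le[of X m h Y] f XY by auto
  obtain Y' where Y': "Y' \<subseteq> Y" "card Y' = m" "card Y * ecount h Y' X' \<le> m * ecount h Y X'"
    using exists_subset_ecount_le[of Y m h X'] f XY by auto
  have f': "finite X'" "finite Y'" using X' Y' f finite_subset by auto
  have e: "ecount h Y X' = ecount h X' Y" "ecount h Y' X' = ecount h X' Y'"
    using f f' h by (auto intro!: ecount_sym)
  have "(real m)\<^sup>2 * (D / 2 * card X * card Y) = card X * (card Y * (D / 2 * (real m)\<^sup>2))" by simp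
  also have "\<dots> \<le> card X * (card Y * real (ecount h X' Y'))"
    using low[of X' Y'] X' Y' XY by (intro mult_left_mono) auto
  also have "\<dots> = real (card X * (card Y * ecount h X' Y'))" by simp
  also have "\<dots> \<le> real (m * (m * ecount h X Y))"
  proof -
    have "card X * (card Y * ecount h X' Y') \<le> card X * (m * ecount h X' Y)" using Y'(3) e by simp
    also have "\<dots> = m * (card X * ecount h X' Y)" by simp
    also have "\<dots> \<le> m * (m * ecount h X Y)" using X'(3) by simp
    finally show ?thesis by (simp only: of_nat_le_iff)
  qed
  finally have "(real m)\<^sup>2 * (D / 2 * card X * card Y) \<le> (real m)\<^sup>2 * ecount h X Y"
    by (simp add: power2_eq_square)
  then show ?thesis using m0 by (simp only: mult_le_cancel_left_pos)
qed

text \<open>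
  The density cannot grow by the factor \<open>1 + 1 / (2 * k\<^sup>2)\<close> in each of \<open>J\<close> successive passages to subsets
  smaller by the factor \<open>k\<close>. A pair where it stops growing is lower-regular.
\<close>

lemma regular_pair:
  fixes \<epsilon> c :: real and k u J :: nat and h :: "'a \<Rightarrow> 'a \<Rightarrow> bool"
  assumes V: "finite V" "4 * (u * k ^ J) \<le> card V" and h: "\<And>x y. h x y \<Longrightarrow> h y x" "\<And>x. \<not> h x x"
    and e: "\<epsilon> * (real (card V))\<^sup>2 \<le> ecount h V V"
    and upper: "\<And>X Y. X \<subseteq> V \<Longrightarrow> Y \<subseteq> V \<Longrightarrow> X \<inter> Y = {} \<Longrightarrow> card X = u \<Longrightarrow> card Y = u \<Longrightarrow> ecount h X Y \<le> c * (real u)\<^sup>2"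
    and c: "4 * c < (1 + 1 / (2 * (real k)\<^sup>2)) ^ J * \<epsilon>" and pos: "0 < u" "0 < \<epsilon>" "2 \<le> k"
  shows "\<exists>N A B. u \<le> N \<and> A \<subseteq> V \<and> B \<subseteq> V \<and> A \<inter> B = {} \<and> card A = N \<and> card B = N \<and>
    (\<forall>X Y. X \<subseteq> A \<longrightarrow> Y \<subseteq> B \<longrightarrow> N / k \<le> card X \<longrightarrow> N / k \<le> card Y \<longrightarrow>
      \<epsilon> / 8 * card X * card Y \<le> ecount h X Y)"
proof -
  define m where "m = u * k ^ J"
  obtain A0 B0 where AB0: "A0 \<subseteq> V" "B0 \<subseteq> V" "A0 \<inter> B0 = {}" "card A0 = m" "card B0 = m"
    "m * m * ecount h V V \<le> 4 * card V * card V * ecount h A0 B0"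
    using balanced_cut[of V h m] V h unfolding m_def by blast
  have m0: "0 < m" using pos by (simp add: m_def)
  have cV: "real (card V) > 0" using V(2) m0 unfolding m_def[symmetric] by linarith
  have "(real (card V))\<^sup>2 * (\<epsilon> / 4 * (real m)\<^sup>2) = (real m)\<^sup>2 * (\<epsilon> * (real (card V))\<^sup>2) / 4" by simp
  also have "\<dots> \<le> (real m)\<^sup>2 * ecount h V V / 4" using e by (intro divide_right_mono mult_left_mono) auto
  also have "\<dots> = real (m * m * ecount h V V) / 4" by (simp add: power2_eq_square)
  also have "\<dots> \<le> real (4 * card V * card V * ecount h A0 B0) / 4"
    using AB0(6) by (intro divide_right_mono) (simp_all only: of_nat_le_iff zero_le_numeral)
  also have "\<dots> = (real (card V))\<^sup>2 * ecount h A0 B0" by (simp add: power2_eq_square)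
  finally have dens: "\<epsilon> / 4 * (real m)\<^sup>2 \<le> ecount h A0 B0" using cV by (simp only: mult_le_cancel_left_pos zero_less_power)
  have "\<exists>j<J. \<exists>A B. \<exists>D::real. A \<subseteq> A0 \<and> B \<subseteq> B0 \<and> card A = u * k ^ Suc j \<and> card B = u * k ^ Suc j \<and> \<epsilon> / 4 \<le> D \<and>
    D * (real (u * k ^ Suc j))\<^sup>2 \<le> ecount h A B \<and>
    (\<forall>X Y. X \<subseteq> A \<longrightarrow> Y \<subseteq> B \<longrightarrow> card X = u * k ^ j \<longrightarrow> card Y = u * k ^ j \<longrightarrow>
      ecount h X Y \<le> (1 + 1 / (2 * (real k)\<^sup>2)) * D * (real (u * k ^ j))\<^sup>2)"
  proof (rule density_increment)
    show "ecount h X Y \<le> c * (real u)\<^sup>2" if "X \<subseteq> A0" "Y \<subseteq> B0" "card X = u" "card Y = u" for X Y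
      using upper[of X Y] that AB0 by blast
      show "\<epsilon> / 4 * (real (u * k ^ J))\<^sup>2 \<le> ecount h A0 B0" using dens by (simp add: m_def)
    show "c < (1 + 1 / (2 * (real k)\<^sup>2)) ^ J * (\<epsilon> / 4)" using c by simp
  qed (use AB0(3-5) pos m_def in auto)
  then obtain j A B D where jAB: "A \<subseteq> A0" "B \<subseteq> B0" "card A = u * k ^ Suc j" "card B = u * k ^ Suc j" "\<epsilon> / 4 \<le> D"
    "D * (real (u * k ^ Suc j))\<^sup>2 \<le> ecount h A B"
    "\<forall>X Y. X \<subseteq> A \<longrightarrow> Y \<subseteq> B \<longrightarrow> card X = u * k ^ j \<longrightarrow> card Y = u * k ^ j \<longrightarrow>
      ecount h X Y \<le> (1 + 1 / (2 * (real k)\<^sup>2)) * D * (real (u * k ^ j))\<^sup>2"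
    by (elim exE conjE) (rule that, assumption+)
  have fin: "finite A" "finite B"
    using finite_subset[OF order_trans[OF jAB(1) AB0(1)] V(1)] finite_subset[OF order_trans[OF jAB(2) AB0(2)] V(1)] by auto
  \<comment> \<open>The density loses a factor 4 in \<open>balanced_cut\<close> and a factor 2 in
    \<open>lower_regular\<close>.\<close>
  have "\<epsilon> / 8 * card X * card Y \<le> ecount h X Y"
    if XY: "X \<subseteq> A" "Y \<subseteq> B" "(u * k ^ Suc j) / k \<le> card X" "(u * k ^ Suc j) / k \<le> card Y" for X Y
  proof -
    have eq: "real (u * k ^ Suc j) / k = real (u * k ^ j)" using pos by simp
    have "D / 2 * card X * card Y \<le> ecount h X Y"
    proof (rule lower_regular[where h=h, OF fin, where k=k and m="u * k ^ j"])
      show "h y x" if "h x y" for x y using that by (rule h(1))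
      show "X \<subseteq> A" "Y \<subseteq> B" by (fact XY)+
      show "u * k ^ j \<le> card X" "u * k ^ j \<le> card Y" using XY(3,4) unfolding eq by (simp_all only: of_nat_le_iff)
      show "D * (real (k * (u * k ^ j)))\<^sup>2 \<le> ecount h A B" using jAB(6) by (simp add: mult_ac)
      show "card A = k * (u * k ^ j)" "card B = k * (u * k ^ j)" using jAB(3,4) by simp_all
      show "2 \<le> k" "0 < u * k ^ j" "0 \<le> D" using pos jAB(5) by simp_all
      show "ecount h X Y \<le> (1 + 1 / (2 * (real k)\<^sup>2)) * D * (real (u * k ^ j))\<^sup>2"
        if "X \<subseteq> A" "Y \<subseteq> B" "card X = u * k ^ j" "card Y = u * k ^ j" for X Y using jAB(7) that by blast
    qed
    moreover have "\<epsilon> / 8 * card X * card Y \<le> D / 2 * card X * card Y"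
      using jAB(5) by (intro mult_right_mono) auto
    ultimately show ?thesis by linarith
  qed
  then have "\<forall>X Y. X \<subseteq> A \<longrightarrow> Y \<subseteq> B \<longrightarrow> (u * k ^ Suc j) / k \<le> card X \<longrightarrow> (u * k ^ Suc j) / k \<le> card Y \<longrightarrow>
      \<epsilon> / 8 * card X * card Y \<le> ecount h X Y" by blast
  moreover have "u \<le> u * k ^ Suc j" using pos by simp
  moreover have "A \<subseteq> V" "B \<subseteq> V" "A \<inter> B = {}" using jAB(1,2) AB0(1-3) by blast+
  ultimately show ?thesis using jAB(3,4) by blast
qed

section \<open>Constants\<close>

text \<open>\<open>K\<close> plays the role of \<open>1 / \<eta>\<close>; its logarithm must exceed
  \<open>1024 / \<alpha> = 16 / \<kappa>\<close> for the union bound in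
  \<open>prob_concentrated_fixed\<close>. \<open>J\<close> is the number of density increments that
  no graph with the cap \<open>8 * p\<close> on densities can allow, whence
  \<open>32 = 4 * 8\<close>.\<close>

locale grid_constants =
  fixes \<alpha> :: real and K J :: nat
  assumes \<alpha>: "0 < \<alpha>" "\<alpha> \<le> 1 / 8" and K: "8 \<le> K" "1024 / \<alpha> \<le> ln (K / 4)"
    and J: "32 < (1 + 1 / (2 * (real K)\<^sup>2)) ^ J * \<alpha>"
begin

text \<open>Each constant solves one numerical assumption of \<open>grid_host\<close>.
  \<open>\<kappa>\<close>: \<open>k = \<kappa> * p * N\<close> with
  \<open>8 * k \<le> \<theta> * N\<close> and \<open>\<theta> = \<alpha> * p / 8\<close>.
  \<open>\<delta>\<close>: the pair found has \<open>N \<ge> \<delta> * n\<close>.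
  \<open>\<mu>\<close>: \<open>r \<le> \<mu> / p\<close>, the summand 1 absorbing rounding.
  \<open>\<rho>\<close>: the hitting rate \<open>t / (2 * \<Delta>)\<close> is at least
  \<open>\<rho> * p\<close>. \<open>\<gamma>\<close>: \<open>b \<le> \<gamma> * p * N\<close>
  implies the assumptions on \<open>b\<close>. \<open>density_const\<close> makes
  \<open>6 * ln n / (\<rho> * p)\<close> at most \<open>\<gamma> * p * N\<close>, and
  \<open>size_const\<close> gives \<open>s * cd \<le> k\<close> with
  \<open>cd = 8 * p\<^sup>2 * n\<close>.\<close>

definition \<kappa> :: real where "\<kappa> = \<alpha> / 64"
definition \<delta> :: real where "\<delta> = 1 / (8 * real K ^ J)"
definition \<mu> :: real where "\<mu> = 8 * K * ln (4 * K) / \<alpha> + 1"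
definition \<rho> :: real where "\<rho> = \<kappa> * \<delta> / (256 * \<mu>)"
definition \<gamma> :: real where "\<gamma> = \<kappa> / (32 * K * \<mu>)"
definition density_const :: real where "density_const = 6 / (\<rho> * \<gamma> * \<delta>)"
definition size_const :: real where "size_const = \<kappa> * \<delta> / 8"

lemma \<kappa>: "0 < \<kappa>" "\<kappa> \<le> 1" using \<alpha> by (auto simp: \<kappa>_def)

lemma \<delta>: "0 < \<delta>" "\<delta> \<le> 1"
proof -
  have "1 \<le> real K ^ J" using K by (intro one_le_power) auto
  then have "1 \<le> 8 * real K ^ J" by linarith
  then show "0 < \<delta>" "\<delta> \<le> 1" unfolding \<delta>_def using K(1) by (simp_all add: divide_le_eq)
qed

lemma \<mu>: "1 \<le> \<mu>" using \<alpha> K by (auto simp: \<mu>_def)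

lemma \<rho>: "0 < \<rho>" "\<rho> \<le> 1"
proof -
  have "\<kappa> * \<delta> \<le> 1 * 1" using \<kappa> \<delta> by (intro mult_mono) auto
  then show "0 < \<rho>" "\<rho> \<le> 1" using \<kappa> \<delta> \<mu> by (auto simp: \<rho>_def)
qed

lemma \<gamma>: "0 < \<gamma>" "\<gamma> \<le> 1" "\<gamma> \<le> \<kappa> / 4" "\<gamma> \<le> 1 / (2 * K)"
proof -
  have K\<mu>: "8 \<le> K * \<mu>" using mult_mono[of 8 "real K" 1 \<mu>] K \<mu> by auto
  show "0 < \<gamma>" using \<kappa> \<mu> K by (auto simp: \<gamma>_def)
  have "\<gamma> = \<kappa> / (32 * (K * \<mu>))" by (simp add: \<gamma>_def mult_ac)
  also have "\<dots> \<le> \<kappa> / 4" using K\<mu> \<kappa> by (intro divide_left_mono) auto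
  finally show "\<gamma> \<le> \<kappa> / 4" .
  then show "\<gamma> \<le> 1" using \<kappa> by simp
  have "\<gamma> \<le> 1 / (32 * K * \<mu>)" unfolding \<gamma>_def using \<kappa> \<mu> K by (intro divide_right_mono) auto
  also have "\<dots> \<le> 1 / (2 * K)" using \<mu> K by (intro divide_left_mono) (auto intro: mult_mono)
  finally show "\<gamma> \<le> 1 / (2 * K)" .
qed

lemma density_const: "1 \<le> density_const"
proof -
  have "\<rho> * \<gamma> * \<delta> \<le> 1 * 1 * 1" using \<rho> \<gamma> \<delta> by (intro mult_mono) auto
  then show ?thesis using \<rho> \<gamma> \<delta> by (simp add: density_const_def field_simps)
qed

lemma size_const: "0 < size_const" "size_const \<le> 1" "size_const \<le> \<kappa> / 8"
proof -
  show "0 < size_const" using \<kappa> \<delta> by (simp add: size_const_def)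
  have "\<kappa> * \<delta> \<le> \<kappa> * 1" using \<kappa> \<delta> by (intro mult_mono) auto
  then show "size_const \<le> \<kappa> / 8" by (simp add: size_const_def)
  then show "size_const \<le> 1" using \<kappa> by simp
qed

text \<open>This is \<open>b\<close>. The factor 3 makes \<open>(1 - \<rho> * p) ^ b\<close> at most
  \<open>1 / n ^ 3\<close>, which beats the at most \<open>n\<^sup>2\<close> constraints.\<close>

definition exc_size :: "nat \<Rightarrow> real \<Rightarrow> nat" where
  "exc_size n p = nat \<lceil>3 * ln n / (\<rho> * p)\<rceil>"

end

locale grid_scale = grid_constants +
  fixes n :: nat and p :: real
  assumes p: "0 < p" "p \<le> 1" and pn: "density_const * ln n \<le> p\<^sup>2 * n" and ln_n: "\<mu> \<le> ln n" "K \<le> \<delta> * ln n"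
begin

abbreviation "b \<equiv> exc_size n p"

lemma ln_n_1: "1 \<le> ln n" using ln_n \<mu> by simp

lemma n_pos: "2 \<le> n"
proof -
  have "1 < real n" using ln_n_1 by (smt (verit) ln_le_zero_iff ln_0 of_nat_0_le_iff)
  then show ?thesis by simp
qed

lemma exc_size_ge: "3 * ln n / (\<rho> * p) \<le> b"
  unfolding exc_size_def by linarith

lemma exc_size_ge': "ln n / p \<le> b"
proof -
  have "ln n / p \<le> 3 * ln n / (\<rho> * p)"
  proof -
    have "\<rho> * (ln n / p) \<le> 3 * (ln n / p)" using \<rho> p ln_n_1 by (intro mult_right_mono) auto
    then show ?thesis using \<rho> p by (simp add: field_simps)
  qed
  then show ?thesis using exc_size_ge by linarith
qed

lemma exc_size_pos: "1 \<le> b"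
proof -
  have "1 \<le> ln n / p" using ln_n_1 p by (simp add: le_divide_eq)
  then show ?thesis using exc_size_ge' by linarith
qed

context
  fixes N :: nat
  assumes N: "\<delta> * n \<le> N" "N \<le> n"
begin

lemma pN: "\<delta> * density_const * ln n \<le> p\<^sup>2 * N" "K \<le> p\<^sup>2 * N" "K \<le> p * N" "8 \<le> p * N" "0 < N"
proof -
  have "\<delta> * (density_const * ln n) \<le> \<delta> * (p\<^sup>2 * n)" using pn \<delta> by (intro mult_left_mono) auto
  also have "\<dots> = p\<^sup>2 * (\<delta> * n)" by simp
  also have "\<dots> \<le> p\<^sup>2 * N" using N by (intro mult_left_mono) auto
  finally show 1: "\<delta> * density_const * ln n \<le> p\<^sup>2 * N" by simp
  have "\<delta> * 1 * ln n \<le> \<delta> * density_const * ln n" using density_const \<delta> ln_n_1 by (intro mult_right_mono mult_left_mono) auto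
  then show 2: "K \<le> p\<^sup>2 * N" using 1 ln_n by linarith
  have "p\<^sup>2 \<le> p" using p by (simp add: power2_eq_square mult_left_le_one_le)
  then have "p\<^sup>2 * N \<le> p * N" by (intro mult_right_mono) auto
  then show 3: "K \<le> p * N" using 2 by linarith
  then show "8 \<le> p * N" using K by linarith
  then show "0 < N" using p by (cases N) auto
qed

lemma exc_size_le: "b \<le> \<gamma> * p * N"
proof -
  have "b \<le> 3 * ln n / (\<rho> * p) + 1" unfolding exc_size_def using ln_n_1 \<rho> p by (simp add: of_nat_nat)
  also have "1 \<le> 3 * ln n / (\<rho> * p)"
  proof -
    have "\<rho> * p \<le> 1 * 1" using \<rho> p by (intro mult_mono) auto
    then show ?thesis using \<rho> p ln_n_1 by (simp add: le_divide_eq)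
  qed
  finally have "b \<le> 6 * ln n / (\<rho> * p)" by (simp add: mult.commute)
  also have "\<dots> = (\<gamma> / p) * (\<delta> * density_const * ln n)" using \<rho> \<gamma> \<delta> p by (simp add: density_const_def field_simps)
  also have "\<dots> \<le> (\<gamma> / p) * (p\<^sup>2 * N)" using pN(1) \<gamma> p by (intro mult_left_mono) auto
  also have "\<dots> = \<gamma> * p * N" using p by (simp add: power2_eq_square)
  finally show ?thesis .
qed

text \<open>These are \<open>r\<close> and \<open>t\<close> of \<open>grid_host\<close>.
  \<open>r\<close> makes \<open>(1 - \<theta> * \<eta>) ^ r\<close> at most
  \<open>\<eta> / 4\<close>, and \<open>t\<close> is then the largest value allowed by
  \<open>r \<le> \<mu> / p\<close> and \<open>2 * r * t \<le> k / 8\<close>. Despite the name,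
  \<open>t\<close> is the threshold for having few neighbours in a set, not the codegree cap
  \<open>cd\<close>.\<close>

definition "hitting_steps = nat \<lceil>8 * K * ln (4 * K) / (\<alpha> * p)\<rceil>"
definition "codegree_bound = \<kappa> * p\<^sup>2 * N / (16 * \<mu>)"

lemma hitting_steps_le: "hitting_steps \<le> \<mu> / p"
proof -
  have "0 \<le> 8 * K * ln (4 * K) / (\<alpha> * p)" using \<alpha> K p by simp
  then have "hitting_steps \<le> 8 * K * ln (4 * K) / (\<alpha> * p) + 1" unfolding hitting_steps_def by (simp add: of_nat_nat)
  also have "1 \<le> 1 / p" using p by simp
  finally show ?thesis by (simp add: \<mu>_def add_divide_distrib)
qed

lemma num_r: "hitting_steps \<le> b" "(1 - (\<alpha> * p / 8) * (1 / K)) ^ hitting_steps \<le> (1 / K) / 4" "2 * hitting_steps * codegree_bound \<le> \<kappa> * p * N / 8"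
proof -
  have "\<mu> / p \<le> ln n / p" using ln_n p by (intro divide_right_mono) auto
  then show "hitting_steps \<le> b" using hitting_steps_le exc_size_ge' by linarith
  let ?x = "(\<alpha> * p / 8) * (1 / K)"
  have "\<alpha> * p \<le> 1 * 1" using \<alpha> p by (intro mult_mono) auto
  moreover have "?x = \<alpha> * p / (8 * K)" by simp
  moreover have "\<alpha> * p / (8 * K) \<le> 1 / 1" using calculation K by (intro frac_le) auto
  ultimately have x: "?x \<le> 1" by simp
  have x0: "0 < ?x" using \<alpha> p K by simp
  have "(1 - ?x) ^ hitting_steps \<le> exp (- ?x) ^ hitting_steps" using x exp_ge_add_one_self[of "- ?x"] by (intro power_mono) auto
  also have "\<dots> = exp (- (?x * hitting_steps))" by (simp add: exp_of_nat_mult[symmetric] mult.commute)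
  also have "\<dots> \<le> exp (- ln (4 * K))"
  proof -
    have "8 * K * ln (4 * K) / (\<alpha> * p) \<le> hitting_steps" unfolding hitting_steps_def by linarith
    then have "?x * (8 * K * ln (4 * K) / (\<alpha> * p)) \<le> ?x * hitting_steps" using x0 by (intro mult_left_mono) auto
    moreover have "?x * (8 * K * ln (4 * K) / (\<alpha> * p)) = ln (4 * K)" using \<alpha> p K by simp
    ultimately show ?thesis by simp
  qed
  also have "\<dots> = (1 / K) / 4" using K by (simp add: exp_minus inverse_eq_divide)
  finally show "(1 - ?x) ^ hitting_steps \<le> (1 / K) / 4" .
  have "2 * hitting_steps * codegree_bound \<le> 2 * (\<mu> / p) * codegree_bound"
    using hitting_steps_le \<kappa> \<mu> by (intro mult_right_mono mult_left_mono) (auto simp: codegree_bound_def)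
  also have "\<dots> = \<kappa> * p * N / 8" using p \<mu> by (simp add: codegree_bound_def power2_eq_square)
  finally show "2 * hitting_steps * codegree_bound \<le> \<kappa> * p * N / 8" .
qed

lemma num_b: "2 * b \<le> (1 / K) * N" "4 * b \<le> \<kappa> * p * N" "2 * (\<kappa> * p * N) * b \<le> (1 / K) * N * codegree_bound" "b \<le> p * N"
proof -
  have "\<gamma> * p * N \<le> 1 / (2 * K) * 1 * N" using \<gamma> p K by (intro mult_right_mono mult_mono) auto
  then show "2 * b \<le> (1 / K) * N" using exc_size_le by simp
  have "\<gamma> * p * N \<le> \<kappa> / 4 * p * N" using \<gamma> p by (intro mult_right_mono) auto
  then show "4 * b \<le> \<kappa> * p * N" using exc_size_le by simp
  have "\<gamma> * p * N \<le> 1 * p * N" using \<gamma> p by (intro mult_right_mono) auto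
  then show "b \<le> p * N" using exc_size_le by simp
  have "\<gamma> \<le> 1 / (32 * K * \<mu>)" unfolding \<gamma>_def using \<kappa> \<mu> K by (intro divide_right_mono) auto
  then have "\<gamma> * (p * N) \<le> 1 / (32 * K * \<mu>) * (p * N)" using p by (intro mult_right_mono) auto
  then have "b \<le> 1 / (32 * K * \<mu>) * (p * N)" using exc_size_le by simp
  then have "2 * (\<kappa> * p * N) * b \<le> 2 * (\<kappa> * p * N) * (1 / (32 * K * \<mu>) * (p * N))"
    using \<kappa> p by (intro mult_left_mono) auto
  also have "\<dots> = (1 / K) * N * codegree_bound" by (simp add: codegree_bound_def power2_eq_square mult_ac)
  finally show "2 * (\<kappa> * p * N) * b \<le> (1 / K) * N * codegree_bound" .
qed

lemma num_D: "(1 - codegree_bound / (2 * (8 * p * n))) ^ b * (b * N) < 1" "codegree_bound \<le> 2 * (8 * p * n)"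
proof -
  let ?x = "codegree_bound / (2 * (8 * p * n))"
  have n0: "0 < real n" using n_pos by simp
  have "\<kappa> * p\<^sup>2 * N \<le> 1 * p * n"
  proof (intro mult_mono)
    show "p\<^sup>2 \<le> p" using p by (simp add: power2_eq_square mult_left_le_one_le)
  qed (use \<kappa> p N in auto)
  moreover have "codegree_bound \<le> \<kappa> * p\<^sup>2 * N / 1" unfolding codegree_bound_def using \<mu> \<kappa> by (intro divide_left_mono) auto
  moreover have "0 \<le> p * n" using p by simp
  ultimately show t: "codegree_bound \<le> 2 * (8 * p * n)" by simp
  have x1: "?x \<le> 1" using t p n0 by (simp add: divide_le_eq)
  have x: "\<rho> * p \<le> ?x"
  proof -
    have "\<rho> * p * (2 * (8 * p * n)) = \<kappa> * p\<^sup>2 * (\<delta> * n) / (16 * \<mu>)" by (simp add: \<rho>_def power2_eq_square)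
    also have "\<dots> \<le> codegree_bound" unfolding codegree_bound_def using N \<kappa> \<mu> by (intro divide_right_mono mult_left_mono) auto
    finally show ?thesis using p n0 by (simp add: le_divide_eq)
  qed
  have "(1 - ?x) ^ b \<le> exp (- ?x) ^ b" using x1 exp_ge_add_one_self[of "- ?x"] by (intro power_mono) auto
  also have "\<dots> = exp (- (?x * b))" by (simp add: exp_of_nat_mult[symmetric] mult.commute)
  also have "\<dots> \<le> exp (- (3 * ln n))"
  proof -
    have "3 * ln n = \<rho> * p * (3 * ln n / (\<rho> * p))" using \<rho> p by simp
    also have "\<dots> \<le> \<rho> * p * b" using exc_size_ge \<rho> p by (intro mult_left_mono) auto
    also have "\<dots> \<le> ?x * b" using x by (intro mult_right_mono) auto
    finally show ?thesis by simp
  qed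
  also have "\<dots> = 1 / real n ^ 3"
  proof -
    have "exp (3 * ln n) = exp (ln n) ^ 3" using exp_of_nat_mult[of 3 "ln n"] by simp
    then show ?thesis using n0 by (simp add: exp_minus inverse_eq_divide)
  qed
  finally have e: "(1 - ?x) ^ b \<le> 1 / real n ^ 3" .
  have "(1 / K) * N \<le> 1 * real N" using K by (intro mult_right_mono) auto
  then have "b \<le> N" using num_b(1) by linarith
  then have "b * N \<le> n * n" using N by (intro mult_le_mono) auto
  then have bN: "real (b * N) \<le> real (n * n)" by (simp only: of_nat_le_iff)
  have "(1 - ?x) ^ b * (b * N) \<le> 1 / real n ^ 3 * real (n * n)"
    using e bN x1 by (intro mult_mono) auto
  also have "\<dots> = 1 / n" using n0 by (simp add: power3_eq_cube)
  also have "\<dots> < 1" using n_pos by simp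
  finally show "(1 - ?x) ^ b * (b * N) < 1" .
qed

lemma num_pos: "0 < \<alpha> * p / 8" "0 < 1 / real K" "0 < codegree_bound" "(\<alpha> * p / 8) * (1 / K) \<le> 1" "4 \<le> \<kappa> * p * N" "4 * (1 / real K) < 1"
proof -
  show "0 < \<alpha> * p / 8" "0 < 1 / real K" using \<alpha> p K by auto
  show "0 < codegree_bound" using \<kappa> p \<mu> pN by (auto simp: codegree_bound_def)
  have "\<alpha> * p \<le> 1 * 1" using \<alpha> p by (intro mult_mono) auto
  then have "\<alpha> * p / (8 * K) \<le> 1 / 1" using K by (intro frac_le) auto
  then show "(\<alpha> * p / 8) * (1 / K) \<le> 1" by simp
  show "4 \<le> \<kappa> * p * N" using num_b(2) exc_size_pos by linarith
  show "4 * (1 / real K) < 1" using K by simp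
qed

lemma num_s:
  fixes s :: nat
  assumes "s \<le> size_const / p"
  shows "s * (8 * p\<^sup>2 * n) \<le> \<kappa> * p * N" "4 * s \<le> \<kappa> * p * N" "s * s \<le> 4 * (1 / K) * N"
proof -
  have "s * (8 * p\<^sup>2 * n) \<le> size_const / p * (8 * p\<^sup>2 * n)" using assms by (intro mult_right_mono) auto
  also have "\<dots> = \<kappa> * p * (\<delta> * n)" using p by (simp add: size_const_def power2_eq_square)
  also have "\<dots> \<le> \<kappa> * p * N" using N \<kappa> p by (intro mult_left_mono) auto
  finally show "s * (8 * p\<^sup>2 * n) \<le> \<kappa> * p * N" .
  have "4 * s \<le> 4 * (size_const / p)" using assms by simp
  also have "\<dots> \<le> (\<kappa> / p) * 1" using size_const \<kappa> p by (simp add: divide_right_mono)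
  also have "\<dots> \<le> (\<kappa> / p) * (p\<^sup>2 * N)" using pN(2) K \<kappa> p by (intro mult_left_mono) auto
  also have "\<dots> = \<kappa> * p * N" using p by (simp add: power2_eq_square)
  finally show "4 * s \<le> \<kappa> * p * N" .
  have "s \<le> 1 / p" using assms size_const p by (smt (verit) divide_right_mono)
  then have "real s * s \<le> (1 / p) * (1 / p)" using p by (intro mult_mono) auto
  also have "\<dots> = (1 / (K * p\<^sup>2)) * K" using K by (simp add: power2_eq_square)
  also have "\<dots> \<le> (1 / (K * p\<^sup>2)) * (p\<^sup>2 * N)" using pN(2) by (intro mult_left_mono) auto
  also have "\<dots> = (1 / K) * N" using p by simp
  also have "\<dots> \<le> 4 * (1 / K) * N" by (intro mult_right_mono) (auto simp: divide_right_mono)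
  finally show "s * s \<le> 4 * (1 / K) * N" by simp
qed

lemma num_P: "4 * p * N \<le> \<kappa> * p * N / 4 * ln (1 / (4 * (1 / K)))"
proof -
  have "16 / \<kappa> \<le> ln (1 / (4 * (1 / K)))" using K by (simp add: \<kappa>_def)
  then have "(\<kappa> * p * N / 4) * (16 / \<kappa>) \<le> (\<kappa> * p * N / 4) * ln (1 / (4 * (1 / K)))"
    using \<kappa> p by (intro mult_left_mono) auto
  then show ?thesis using \<kappa> by simp
qed

end
end

section \<open>Typical graphs contain grids robustly\<close>

lemma contains_copyI:
  assumes F: "simple_graph F" and inj: "inj_on \<phi> (verts F)" and v: "\<phi> ` verts F \<subseteq> verts H"
    and e: "\<And>x y. x \<in> verts F \<Longrightarrow> y \<in> verts F \<Longrightarrow> {x, y} \<in> edges F \<Longrightarrow> {\<phi> x, \<phi> y} \<in> edges H"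
  shows "contains_copy H F"
proof -
  let ?F' = "(\<phi> ` verts F, (`) \<phi> ` edges F)"
  have Fe: "edges F \<subseteq> [verts F]\<^bsup>2\<^esup>" using F by (simp add: simple_graph_def)
  have "subgraph ?F' H"
    unfolding subgraph_def simple_graph_def
  proof (intro conjI subsetI)
    fix a assume "a \<in> edges ?F'"
    then obtain d where d: "d \<in> edges F" "a = \<phi> ` d" by auto
    with Fe have "d \<in> [verts F]\<^bsup>2\<^esup>" by blast
    then obtain x y where xy: "d = {x, y}" "x \<in> verts F" "y \<in> verts F" "x \<noteq> y" by (rule nsets2_E)
    then have "\<phi> x \<noteq> \<phi> y" using inj by (auto simp: inj_on_def)
    then show "a \<in> [verts ?F']\<^bsup>2\<^esup>" using d xy by auto
  next
    fix a assume "a \<in> edges ?F'"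
    then obtain d where d: "d \<in> edges F" "a = \<phi> ` d" by auto
    with Fe have "d \<in> [verts F]\<^bsup>2\<^esup>" by blast
    then obtain x y where "d = {x, y}" "x \<in> verts F" "y \<in> verts F" by (rule nsets2_E)
    then show "a \<in> edges H" using d e[of x y] by auto
  qed (use v in auto)
  moreover have "isomorphic F ?F'"
    unfolding isomorphic_def
  proof (intro exI conjI ballI)
    show "bij_betw \<phi> (verts F) (verts ?F')" using inj by (simp add: bij_betw_def)
    fix x y assume xy: "x \<in> verts F" "y \<in> verts F"
    have "{x, y} \<in> edges F" if "{\<phi> x, \<phi> y} \<in> edges ?F'"
    proof -
      from that obtain d where d: "d \<in> edges F" "\<phi> ` {x, y} = \<phi> ` d" by auto
      then have "d \<subseteq> verts F" using Fe by (auto simp: nsets_def)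
      then have "{x, y} = d" using d xy inj_on_image_eq_iff[OF inj, of "{x, y}" d] by auto
      then show ?thesis using d by simp
    qed
    moreover have "{\<phi> x, \<phi> y} \<in> edges ?F'" if "{x, y} \<in> edges F"
      using that imageI[of "{x, y}" "edges F" "(`) \<phi>"] by simp
    ultimately show "{x, y} \<in> edges F \<longleftrightarrow> {\<phi> x, \<phi> y} \<in> edges ?F'" by blast
  qed
  ultimately show ?thesis by (auto simp: contains_copy_def)
qed

lemma contains_grid:
  fixes F :: "nat \<Rightarrow> nat \<Rightarrow> 'a"
  assumes inj: "inj_on (\<lambda>(i, j). F i j) ({..<s} \<times> {..<s})"
    and v: "\<And>i j. i < s \<Longrightarrow> j < s \<Longrightarrow> F i j \<in> verts H"
    and e1: "\<And>i j. Suc i < s \<Longrightarrow> j < s \<Longrightarrow> {F i j, F (Suc i) j} \<in> edges H"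
    and e2: "\<And>i j. i < s \<Longrightarrow> Suc j < s \<Longrightarrow> {F i j, F i (Suc j)} \<in> edges H"
  shows "contains_copy H (grid_graph s s)"
\<comment> \<open>\<open>grid_graph\<close> is indexed from 1, \<open>F\<close> from 0.\<close>
proof (rule contains_copyI[where \<phi>="\<lambda>(i, j). F (i - 1) (j - 1)"])
  show "simple_graph (grid_graph s s)" by (rule simple_graph_grid_graph)
  have eq: "F i j = F i' j' \<Longrightarrow> i = i' \<and> j = j'" if "i < s" "j < s" "i' < s" "j' < s" for i j i' j'
    using inj_onD[OF inj, of "(i, j)" "(i', j')"] that by auto
  show "inj_on (\<lambda>(i, j). F (i - 1) (j - 1)) (verts (grid_graph s s))"
  proof (rule inj_onI)
    fix x y assume xy: "x \<in> verts (grid_graph s s)" "y \<in> verts (grid_graph s s)"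
      "(case x of (i, j) \<Rightarrow> F (i - 1) (j - 1)) = (case y of (i, j) \<Rightarrow> F (i - 1) (j - 1))"
    obtain i j i' j' where ij: "x = (i, j)" "y = (i', j')" by (cases x, cases y)
    then have r: "1 \<le> i" "i \<le> s" "1 \<le> j" "j \<le> s" "1 \<le> i'" "i' \<le> s" "1 \<le> j'" "j' \<le> s"
      "F (i - 1) (j - 1) = F (i' - 1) (j' - 1)" using xy by (auto simp: grid_graph_def)
    then have "i - 1 = i' - 1 \<and> j - 1 = j' - 1" by (intro eq) auto
    then show "x = y" using r ij by auto
  qed
  show "(\<lambda>(i, j). F (i - 1) (j - 1)) ` verts (grid_graph s s) \<subseteq> verts H"
    by (auto simp: grid_graph_def intro!: v)
  fix x y assume xy: "{x, y} \<in> edges (grid_graph s s)"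
  obtain i j i' j' where ij: "x = (i, j)" "y = (i', j')" by (cases x, cases y)
  have sym: "grid_adj v u \<longleftrightarrow> grid_adj u v" for u v by (auto simp: grid_adj_def)
  have adj: "x \<in> {1..s} \<times> {1..s}" "y \<in> {1..s} \<times> {1..s}" "grid_adj x y"
    using xy by (auto simp: grid_graph_def doubleton_eq_iff sym)
  then have r: "1 \<le> i" "i \<le> s" "1 \<le> j" "j \<le> s" "1 \<le> i'" "i' \<le> s" "1 \<le> j'" "j' \<le> s" using ij by auto
  obtain a b a' b' where ab: "i = Suc a" "j = Suc b" "i' = Suc a'" "j' = Suc b'"
    using r by (metis Suc_le_D One_nat_def)
  consider "a = a'" "b' = Suc b" | "a = a'" "b = Suc b'" | "b = b'" "a' = Suc a" | "b = b'" "a = Suc a'"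
    using adj(3) unfolding ij ab grid_adj_def by fastforce
  then show "{case x of (i, j) \<Rightarrow> F (i - 1) (j - 1), case y of (i, j) \<Rightarrow> F (i - 1) (j - 1)} \<in> edges H"
    using r e1[of a b] e1[of a' b] e2[of a b] e2[of a b'] unfolding ij ab
    by cases (auto simp: insert_commute)
qed

lemma card_edges_le_ecount:
  assumes "E \<subseteq> [V]\<^bsup>2\<^esup>" "finite V"
  shows "card E \<le> ecount (\<lambda>x y. {x, y} \<in> E) V V"
proof -
  have "ecount (\<lambda>x y. {x, y} \<in> E) V V = card (SIGMA x:V. {y\<in>V. {x, y} \<in> E})"
    using assms by (simp add: ecount_def)
  moreover have "E \<subseteq> (\<lambda>(x, y). {x, y}) ` (SIGMA x:V. {y\<in>V. {x, y} \<in> E})"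
  proof
    fix a assume a: "a \<in> E"
    with assms have "a \<in> [V]\<^bsup>2\<^esup>" by blast
    then obtain x y where "a = {x, y}" "x \<in> V" "y \<in> V" by (rule nsets2_E)
    then show "a \<in> (\<lambda>(x, y). {x, y}) ` (SIGMA x:V. {y\<in>V. {x, y} \<in> E})"
      using a by (intro image_eqI[of _ _ "(x, y)"]) auto
  qed
  then have "card E \<le> card (SIGMA x:V. {y\<in>V. {x, y} \<in> E})"
    by (rule surj_card_le[rotated]) (use assms(2) in auto)
  ultimately show ?thesis by simp
qed

lemma ecount_eq_card_cross:
  assumes "X \<inter> Y = {}" "finite X" "finite Y"
  shows "ecount (\<lambda>x y. {x, y} \<in> E) X Y = card (E \<inter> cross X Y)"
proof -
  have "ecount (\<lambda>x y. {x, y} \<in> E) X Y = card (SIGMA x:X. {y\<in>Y. {x, y} \<in> E})"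
    using assms by (simp add: ecount_def)
  also have "\<dots> = card ((\<lambda>(x, y). {x, y}) ` (SIGMA x:X. {y\<in>Y. {x, y} \<in> E}))"
    by (rule card_image[symmetric], rule inj_on_subset[OF inj_on_doubleton[OF assms(1)]]) auto
  also have "(\<lambda>(x, y). {x, y}) ` (SIGMA x:X. {y\<in>Y. {x, y} \<in> E}) = E \<inter> cross X Y"
    by (auto simp: cross_def)
  finally show ?thesis .
qed

section \<open>Typical graphs\<close>

context grid_constants
begin

text \<open>\<open>n div (4 * K ^ J)\<close> is the size at which the density increment must stop.
  The last clause covers every \<open>N\<close> in the range because the size of the regular pair
  depends on the adversarial subgraph.\<close>

definition typical :: "nat \<Rightarrow> real \<Rightarrow> nat ugraph \<Rightarrow> bool" where
  "typical n p G \<longleftrightarrow> simple_graph G \<and> verts G = {1..n} \<and> p * (real n)\<^sup>2 / 8 \<le> num_edges G \<and>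
    (\<forall>X Y. X \<subseteq> {1..n} \<longrightarrow> Y \<subseteq> {1..n} \<longrightarrow> X \<inter> Y = {} \<longrightarrow> card X = n div (4 * K ^ J) \<longrightarrow> card Y = n div (4 * K ^ J) \<longrightarrow>
      real (card (edges G \<inter> cross X Y)) \<le> 8 * p * (real (n div (4 * K ^ J)))\<^sup>2) \<and>
    (\<forall>x\<in>{1..n}. real (card (edges G \<inter> cross {x} ({1..n} - {x}))) \<le> 8 * p * real n) \<and>
    (\<forall>x\<in>{1..n}. \<forall>y\<in>{1..n}. x \<noteq> y \<longrightarrow> real (card {z\<in>{1..n} - {x, y}. {x, z} \<in> edges G \<and> {y, z} \<in> edges G}) \<le> 8 * p\<^sup>2 * real n) \<and>
    (\<forall>N X S V. \<delta> * n \<le> N \<longrightarrow> N \<le> n \<longrightarrow> \<not> concentrated n N (exc_size n p) (4 * (1 / K)) (\<kappa> * p * N / 4) G X S V)"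

end

context grid_scale
begin

lemma part_size_ge: "\<delta> * n \<le> n div (4 * K ^ J)" "0 < n div (4 * K ^ J)"
proof -
  let ?m = "4 * K ^ J"
  have m0: "0 < ?m" using K by simp
  have "K / \<delta> \<le> ln n" using ln_n(2) \<delta> by (simp add: divide_le_eq mult.commute)
  also have "\<dots> \<le> n" using n_pos ln_le_minus_one[of "real n"] by simp
  finally have "K / \<delta> \<le> n" .
  moreover have "K / \<delta> = real K * real (2 * ?m)" by (simp add: \<delta>_def)
  moreover have "1 * real (2 * ?m) \<le> real K * real (2 * ?m)" using K by (intro mult_right_mono) auto
  ultimately have "real (2 * ?m) \<le> n" by linarith
  \<comment> \<open>With at least two full blocks, rounding down loses at most a factor 2, which is
    the ratio between \<open>8\<close> in \<open>\<delta>\<close> and \<open>4\<close> here.\<close>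
  then have n: "2 * ?m \<le> n" by (simp only: of_nat_le_iff)
  have "n = n div ?m * ?m + n mod ?m" by (rule div_mult_mod_eq[symmetric])
  moreover have "n mod ?m < ?m" using m0 by simp
  moreover have "?m \<le> n div ?m * ?m"
  proof -
    have "1 \<le> n div ?m" using n m0 by (simp add: div_greater_zero_iff Suc_le_eq)
    then have "1 * ?m \<le> n div ?m * ?m" by (rule mult_le_mono1)
    then show ?thesis by simp
  qed
  ultimately have "n \<le> 2 * (n div ?m * ?m)" by linarith
  then have "real n \<le> real (2 * (n div ?m * ?m))" by (simp only: of_nat_le_iff)
  then show "\<delta> * n \<le> n div ?m" using K by (simp add: \<delta>_def field_simps)
  show "0 < n div ?m" using n m0 by (simp add: div_greater_zero_iff)
qed

lemma typical_contains_grid: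
  assumes G: "typical n p G" and H: "subgraph H G" "8 * \<alpha> * num_edges G \<le> num_edges H"
    and s: "1 \<le> s" "s \<le> size_const / p"
  shows "contains_copy H (grid_graph s s)"
proof -
  let ?u = "n div (4 * K ^ J)"
  have Hs: "edges H \<subseteq> [verts H]\<^bsup>2\<^esup>" "verts H \<subseteq> {1..n}" "edges H \<subseteq> edges G"
    using H G by (auto simp: subgraph_def simple_graph_def typical_def)
  then have Hn: "edges H \<subseteq> [{1..n}]\<^bsup>2\<^esup>" using nsets_mono by blast
  have Gn: "edges G \<subseteq> [{1..n}]\<^bsup>2\<^esup>" using G by (auto simp: typical_def simple_graph_def)
  have finG: "finite (edges G)" using Gn finite_imp_finite_nsets[of "{1..n}" 2] finite_subset by blast
  let ?h = "\<lambda>x y. {x, y} \<in> edges H"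
  have "\<exists>N A B. ?u \<le> N \<and> A \<subseteq> {1..n} \<and> B \<subseteq> {1..n} \<and> A \<inter> B = {} \<and> card A = N \<and> card B = N \<and>
    (\<forall>X Y. X \<subseteq> A \<longrightarrow> Y \<subseteq> B \<longrightarrow> N / K \<le> card X \<longrightarrow> N / K \<le> card Y \<longrightarrow>
      (\<alpha> * p) / 8 * card X * card Y \<le> ecount ?h X Y)"
  proof (rule regular_pair[where h="?h"])
    show "4 * (?u * K ^ J) \<le> card {1..n}" using div_times_less_eq_dividend[of n "4 * K ^ J"] by (simp add: mult_ac)
    show "?h y x" if "?h x y" for x y using that by (simp add: insert_commute)
    show "\<not> ?h x x" for x
    proof
      assume "{x, x} \<in> edges H"
      then have "{x, x} \<in> [{1..n}]\<^bsup>2\<^esup>" using Hn by blast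
      then show False by (simp add: nsets_def)
    qed
    \<comment> \<open>The factor 8 in the hypothesis on \<open>H\<close> cancels the
      \<open>1 / 8\<close> in the lower bound on the edges of \<open>G\<close>.\<close>
    have "(\<alpha> * p) * (real (card {1..n}))\<^sup>2 = 8 * \<alpha> * (p * (real n)\<^sup>2 / 8)" by simp
    also have "\<dots> \<le> 8 * \<alpha> * num_edges G" using G \<alpha> by (intro mult_left_mono) (auto simp: typical_def)
    also have "\<dots> \<le> num_edges H" by (rule H)
    also have "\<dots> \<le> ecount ?h {1..n} {1..n}"
      unfolding num_edges_def using Hn by (intro of_nat_mono card_edges_le_ecount) auto
    finally show "(\<alpha> * p) * (real (card {1..n}))\<^sup>2 \<le> ecount ?h {1..n} {1..n}" .
    show "ecount ?h X Y \<le> 8 * p * (real ?u)\<^sup>2" if "X \<subseteq> {1..n}" "Y \<subseteq> {1..n}" "X \<inter> Y = {}" "card X = ?u" "card Y = ?u" for X Y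
    proof -
      have "finite X" "finite Y" using that(1,2) finite_subset[OF _ finite_atLeastAtMost] by blast+
      then have "ecount ?h X Y = card (edges H \<inter> cross X Y)" using that by (intro ecount_eq_card_cross)
      also have "\<dots> \<le> card (edges G \<inter> cross X Y)" using Hs finG by (intro card_mono) auto
      finally have "real (ecount ?h X Y) \<le> card (edges G \<inter> cross X Y)" by simp
      also have "\<dots> \<le> 8 * p * (real ?u)\<^sup>2" using G that unfolding typical_def by blast
      finally show ?thesis .
    qed
    show "4 * (8 * p) < (1 + 1 / (2 * (real K)\<^sup>2)) ^ J * (\<alpha> * p)"
      using mult_strict_right_mono[OF J p(1)] by (simp add: mult_ac)
    show "0 < ?u" by (rule part_size_ge)
    show "0 < \<alpha> * p" using \<alpha> p by simp
    show "2 \<le> K" using K by simp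
  qed simp
  then obtain N A B where AB: "?u \<le> N" "A \<subseteq> {1..n}" "B \<subseteq> {1..n}" "A \<inter> B = {}" "card A = N" "card B = N"
    and reg: "\<forall>X Y. X \<subseteq> A \<longrightarrow> Y \<subseteq> B \<longrightarrow> N / K \<le> card X \<longrightarrow> N / K \<le> card Y \<longrightarrow>
      (\<alpha> * p) / 8 * card X * card Y \<le> ecount ?h X Y" by (elim exE conjE) (rule that)
  have finAB: "finite A" "finite B" using AB(2,3) finite_subset[OF _ finite_atLeastAtMost] by blast+
  have N: "\<delta> * n \<le> N" "N \<le> n" using AB(1) part_size_ge(1) card_mono[OF _ AB(2)] AB(5) by auto
  define h where "h x y \<longleftrightarrow> ?h x y \<and> (x \<in> A \<and> y \<in> B \<or> x \<in> B \<and> y \<in> A)" for x y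
  define g where "g x y \<longleftrightarrow> {x, y} \<in> edges G" for x y
  interpret grid_host A B h g N b "hitting_steps" s "\<alpha> * p / 8" "1 / K" "\<kappa> * p * N" "codegree_bound N" "8 * p * n" "8 * p\<^sup>2 * n"
  proof
    show "h y x" if "h x y" for x y using that by (auto simp: h_def insert_commute)
    show "x \<in> A \<and> y \<in> B \<or> x \<in> B \<and> y \<in> A" if "h x y" for x y using that by (auto simp: h_def)
    show "g x y" if "h x y" for x y using that Hs by (auto simp: h_def g_def)
    show "\<alpha> * p / 8 * card X * card Y \<le> ecount h X Y"
      if "X \<subseteq> A" "Y \<subseteq> B" "1 / K * N \<le> card X" "1 / K * N \<le> card Y" for X Y
    proof -
      have "ecount h X Y = ecount ?h X Y"
        unfolding ecount_def using that by (intro sum.cong refl arg_cong[where f=card]) (auto simp: h_def)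
      then show ?thesis using reg that by simp
    qed
    fix X S V :: "nat set" and F R
    assume *: "X \<subseteq> A \<union> B" "S \<subseteq> A \<union> B" "V \<subseteq> A \<union> B" "X \<inter> S = {}" "X \<inter> V = {}"
      "S \<inter> V = {}" "card V \<le> N" "card X \<le> b" "card S = b"
      "\<And>x v. F x v \<Longrightarrow> h x v" "\<And>w. w \<in> S \<Longrightarrow> R w \<subseteq> X"
      "\<And>w. w \<in> S \<Longrightarrow> card {v\<in>V. \<forall>x\<in>R w. \<not> F x v} \<le> 4 * (1 / K) * N"
      "\<And>w. w \<in> S \<Longrightarrow> \<kappa> * p * N / 4 \<le> card {v\<in>V. g w v \<and> (\<forall>x\<in>R w. \<not> F x v)}"
    \<comment> \<open>\<open>F\<close> may be directed, but \<open>concentrated\<close> speaks of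
      unordered edges. Since \<open>X\<close> and \<open>V\<close> are disjoint, an unordered pair
      determines its orientation.\<close>
    define F' where "F' = (\<lambda>(x, v). {x, v}) ` {(x, v). x \<in> X \<and> v \<in> V \<and> F x v}"
    have F': "{x, v} \<in> F' \<longleftrightarrow> F x v" if "x \<in> X" "v \<in> V" for x v
      using that *(5) by (auto simp: F'_def doubleton_eq_iff image_iff)
    have "F' \<subseteq> edges G \<inter> cross X V" using *(10) Hs by (auto simp: F'_def cross_def h_def)
    moreover have "R w \<subseteq> X \<and> card {v\<in>V. \<forall>x\<in>R w. {x, v} \<notin> F'} \<le> 4 * (1 / K) * N \<and>
        \<kappa> * p * N / 4 \<le> card {v\<in>V. {w, v} \<in> edges G \<and> (\<forall>x\<in>R w. {x, v} \<notin> F')}" if w: "w \<in> S" for w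
    proof -
      have 1: "{v\<in>V. \<forall>x\<in>R w. {x, v} \<notin> F'} = {v\<in>V. \<forall>x\<in>R w. \<not> F x v}" using F' *(11)[OF w] by blast
      have 2: "{v\<in>V. {w, v} \<in> edges G \<and> (\<forall>x\<in>R w. {x, v} \<notin> F')} = {v\<in>V. g w v \<and> (\<forall>x\<in>R w. \<not> F x v)}"
        unfolding g_def using F' *(11)[OF w] by blast
      show ?thesis unfolding 1 2 using *(11-13)[OF w] by blast
    qed
    moreover have "A \<union> B \<subseteq> {1..n}" using AB by blast
    ultimately have "concentrated n N b (4 * (1 / K)) (\<kappa> * p * N / 4) G X S V"
      unfolding concentrated_def using *(1-9) by blast
    then show False using G N by (auto simp: typical_def)
  next
    fix x
    show "card {y. h x y} \<le> 8 * p * n"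
    proof (cases "x \<in> {1..n}")
      case True
      have "card {y. h x y} \<le> card ({y\<in>{1..n} - {x}. {x, y} \<in> edges G})"
        using AB Hs by (intro card_mono) (auto simp: h_def)
      also have "\<dots> = ecount (\<lambda>x y. {x, y} \<in> edges G) {x} ({1..n} - {x})" by (simp add: ecount_def)
      also have "\<dots> = card (edges G \<inter> cross {x} ({1..n} - {x}))" by (intro ecount_eq_card_cross) auto
      finally have "real (card {y. h x y}) \<le> card (edges G \<inter> cross {x} ({1..n} - {x}))" by simp
      also have "\<dots> \<le> 8 * p * n" using G True by (auto simp: typical_def)
      finally show ?thesis .
    next
      case False
      then have "{y. h x y} = {}" using AB by (auto simp: h_def)
      then show ?thesis using p by simp
    qed
    fix y assume xy: "x \<noteq> y"
    show "card {z. h x z \<and> h y z} \<le> 8 * p\<^sup>2 * n"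
    proof (cases "x \<in> {1..n} \<and> y \<in> {1..n}")
      case True
      have "card {z. h x z \<and> h y z} \<le> card {z\<in>{1..n} - {x, y}. {x, z} \<in> edges G \<and> {y, z} \<in> edges G}"
        using AB Hs by (intro card_mono) (auto simp: h_def)
      then have "real (card {z. h x z \<and> h y z}) \<le> card {z\<in>{1..n} - {x, y}. {x, z} \<in> edges G \<and> {y, z} \<in> edges G}" by simp
      also have "\<dots> \<le> 8 * p\<^sup>2 * n" using G True xy by (auto simp: typical_def)
      finally show ?thesis .
    next
      case False
      then have "{z. h x z \<and> h y z} = {}" using AB by (auto simp: h_def)
      then have "real (card {z. h x z \<and> h y z}) = 0" by (simp only: card.empty of_nat_0)
      then show ?thesis using p by (simp only:) simp
    qed
  next
    show "8 * (\<kappa> * p * N) \<le> \<alpha> * p / 8 * N" by (simp add: \<kappa>_def)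
  qed (use finAB AB pN(5)[OF N] num_pos[OF N] num_r[OF N] num_b[OF N] num_D[OF N] num_s[OF N s(2)] in \<open>assumption | simp\<close>)+
  obtain F where F: "inj_on (\<lambda>(i, j). F i j) ({..<s} \<times> {..<s})"
    "\<And>i j. Suc i < s \<Longrightarrow> j < s \<Longrightarrow> h (F i j) (F (Suc i) j)"
    "\<And>i j. i < s \<Longrightarrow> Suc j < s \<Longrightarrow> h (F i j) (F i (Suc j))"
    "\<And>i j. i < s \<Longrightarrow> j < s \<Longrightarrow> \<exists>y. h (F i j) y" using grid_exists s by auto
  show ?thesis
  proof (rule contains_grid[OF F(1)])
    fix i j assume "i < s" "j < s"
    then obtain y where "{F i j, y} \<in> edges H" using F(4) by (auto simp: h_def)
    then have "{F i j, y} \<in> [verts H]\<^bsup>2\<^esup>" using Hs by blast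
    then show "F i j \<in> verts H" by (auto simp: nsets_def)
  qed (use F(2,3) in \<open>auto simp: h_def\<close>)
qed

end

section \<open>Probability of being typical\<close>

context grid_scale
begin

text \<open>Five kinds of failure, each of probability at most \<open>1 / n\<close>.\<close>

lemma prob_not_typical:
  assumes n32: "32 \<le> n" and \<delta>2: "1 \<le> \<delta>\<^sup>2 * ln n"
  shows "measure_pmf.prob (gnp n p) {G. \<not> typical n p G} \<le> 5 / n"
proof -
  let ?u = "n div (4 * K ^ J)" and ?P = "measure_pmf.prob (gnp n p)"
  define E1 where "E1 = {G :: nat ugraph. num_edges G \<le> p * (real n)\<^sup>2 / 8}"
  define E2 where "E2 = {G :: nat ugraph. \<exists>X Y. X \<subseteq> {1..n} \<and> Y \<subseteq> {1..n} \<and> X \<inter> Y = {} \<and> card X = ?u \<and> card Y = ?u \<and>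
     8 * p * (real ?u)\<^sup>2 \<le> card (edges G \<inter> cross X Y)}"
  define E3 where "E3 = {G :: nat ugraph. \<exists>x\<in>{1..n}. 8 * p * n \<le> card (edges G \<inter> cross {x} ({1..n} - {x}))}"
  define E4 where "E4 = {G :: nat ugraph. \<exists>x\<in>{1..n}. \<exists>y\<in>{1..n}. x \<noteq> y \<and>
      8 * p\<^sup>2 * n \<le> card {z\<in>{1..n} - {x, y}. {x, z} \<in> edges G \<and> {y, z} \<in> edges G}}"
  define I where "I = {N. \<delta> * n \<le> real N \<and> N \<le> n}"
  define E5 where "E5 N = {G. \<exists>X S V. concentrated n N b (4 * (1 / K)) (\<kappa> * p * N / 4) G X S V}" for N
  have n0: "0 < real n" using n32 by simp
  have exp_ln_n: "exp (- ln n) = 1 / n" using n0 by (simp add: exp_minus inverse_eq_divide)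
  have ln_le: "ln n \<le> n" using n0 ln_le_minus_one[of "real n"] by simp
  have p2n: "ln n \<le> p\<^sup>2 * n" using pn density_const mult_right_mono[of 1 density_const "ln n"] ln_n_1 by linarith
  have "p\<^sup>2 \<le> p" using p by (simp add: power2_eq_square mult_left_le_one_le)
  then have "p\<^sup>2 * n \<le> p * n" by (intro mult_right_mono) auto
  then have p1n: "ln n \<le> p * n" using p2n by linarith
  have pnn: "n * ln n \<le> p * (real n)\<^sup>2" using mult_left_mono[OF p1n, of n] by (simp add: power2_eq_square mult_ac)
  have "?P E1 \<le> exp (- (p * (real n)\<^sup>2 / 32))" unfolding E1_def using p n32 by (intro prob_few_edges) auto
  also have "\<dots> \<le> exp (- ln n)"
  proof -
    have "32 * ln n \<le> n * ln n" using n32 ln_n_1 by (intro mult_right_mono) auto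
    then show ?thesis using pnn by simp
  qed
  finally have P1: "?P E1 \<le> 1 / n" by (simp add: exp_ln_n)
  have exp1: "2 \<le> exp (1::real)" using exp_ge_add_one_self[of 1] by simp
  have "?P E2 \<le> 4 ^ n * exp (- (9 * p * (real ?u)\<^sup>2))" unfolding E2_def using p by (intro prob_dense_pair) auto
  also have "\<dots> \<le> exp (2 * n) * exp (- (9 * p * (real ?u)\<^sup>2))"
  proof -
    have "4 \<le> exp (2::real)" using mult_mono[OF exp1 exp1] by (simp add: exp_add[symmetric])
    then have "4 ^ n \<le> exp (2::real) ^ n" by (intro power_mono) auto
    then show ?thesis by (simp add: exp_of_nat_mult[symmetric] mult.commute)
  qed
  also have "\<dots> \<le> exp (- ln n)"
  proof -
    have "(\<delta> * n)\<^sup>2 \<le> (real ?u)\<^sup>2" using part_size_ge \<delta> by (intro power_mono) auto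
    then have "9 * p * (\<delta> * n)\<^sup>2 \<le> 9 * p * (real ?u)\<^sup>2" using p by (intro mult_left_mono) auto
    moreover have "\<delta>\<^sup>2 * (n * ln n) \<le> \<delta>\<^sup>2 * (p * (real n)\<^sup>2)" using pnn by (intro mult_left_mono) auto
    moreover have "real n * 1 \<le> real n * (\<delta>\<^sup>2 * ln n)" using \<delta>2 by (intro mult_left_mono) auto
    ultimately have "9 * n \<le> 9 * p * (real ?u)\<^sup>2" by (simp add: power_mult_distrib mult_ac)
    then show ?thesis using ln_le by (simp add: exp_add[symmetric])
  qed
  finally have P2: "?P E2 \<le> 1 / n" by (simp add: exp_ln_n)
  have "?P E3 \<le> n * exp (- (9 * p * n))" unfolding E3_def using p by (intro prob_high_degree) auto
  also have "\<dots> = exp (ln n) * exp (- (9 * p * n))" using n0 by simp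
  also have "\<dots> \<le> exp (- ln n)" using p1n ln_n_1 by (simp add: exp_add[symmetric])
  finally have P3: "?P E3 \<le> 1 / n" by (simp add: exp_ln_n)
  have "?P E4 \<le> (real n)\<^sup>2 * exp (- (9 * p\<^sup>2 * n))" unfolding E4_def using p by (intro prob_high_codegree) auto
  also have "\<dots> = exp (ln n) * exp (ln n) * exp (- (9 * p\<^sup>2 * n))" using n0 by (simp add: power2_eq_square)
  also have "\<dots> = exp (2 * ln n - 9 * (p\<^sup>2 * n))" by (simp add: exp_add[symmetric] mult_ac)
  also have "\<dots> \<le> exp (- ln n)" using p2n ln_n_1 unfolding exp_le_cancel_iff by linarith
  finally have P4: "?P E4 \<le> 1 / n" by (simp add: exp_ln_n)
  have finI: "finite I" and cI: "card I \<le> n + 1"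
  proof -
    have "I \<subseteq> {..n}" by (auto simp: I_def)
    then show "finite I" "card I \<le> n + 1" using finite_subset card_mono[of "{..n}" I] by auto
  qed
  have "?P (\<Union>N\<in>I. E5 N) \<le> (\<Sum>N\<in>I. exp (- 5 * real n))"
  proof (rule prob_Union_le[OF finI, of _ E5])
    fix N assume "N \<in> I"
    then have N: "\<delta> * n \<le> real N" "N \<le> n" by (auto simp: I_def)
    have "?P (E5 N) \<le> 8 ^ n * exp (- (p * b * N))"
      unfolding E5_def
    proof (rule prob_concentrated)
      show "0 \<le> \<kappa> * p * N / 4" using \<kappa> p by simp
    qed (use p K num_b[OF N] num_P[OF N] in auto)
    \<comment> \<open>\<open>p * b * N\<close> is at least
      \<open>ln n * \<delta> * n \<ge> 8 * n\<close>, which beats both the \<open>8 ^ n\<close>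
      choices of vertex sets and the union over \<open>N\<close>.\<close>
    also have "\<dots> \<le> exp (3 * real n) * exp (- (8 * real n))"
    proof (intro mult_mono)
      have "8 \<le> exp (3::real)" using mult_mono[OF mult_mono[OF exp1 exp1] exp1] by (simp add: exp_add[symmetric])
      then have "8 ^ n \<le> exp (3::real) ^ n" by (intro power_mono) auto
      then show "8 ^ n \<le> exp (3 * real n)" by (simp add: exp_of_nat_mult[symmetric] mult.commute)
      have "ln n \<le> p * b" using exc_size_ge' p by (simp add: divide_le_eq mult.commute)
      then have "ln n * (\<delta> * n) \<le> p * b * N" using N(1) \<delta> p ln_n_1 by (intro mult_mono) auto
      moreover have "8 * real n \<le> (\<delta> * ln n) * n" using ln_n(2) K(1) by (intro mult_right_mono) auto
      ultimately show "exp (- (p * b * N)) \<le> exp (- (8 * real n))" by (simp add: mult_ac)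
    qed auto
    also have "\<dots> = exp (- 5 * real n)" by (simp add: exp_add[symmetric])
    finally show "?P (E5 N) \<le> exp (- 5 * real n)" .
  qed simp
  also have "\<dots> = card I * exp (- 5 * real n)" by simp
  also have "\<dots> \<le> exp n * exp (- 5 * real n)"
  proof (rule mult_right_mono)
    show "card I \<le> exp (real n)" using cI exp_ge_add_one_self[of "real n"] by linarith
  qed simp
  also have "\<dots> \<le> exp (- ln n)" using ln_le by (simp add: exp_add[symmetric])
  finally have P5: "?P (\<Union>N\<in>I. E5 N) \<le> 1 / n" by (simp add: exp_ln_n)
  \<comment> \<open>Restricting to the support makes \<open>G\<close> a simple graph on
    \<open>{1..n}\<close>.\<close>
  have "?P {G. \<not> typical n p G} = ?P ({G. \<not> typical n p G} \<inter> set_pmf (gnp n p))" by (rule measure_Int_set_pmf[symmetric])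
  also have "\<dots> \<le> ?P (E1 \<union> E2 \<union> E3 \<union> E4 \<union> (\<Union>N\<in>I. E5 N))"
  proof (rule measure_pmf.finite_measure_mono)
    show "{G. \<not> typical n p G} \<inter> set_pmf (gnp n p) \<subseteq> E1 \<union> E2 \<union> E3 \<union> E4 \<union> (\<Union>N\<in>I. E5 N)"
    proof
      fix G assume G: "G \<in> {G. \<not> typical n p G} \<inter> set_pmf (gnp n p)"
      then have sg: "simple_graph G \<and> verts G = {1..n}" using simple_graph_gnp[of G n p] by simp
      show "G \<in> E1 \<union> E2 \<union> E3 \<union> E4 \<union> (\<Union>N\<in>I. E5 N)"
      proof (rule ccontr)
        assume neg: "G \<notin> E1 \<union> E2 \<union> E3 \<union> E4 \<union> (\<Union>N\<in>I. E5 N)"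
        have "typical n p G"
          unfolding typical_def
        proof (intro conjI allI impI ballI)
          show "simple_graph G" "verts G = {1..n}" using sg by auto
          show "p * (real n)\<^sup>2 / 8 \<le> num_edges G" using neg by (simp add: E1_def)
          show "card (edges G \<inter> cross X Y) \<le> 8 * p * (real ?u)\<^sup>2"
            if "X \<subseteq> {1..n}" "Y \<subseteq> {1..n}" "X \<inter> Y = {}" "card X = ?u" "card Y = ?u" for X Y
          proof (rule ccontr)
            assume "\<not> ?thesis"
            then have "G \<in> E2" unfolding E2_def using that by (rule_tac CollectI, rule_tac exI[of _ X], rule_tac exI[of _ Y]) simp
            then show False using neg by simp
          qed
          show "card (edges G \<inter> cross {x} ({1..n} - {x})) \<le> 8 * p * n" if "x \<in> {1..n}" for x
            using neg that by (force simp: E3_def)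
          show "card {z\<in>{1..n} - {x, y}. {x, z} \<in> edges G \<and> {y, z} \<in> edges G} \<le> 8 * p\<^sup>2 * n"
            if "x \<in> {1..n}" "y \<in> {1..n}" "x \<noteq> y" for x y
          proof (rule ccontr)
            assume "\<not> ?thesis"
            then have "G \<in> E4" unfolding E4_def using that by (rule_tac CollectI, rule_tac bexI[of _ x], rule_tac bexI[of _ y]) auto
            then show False using neg by simp
          qed
          show "\<not> concentrated n N b (4 * (1 / K)) (\<kappa> * p * N / 4) G X S V" if "\<delta> * n \<le> real N" "N \<le> n" for N X S V
            using neg that unfolding E5_def I_def by blast
        qed
        then show False using G by simp
      qed
    qed
  qed simp
  also have "\<dots> \<le> ?P E1 + ?P E2 + ?P E3 + ?P E4 + ?P (\<Union>N\<in>I. E5 N)"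
    by (intro order_trans[OF measure_Un_le] add_mono order_refl) auto
  also have "\<dots> \<le> 5 / n" using P1 P2 P3 P4 P5 by simp
  finally show ?thesis .
qed

end

section \<open>Fixing the constants and passing to the limit\<close>

lemma grid_constants_exist:
  fixes \<alpha> :: real
  assumes "0 < \<alpha>" "\<alpha> \<le> 1 / 8"
  shows "\<exists>K J. grid_constants \<alpha> K J"
proof -
  define K where "K = nat \<lceil>4 * exp (1024 / \<alpha>)\<rceil> + 8"
  have "4 * exp (1024 / \<alpha>) \<le> K" unfolding K_def by linarith
  moreover have "0 < K" by (simp add: K_def)
  ultimately have "ln (exp (1024 / \<alpha>)) \<le> ln (K / 4)" by (subst ln_le_cancel_iff) auto
  then have K: "1024 / \<alpha> \<le> ln (K / 4)" by simp
  from \<open>0 < K\<close> obtain J where "32 / \<alpha> < (1 + 1 / (2 * (real K)\<^sup>2)) ^ J"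
    using real_arch_pow[of "1 + 1 / (2 * (real K)\<^sup>2)" "32 / \<alpha>"] by auto
  then have "grid_constants \<alpha> K J" using assms K by unfold_locales (auto simp: K_def field_simps)
  then show ?thesis by blast
qed

theorem theorem1p1:
  fixes \<alpha>' :: real
  assumes "\<alpha>' > 0"
  shows "\<exists>c::real. \<exists>C::real. c > 0 \<and> C \<ge> 1 \<and>
    (\<forall>p :: nat \<Rightarrow> real.
       (\<forall>n. 0 < p n \<and> p n \<le> 1) \<longrightarrow>
       (\<forall>\<^sub>F n in sequentially. p n \<ge> C * sqrt (ln (real n) / real n)) \<longrightarrow>
       (\<lambda>n. measure_pmf.prob (gnp n (p n))
          {G. \<forall>H. subgraph H G \<longrightarrow> real (num_edges H) \<ge> \<alpha>' * real (num_edges G) \<longrightarrow>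
              (\<forall>s::nat. s \<ge> 1 \<longrightarrow> real s \<le> c / p n \<longrightarrow> contains_copy H (grid_graph s s))})
         \<longlonglongrightarrow> 1)"
proof -
  \<comment> \<open>The minimum ensures \<open>\<alpha> \<le> 1 / 8\<close>; the division by 8
    matches the hypothesis of \<open>typical_contains_grid\<close>.\<close>
  define \<alpha> where "\<alpha> = min \<alpha>' 1 / 8"
  have \<alpha>_bounds: "0 < \<alpha>" "\<alpha> \<le> 1 / 8" "8 * \<alpha> \<le> \<alpha>'" using assms by (auto simp: \<alpha>_def)
  obtain K J where "grid_constants \<alpha> K J" using grid_constants_exist \<alpha>_bounds by blast
  then interpret grid_constants \<alpha> K J .
  show ?thesis
  proof (rule exI[of _ size_const], rule exI[of _ density_const], intro conjI allI impI)
    show "size_const > 0" "density_const \<ge> 1" by (rule size_const density_const)+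
    fix p :: "nat \<Rightarrow> real"
    assume p: "\<forall>n. 0 < p n \<and> p n \<le> 1" and pC: "\<forall>\<^sub>F n in sequentially. p n \<ge> density_const * sqrt (ln (real n) / real n)"
    let ?S = "\<lambda>n. {G. \<forall>H. subgraph H G \<longrightarrow> real (num_edges H) \<ge> \<alpha>' * real (num_edges G) \<longrightarrow>
              (\<forall>s::nat. s \<ge> 1 \<longrightarrow> real s \<le> size_const / p n \<longrightarrow> contains_copy H (grid_graph s s))}"
    have lim: "filterlim (\<lambda>n. ln (real n)) at_top sequentially"
      by (rule filterlim_compose[OF ln_at_top filterlim_real_sequentially])
    have "\<forall>\<^sub>F n in sequentially. max (max \<mu> (K / \<delta>)) (1 / \<delta>\<^sup>2) \<le> ln (real n)"
      using lim unfolding filterlim_at_top by blast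
    then have low: "\<forall>\<^sub>F n in sequentially. 1 - 5 / real n \<le> measure_pmf.prob (gnp n (p n)) (?S n)"
      using pC eventually_ge_at_top[of 32]
    proof eventually_elim
      case (elim n)
      have ln: "\<mu> \<le> ln n" "K \<le> \<delta> * ln n" "1 \<le> \<delta>\<^sup>2 * ln n"
        using elim(1) \<delta> by (auto simp: divide_le_eq mult.commute)
      have ln0: "0 \<le> ln n" using ln \<mu> by linarith
      have "density_const * ln n \<le> (p n)\<^sup>2 * n"
      proof -
        have "(density_const * sqrt (ln n / n))\<^sup>2 \<le> (p n)\<^sup>2" using elim(2) density_const ln0 by (intro power_mono) auto
        then have "density_const\<^sup>2 * (ln n / n) \<le> (p n)\<^sup>2" using ln0 by (simp add: power_mult_distrib)
        then have "density_const\<^sup>2 * ln n \<le> (p n)\<^sup>2 * n" using elim(3) by (simp add: field_simps)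
        \<comment> \<open>Squaring the lower bound on \<open>p\<close> produces
          \<open>density_const\<^sup>2\<close>, which is at least \<open>density_const\<close>
          because the constant is at least 1.\<close>
        moreover have "density_const * ln n \<le> density_const\<^sup>2 * ln n"
          using density_const ln0 by (intro mult_right_mono) (auto simp: power2_eq_square)
        ultimately show ?thesis by linarith
      qed
      then interpret grid_scale \<alpha> K J n "p n" using p ln by unfold_locales auto
      have "1 - 5 / n \<le> 1 - measure_pmf.prob (gnp n (p n)) {G. \<not> typical n (p n) G}"
        using prob_not_typical[OF elim(3) ln(3)] by simp
      also have "\<dots> = measure_pmf.prob (gnp n (p n)) (UNIV - {G. \<not> typical n (p n) G})"
        using measure_pmf.prob_compl[of "{G. \<not> typical n (p n) G}" "gnp n (p n)"] by simp
      also have "\<dots> \<le> measure_pmf.prob (gnp n (p n)) (?S n)"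
      proof (rule measure_pmf.finite_measure_mono)
        show "UNIV - {G. \<not> typical n (p n) G} \<subseteq> ?S n"
        proof (intro subsetI CollectI allI impI)
          fix G H s
          assume G: "G \<in> UNIV - {G. \<not> typical n (p n) G}" and H: "subgraph H G" "\<alpha>' * real (num_edges G) \<le> real (num_edges H)"
            and s: "1 \<le> s" "real s \<le> size_const / p n"
          have "8 * \<alpha> * num_edges G \<le> \<alpha>' * num_edges G" using \<alpha>_bounds by (intro mult_right_mono) auto
          then show "contains_copy H (grid_graph s s)"
            using G H s by (intro typical_contains_grid) auto
        qed
      qed simp
      finally show ?case .
    qed
    show "(\<lambda>n. measure_pmf.prob (gnp n (p n)) (?S n)) \<longlonglongrightarrow> 1"
    proof (rule tendsto_sandwich[OF low])
      show "\<forall>\<^sub>F n in sequentially. measure_pmf.prob (gnp n (p n)) (?S n) \<le> 1" by simp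
      have "(\<lambda>n. 5 / real n) \<longlonglongrightarrow> 0" by (rule lim_const_over_n)
      from tendsto_diff[OF tendsto_const[of 1] this] show "(\<lambda>n. 1 - 5 / real n) \<longlonglongrightarrow> 1" by simp
    qed simp
  qed
qed

end
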